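(* Let $\Sigma$ be a surface of genus $g$ with $n+1$ boundary components and framing $f$. Assume that the set $\mathrm{SolKV}^f_{(g,n+1)}$ is nonempty. Then it carries a free and transitive action of the group $\mathrm{KV}^f_{(g,n+1)}$ by right translations and a free and transitive action of the group $\mathrm{KRV}^f_{(g,n+1)}$ by left translations. Every element $\tilde F\in\mathrm{SolKV}^f_{(g,n+1)}$ defines a group isomorphism $\mathrm{KRV}^f_{(g,n+1)}\to\mathrm{KV}^f_{(g,n+1)}$, $\tilde G\mapsto\tilde H=\tilde F^{-1}\tilde G\tilde F$. This isomorphism has the property that $h^H=h^G$ and $h^H_j=h^G_j$ for $j=1,\dots,n$ (i.e. it preserves Duflo functions).
   Context: $\mathbb{K}$ is a field of characteristic zero; $\Sigma$ is a compact connected oriented surface of genus $g$ with labelled boundary components $\partial_0\Sigma,\dots,\partial_n\Sigma$, $(g,n)\neq(0,0)$, $*\in\partial_0\Sigma$, $\pi=\pi_1(\Sigma,* )$. Fix a standard generating system: a free generating set $\alpha_i,\beta_i$ ($1\le i\le g$), $\gamma_j$ ($1\le j\le n$) of $\pi$ represented by simple loops meeting only at $*$, with $\gamma_j$ freely homotopic to $\partial_j\Sigma$ with positive (boundary) orientation and $\gamma_0=\prod_i\alpha_i\beta_i\alpha_i^{-1}\beta_i^{-1}\prod_j\gamma_j$ the loop around $\partial_0\Sigma$ with negative orientation. A framing $f$ is a homotopy class of trivializations of the oriented bundle $T\Sigma$; $\mathrm{rot}^f(\alpha_i)$ etc. are the rotation numbers of the simple closed curves freely homotopic to these elements. $A=\mathbb{K}\langle\langle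 x_i,y_i,z_j\rangle\rangle$ ($1\le i\le g$, $1\le j\le n$) with weights $\mathrm{wt}(x_i)=\mathrm{wt}(y_i)=1$, $\mathrm{wt}(z_j)=2$; $L\subset A$ is the completed free Lie algebra on the generators and $\exp(L)\subset A$ the group of group-like elements. $|A|=A/[A,A]$, with $[A,A]$ the closed span of commutators, and $|a|$ is the class of $a$. $\mathrm{Aut}^+(L)$ is the group of continuous automorphisms $F$ of $L$ (extended to $A$ and $|A|$) with $F(x_i)-x_i,F(y_i)-y_i$ of weight $\ge2$ and $F(z_j)-z_j$ of weight $\ge3$. $\mathrm{tAut}^+(L)$ is the group of $\tilde F=(F,f_1,\dots,f_n)$ with $F\in\mathrm{Aut}^+(L)$, $f_j\in\exp(L)$, $F(z_j)=f_j^{-1}z_jf_j$, and product $\tilde F\tilde G=(FG,f_1F(g_1),\dots,f_nF(g_n))$. For a generator $w$ let $d_w\colon A\to A$ be defined by $a=\varepsilon(a)+\sum_wd_w(a)w$ ($\varepsilon(a)$ the constant term). For a derivation $u$ of $L$ of positive weight put $\mathsf{div}(u)=\sum_w|d_wu(w)|$, and define $\mathsf{j}\colon\mathrm{Aut}^+(L)\to|A|$ by $\mathsf{j}(\exp u)=\sum_{k\ge0}\frac{1}{(k+1)!}u^k(\mathsf{div}(u))$. Put $r(s)=\log((e^s-1)/s)$, $\mathbf{r}=\sum_i|r(x_i)+r(y_i)|$, $\mathbf{p}^f=\sum_i|\mathrm{rot}^f(\alpha_i)y_i-\mathrm{rot}^f(\beta_i)x_i|$, $\mathsf{c}^f(\tilde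 F)=\sum_j\mathrm{rot}^f(\gamma_j)|\log f_j|$, $\omega=\sum_i[x_i,y_i]+\sum_jz_j$, $\xi=\log\big(\prod_i(e^{x_i}e^{y_i}e^{-x_i}e^{-y_i})\prod_je^{z_j}\big)$, and $$\mathsf{j}^f_{\mathrm{gr}}(\tilde G)=\mathsf{j}(G)-\mathsf{c}^f(\tilde G),\quad \mathsf{j}^f(\tilde G)=\mathsf{j}(G)-\mathsf{c}^f(\tilde G)+G(\mathbf{r}-\mathbf{p}^f)-(\mathbf{r}-\mathbf{p}^f),\quad R^f(\tilde F)=\mathsf{j}^f_{\mathrm{gr}}(\tilde F)+F(\mathbf{r}-\mathbf{p}^f).$$ In the following, $h_j\in s\mathbb{K}[[s]]$ and $h\in s^2\mathbb{K}[[s]]$: - $\mathrm{SolKV}^f_{(g,n+1)}$ is the set of $\tilde F\in\mathrm{tAut}^+(L)$ with $F(\xi)=\omega$ and $R^f(\tilde F)=\sum_j|h_j(z_j)|-|h(\omega)|$ for some $h_j,h$; - $\mathrm{KV}^f_{(g,n+1)}$ is the subgroup of $\tilde G\in\mathrm{tAut}^+(L)$ with $G(\xi)=\xi$ and $\mathsf{j}^f(\tilde G)=\sum_j|h_j(z_j)|-|h(\xi)|$ for some $h_j,h$; - $\mathrm{KRV}^f_{(g,n+1)}$ is the subgroup of $\tilde G\in\mathrm{tAut}^+(L)$ with $G(\omega)=\omega$ and $\mathsf{j}^f_{\mathrm{gr}}(\tilde G)=\sum_j|h_j(z_j)|-|h(\omega)|$ for some $h_j,h$. The functions $h_j,h$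 are called Duflo functions of the element and written $h^G_j,h^G$. "Preserves Duflo functions" means: if $h_j,h$ are Duflo functions for $\tilde G$ they are also Duflo functions for $\tilde H$. *)

theory Defs
  imports
    "HOL-Complex_Analysis.Complex_Analysis"
    "HOL-Computational_Algebra.Formal_Power_Series"
    "HOL-Algebra.Group_Action"
begin

text \<open>
  The constructors \<open>X i\<close>, \<open>Y i\<close>, \<open>Z j\<close> index both the topological generators
  \<open>\<alpha>\<^sub>i, \<beta>\<^sub>i, \<gamma>\<^sub>j\<close> of the fundamental group and the formal variables
  \<open>x\<^sub>i, y\<^sub>i, z\<^sub>j\<close>. Indices start at 1.
\<close>

datatype gen = X nat | Y nat | Z nat

definition gens :: "nat \<Rightarrow> nat \<Rightarrow> gen set" where
  "gens g n = X ` {1..g} \<union> Y ` {1..g} \<union> Z ` {1..n}"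


section \<open>Framed surfaces\<close>

text \<open>
  A surface is a subset \<open>S\<close> of a Hausdorff space with a set \<open>\<Phi>\<close> of smooth, orientation
  compatible charts with values in the closed upper half plane, which carries the standard
  orientation of \<open>\<complex>\<close>.
\<close>

type_synonym 'p chart = "'p set \<times> ('p \<Rightarrow> complex)"

definition upper_half :: "complex set" where
  "upper_half = {z. 0 \<le> Im z}"

text \<open>
  Real \<open>k\<close>-fold continuous differentiability; \<open>fx\<close> and \<open>fy\<close> are the partial derivatives.
  It is only used for sets \<open>W\<close> that are open in the half plane, where the derivative within
  \<open>W\<close> is unique.
\<close>

primrec Ck_on :: "nat \<Rightarrow> complex set \<Rightarrow> (complex \<Rightarrow> complex) \<Rightarrow> bool" where
  "Ck_on 0 W f = continuous_on W f"
| "Ck_on (Suc k) W f = (\<exists>fx fy.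
     (\<forall>z\<in>W. (f has_derivative (\<lambda>v. Re v *\<^sub>R fx z + Im v *\<^sub>R fy z)) (at z within W)) \<and>
     Ck_on k W fx \<and> Ck_on k W fy)"

definition smooth_on :: "complex set \<Rightarrow> (complex \<Rightarrow> complex) \<Rightarrow> bool" where
  "smooth_on W f \<longleftrightarrow> (\<forall>k. Ck_on k W f)"

definition transition :: "'p chart \<Rightarrow> 'p chart \<Rightarrow> complex \<Rightarrow> complex" where
  "transition c d = snd d \<circ> inv_into (fst c) (snd c)"

definition transition_diff :: "'p chart \<Rightarrow> 'p chart \<Rightarrow> 'p \<Rightarrow> complex \<Rightarrow> complex" where
  "transition_diff c d p =
     frechet_derivative (transition c d) (at (snd c p) within snd c ` (fst c \<inter> fst d))"

text \<open>\<open>Im (cnj v * w)\<close> is the determinant of the pair \<open>v, w\<close> of vectors of \<open>\<real>\<^sup>2 = \<complex>\<close>.\<close>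

definition positive_pair :: "complex \<Rightarrow> complex \<Rightarrow> bool" where
  "positive_pair v w \<longleftrightarrow> Im (cnj v * w) > 0"

definition oriented_atlas :: "'p::t2_space set \<Rightarrow> 'p chart set \<Rightarrow> bool" where
  "oriented_atlas S \<Phi> \<longleftrightarrow>
     (\<forall>(U, \<phi>)\<in>\<Phi>. openin (top_of_set S) U \<and> openin (top_of_set upper_half) (\<phi> ` U) \<and>
        homeomorphism U (\<phi> ` U) \<phi> (inv_into U \<phi>)) \<and>
     (\<Union>(U, \<phi>)\<in>\<Phi>. U) = S \<and>
     (\<forall>c\<in>\<Phi>. \<forall>d\<in>\<Phi>. smooth_on (snd c ` (fst c \<inter> fst d)) (transition c d) \<and>
        (\<forall>p\<in>fst c \<inter> fst d.
           positive_pair (transition_diff c d p 1) (transition_diff c d p \<i>)))"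

definition compact_connected_oriented_surface :: "'p::t2_space set \<Rightarrow> 'p chart set \<Rightarrow> bool" where
  "compact_connected_oriented_surface S \<Phi> \<longleftrightarrow>
     S \<noteq> {} \<and> compact S \<and> connected S \<and> oriented_atlas S \<Phi>"

definition surface_boundary :: "'p::t2_space set \<Rightarrow> 'p chart set \<Rightarrow> 'p set" where
  "surface_boundary S \<Phi> = {p \<in> S. \<exists>(U, \<phi>)\<in>\<Phi>. p \<in> U \<and> Im (\<phi> p) = 0}"

definition boundary_labelling ::
  "'p::t2_space set \<Rightarrow> 'p chart set \<Rightarrow> nat \<Rightarrow> (nat \<Rightarrow> 'p set) \<Rightarrow> bool" where
  "boundary_labelling S \<Phi> n B \<longleftrightarrow>
     bij_betw B {0..n} (components (surface_boundary S \<Phi>))"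

definition simple_loop :: "(real \<Rightarrow> 'p::topological_space) \<Rightarrow> bool" where
  "simple_loop c \<longleftrightarrow> simple_path c \<and> pathfinish c = pathstart c"

text \<open>
  The genus is the maximal number of disjoint simple closed curves in the interior that
  together do not disconnect the surface.
\<close>

definition nonseparating_system ::
  "'p::t2_space set \<Rightarrow> 'p chart set \<Rightarrow> nat \<Rightarrow> (nat \<Rightarrow> real \<Rightarrow> 'p) \<Rightarrow> bool" where
  "nonseparating_system S \<Phi> k C \<longleftrightarrow>
     (\<forall>i<k. simple_loop (C i) \<and> path_image (C i) \<subseteq> S - surface_boundary S \<Phi>) \<and>
     (\<forall>i<k. \<forall>j<k. i \<noteq> j \<longrightarrow> path_image (C i) \<inter> path_image (C j) = {}) \<and>
     connected (S - (\<Union>i<k. path_image (C i)))"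

definition has_genus :: "'p::t2_space set \<Rightarrow> 'p chart set \<Rightarrow> nat \<Rightarrow> bool" where
  "has_genus S \<Phi> g \<longleftrightarrow> (\<forall>k. (\<exists>C. nonseparating_system S \<Phi> k C) \<longleftrightarrow> k \<le> g)"

text \<open>
  In the upper half plane the outward normal followed by \<open>1\<close> is a positive basis. So a
  parametrization of a boundary component has the boundary orientation iff it moves to the
  right in all charts.
\<close>

definition positive_boundary_loop ::
  "'p::t2_space set \<Rightarrow> 'p chart set \<Rightarrow> 'p set \<Rightarrow> (real \<Rightarrow> 'p) \<Rightarrow> bool" where
  "positive_boundary_loop S \<Phi> D \<delta> \<longleftrightarrow>
     simple_loop \<delta> \<and> path_image \<delta> = D \<and>
     (\<forall>t\<in>{0..1}. \<forall>(U, \<phi>)\<in>\<Phi>. \<delta> t \<in> U \<longrightarrow>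
        (\<exists>e>0. strict_mono_on ({0..1} \<inter> {t - e<..<t + e}) (\<lambda>s. Re (\<phi> (\<delta> s)))))"

text \<open>
  A word is a list of letters \<open>(x, True)\<close>, standing for \<open>x\<close>, and \<open>(x, False)\<close>, standing for
  its inverse. Products in the fundamental group are read from left to right.
\<close>

definition word_path :: "'p::t2_space \<Rightarrow> (gen \<Rightarrow> real \<Rightarrow> 'p) \<Rightarrow> (gen \<times> bool) list \<Rightarrow> real \<Rightarrow> 'p" where
  "word_path pt \<theta> w =
     foldr (\<lambda>(x, e) p. (if e then \<theta> x else reversepath (\<theta> x)) +++ p) w (\<lambda>_. pt)"

definition reduced_word :: "(gen \<times> bool) list \<Rightarrow> bool" where
  "reduced_word w \<longleftrightarrow> successively (\<lambda>a b. fst a = fst b \<longrightarrow> snd a = snd b) w"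

definition freely_generates_pi1 ::
  "'p::t2_space set \<Rightarrow> 'p \<Rightarrow> gen set \<Rightarrow> (gen \<Rightarrow> real \<Rightarrow> 'p) \<Rightarrow> bool" where
  "freely_generates_pi1 S pt G \<theta> \<longleftrightarrow>
     (\<forall>x\<in>G. path (\<theta> x) \<and> path_image (\<theta> x) \<subseteq> S \<and> pathstart (\<theta> x) = pt \<and> pathfinish (\<theta> x) = pt) \<and>
     (\<forall>p. path p \<and> path_image p \<subseteq> S \<and> pathstart p = pt \<and> pathfinish p = pt \<longrightarrow>
        (\<exists>w. fst ` set w \<subseteq> G \<and> homotopic_paths S p (word_path pt \<theta> w))) \<and>
     (\<forall>w. fst ` set w \<subseteq> G \<and> reduced_word w \<and> homotopic_paths S (word_path pt \<theta> w) (\<lambda>_. pt) \<longrightarrow>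
        w = [])"

definition gamma0_word :: "nat \<Rightarrow> nat \<Rightarrow> (gen \<times> bool) list" where
  "gamma0_word g n =
     concat (map (\<lambda>i. [(X i, True), (Y i, True), (X i, False), (Y i, False)]) [1..<Suc g]) @
     map (\<lambda>j. (Z j, True)) [1..<Suc n]"

definition standard_generating_system ::
  "'p::t2_space set \<Rightarrow> 'p chart set \<Rightarrow> (nat \<Rightarrow> 'p set) \<Rightarrow> nat \<Rightarrow> nat \<Rightarrow> 'p \<Rightarrow>
   (nat \<Rightarrow> real \<Rightarrow> 'p) \<Rightarrow> (nat \<Rightarrow> real \<Rightarrow> 'p) \<Rightarrow> (nat \<Rightarrow> real \<Rightarrow> 'p) \<Rightarrow> bool" where
  "standard_generating_system S \<Phi> B g n pt \<alpha> \<beta> \<gamma> \<longleftrightarrow>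
     (let \<theta> = case_gen \<alpha> \<beta> \<gamma> in
      freely_generates_pi1 S pt (gens g n) \<theta> \<and>
      (\<forall>x\<in>gens g n. simple_loop (\<theta> x)) \<and>
      (\<forall>x\<in>gens g n. \<forall>y\<in>gens g n. x \<noteq> y \<longrightarrow> path_image (\<theta> x) \<inter> path_image (\<theta> y) = {pt}) \<and>
      (\<forall>j\<in>{1..n}. \<exists>\<delta>. positive_boundary_loop S \<Phi> (B j) \<delta> \<and> homotopic_loops S (\<gamma> j) \<delta>) \<and>
      (\<exists>\<delta>. positive_boundary_loop S \<Phi> (B 0) \<delta> \<and> pathstart \<delta> = pt \<and>
         homotopic_paths S (word_path pt \<theta> (gamma0_word g n)) (reversepath \<delta>)))"

text \<open>
  A trivialization of the oriented tangent bundle is a continuous positive frame: for every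
  chart \<open>c\<close> and point \<open>p\<close> of its domain, \<open>E c p\<close> is the pair of coordinate vectors of the
  frame at \<open>p\<close> with respect to \<open>c\<close>.
\<close>

type_synonym 'p frame = "'p chart \<Rightarrow> 'p \<Rightarrow> complex \<times> complex"

definition trivialization :: "'p::t2_space chart set \<Rightarrow> 'p frame \<Rightarrow> bool" where
  "trivialization \<Phi> E \<longleftrightarrow>
     (\<forall>c\<in>\<Phi>. continuous_on (fst c) (E c) \<and>
        (\<forall>p\<in>fst c. positive_pair (fst (E c p)) (snd (E c p)))) \<and>
     (\<forall>c\<in>\<Phi>. \<forall>d\<in>\<Phi>. \<forall>p\<in>fst c \<inter> fst d.
        E d p = map_prod (transition_diff c d p) (transition_diff c d p) (E c p))"

definition homotopic_trivializations :: "'p::t2_space chart set \<Rightarrow> 'p frame \<Rightarrow> 'p frame \<Rightarrow> bool" where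
  "homotopic_trivializations \<Phi> E E' \<longleftrightarrow>
     (\<exists>H. (\<forall>t\<in>{0..1::real}. trivialization \<Phi> (H t)) \<and>
        (\<forall>c\<in>\<Phi>. continuous_on ({0..1} \<times> fst c) (\<lambda>(t, p). H t c p)) \<and>
        (\<forall>c\<in>\<Phi>. \<forall>p\<in>fst c. H 0 c p = E c p \<and> H 1 c p = E' c p))"

definition framings :: "'p::t2_space chart set \<Rightarrow> 'p frame set set" where
  "framings \<Phi> = {E. trivialization \<Phi> E} //
     {(E, E'). trivialization \<Phi> E \<and> trivialization \<Phi> E' \<and> homotopic_trivializations \<Phi> E E'}"

text \<open>
  \<open>c\<close> is an immersed closed curve whose velocity, expressed in the frame \<open>E\<close>, is the loop \<open>u\<close>
  in \<open>\<complex> - {0}\<close>; its rotation number is the winding number of \<open>u\<close>.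
\<close>

definition has_rotation_number ::
  "'p::t2_space chart set \<Rightarrow> 'p frame \<Rightarrow> (real \<Rightarrow> 'p) \<Rightarrow> int \<Rightarrow> bool" where
  "has_rotation_number \<Phi> E c k \<longleftrightarrow>
     (\<exists>u. path u \<and> pathfinish u = pathstart u \<and> 0 \<notin> path_image u \<and>
        (\<forall>t\<in>{0..1}. \<forall>(U, \<phi>)\<in>\<Phi>. c t \<in> U \<longrightarrow>
           ((\<lambda>s. \<phi> (c s)) has_vector_derivative
              Re (u t) *\<^sub>R fst (E (U, \<phi>) (c t)) + Im (u t) *\<^sub>R snd (E (U, \<phi>) (c t)))
             (at t within {0..1})) \<and>
        winding_number u 0 = of_int k)"

text \<open>The rotation number of the simple closed immersed curves freely homotopic to \<open>a\<close>.\<close>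

definition rot :: "'p::t2_space set \<Rightarrow> 'p chart set \<Rightarrow> 'p frame set \<Rightarrow> (real \<Rightarrow> 'p) \<Rightarrow> int" where
  "rot S \<Phi> f a = (THE k. \<exists>E\<in>f. \<exists>c. simple_loop c \<and> path_image c \<subseteq> S \<and>
     homotopic_loops S a c \<and> has_rotation_number \<Phi> E c k)"


section \<open>Noncommutative formal power series\<close>

typedef (overloaded) ('x, 'k::zero) ncs = "UNIV :: ('x list \<Rightarrow> 'k) set"
  morphisms cf Ncs by simp

lemma cf_Ncs [simp]: "cf (Ncs f) = f"
  by (simp add: Ncs_inverse)

lemma ncs_eqI: "(\<And>w. cf a w = cf b w) \<Longrightarrow> a = b"
  by (metis cf_inject ext)

instantiation ncs :: (type, comm_ring_1) ring_1
begin

definition "0 = Ncs (\<lambda>_. 0)"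
definition "1 = Ncs (\<lambda>w. if w = [] then 1 else 0)"
definition "a + b = Ncs (\<lambda>w. cf a w + cf b w)"
definition "- a = Ncs (\<lambda>w. - cf a w)"
definition "a - b = Ncs (\<lambda>w. cf a w - cf b w)"
definition "a * b = Ncs (\<lambda>w. \<Sum>k\<le>length w. cf a (take k w) * cf b (drop k w))"

lemma cf_simps [simp]:
  "cf 0 w = 0" "cf (a + b) w = cf a w + cf b w" "cf (- a) w = - cf a w"
  "cf (a - b) w = cf a w - cf b w"
  by (simp_all add: zero_ncs_def plus_ncs_def uminus_ncs_def minus_ncs_def)

lemma cf_one: "cf 1 w = (if w = [] then 1 else 0)"
  by (simp add: one_ncs_def)

lemma cf_mult: "cf (a * b) w = (\<Sum>k\<le>length w. cf a (take k w) * cf b (drop k w))"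
  by (simp add: times_ncs_def)

instance
proof
  fix a b c :: "('a, 'b) ncs"
  show "a * b * c = a * (b * c)"
  proof (rule ncs_eqI)
    fix w
    let ?f = "\<lambda>i j. cf a (take i w) * cf b (take j (drop i w)) * cf c (drop (i + j) w)"
    have "cf (a * b * c) w = (\<Sum>k\<le>length w. \<Sum>i\<le>k. ?f i (k - i))"
      by (auto simp: cf_mult sum_distrib_right min_def drop_take intro!: sum.cong)
    also have "\<dots> = (\<Sum>(i, j)\<in>{(i, j). i + j \<le> length w}. ?f i j)"
      by (rule sum.triangle_reindex_eq [symmetric])
    also have "\<dots> = (\<Sum>i\<le>length w. \<Sum>j\<le>length w - i. ?f i j)"
    proof -
      have "{(i, j). i + j \<le> length w} = (SIGMA i:{..length w}. {..length w - i})"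
        by auto
      then show ?thesis by (simp add: sum.Sigma)
    qed
    also have "\<dots> = cf (a * (b * c)) w"
      by (simp add: cf_mult sum_distrib_left mult.assoc add.commute)
    finally show "cf (a * b * c) w = cf (a * (b * c)) w" .
  qed
  show "1 * a = a"
  proof (rule ncs_eqI)
    fix w
    have "cf (1 * a) w = (\<Sum>k\<le>length w. if k = 0 then cf a w else 0)"
      unfolding cf_mult by (rule sum.cong) (auto simp: cf_one)
    then show "cf (1 * a) w = cf a w" by simp
  qed
  show "a * 1 = a"
  proof (rule ncs_eqI)
    fix w
    have "cf (a * 1) w = (\<Sum>k\<le>length w. if k = length w then cf a w else 0)"
      unfolding cf_mult by (rule sum.cong) (auto simp: cf_one)
    then show "cf (a * 1) w = cf a w" by simp
  qed
  show "(a + b) * c = a * c + b * c"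
    by (rule ncs_eqI) (simp add: cf_mult algebra_simps sum.distrib)
  show "a * (b + c) = a * b + a * c"
    by (rule ncs_eqI) (simp add: cf_mult algebra_simps sum.distrib)
  show "(0 :: ('a, 'b) ncs) \<noteq> 1"
    by (metis cf_one cf_simps(1) zero_neq_one)
qed (auto intro!: ncs_eqI)

end

definition smul :: "'k \<Rightarrow> ('x, 'k::comm_ring_1) ncs \<Rightarrow> ('x, 'k) ncs" (infixr \<open>\<odot>\<close> 75) where
  "c \<odot> a = Ncs (\<lambda>w. c * cf a w)"

interpretation ncs: vector_space "smul :: 'k::field \<Rightarrow> ('x, 'k) ncs \<Rightarrow> ('x, 'k) ncs"
  by unfold_locales (auto intro!: ncs_eqI simp: smul_def algebra_simps)

definition commutator :: "'a::ring \<Rightarrow> 'a \<Rightarrow> 'a" where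
  "commutator a b = a * b - b * a"

definition letter :: "'x \<Rightarrow> ('x, 'k::comm_ring_1) ncs" where
  "letter x = Ncs (\<lambda>w. if w = [x] then 1 else 0)"

text \<open>
  \<open>h(a) = \<Sum>\<^sub>k h\<^sub>k a\<^sup>k\<close> for a one-variable series \<open>h\<close> and a series \<open>a\<close> without constant term;
  then \<open>a\<^sup>k\<close> has no terms of length less than \<open>k\<close>.
\<close>

definition fps_app :: "'k fps \<Rightarrow> ('x, 'k::comm_ring_1) ncs \<Rightarrow> ('x, 'k) ncs" where
  "fps_app h a = Ncs (\<lambda>w. \<Sum>k\<le>length w. fps_nth h k * cf (a ^ k) w)"

definition ncs_exp :: "('x, 'k::field_char_0) ncs \<Rightarrow> ('x, 'k) ncs" where
  "ncs_exp a = fps_app (fps_exp 1) a"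

definition ncs_log :: "('x, 'k::field_char_0) ncs \<Rightarrow> ('x, 'k) ncs" where
  "ncs_log b = fps_app (fps_ln 1) (b - 1)"

definition ncs_inv :: "('x, 'k::comm_ring_1) ncs \<Rightarrow> ('x, 'k) ncs" where
  "ncs_inv a = (THE b. a * b = 1 \<and> b * a = 1)"

definition dd :: "'x \<Rightarrow> ('x, 'k::comm_ring_1) ncs \<Rightarrow> ('x, 'k) ncs" where
  "dd x a = Ncs (\<lambda>w. cf a (w @ [x]))"


section \<open>The algebra \<open>A\<close>, the Lie algebra \<open>L\<close> and the space \<open>|A|\<close>\<close>

type_synonym 'k ser = "(gen, 'k) ncs"

fun wt :: "gen \<Rightarrow> nat" where
  "wt (X i) = 1"
| "wt (Y i) = 1"
| "wt (Z j) = 2"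

definition wtw :: "gen list \<Rightarrow> nat" where
  "wtw w = sum_list (map wt w)"

definition Alg :: "nat \<Rightarrow> nat \<Rightarrow> 'k::field_char_0 ser set" where
  "Alg g n = {a. \<forall>w. cf a w \<noteq> 0 \<longrightarrow> set w \<subseteq> gens g n}"

text \<open>The defining property of \<open>d\<^sub>x\<close>.\<close>

lemma dd_decomposition:
  fixes a :: "'k::field_char_0 ser"
  assumes "a \<in> Alg g n"
  shows "a = smul (cf a []) 1 + (\<Sum>x\<in>gens g n. dd x a * letter x)"
proof (rule ncs_eqI)
  fix w :: "gen list"
  have fin: "finite (gens g n)" by (simp add: gens_def)
  have cfsum: "cf (\<Sum>x\<in>B. h x) v = (\<Sum>x\<in>B. cf (h x) v)"
    if "finite B" for B :: "gen set" and h :: "gen \<Rightarrow> 'k ser" and v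
    using that by (induction B) auto
  show "cf a w = cf (smul (cf a []) 1 + (\<Sum>x\<in>gens g n. dd x a * letter x)) w"
  proof (cases w rule: rev_cases)
    case Nil
    then show ?thesis
      by (simp add: cfsum fin smul_def cf_one cf_mult letter_def)
  next
    case (snoc v y)
    have "cf (dd x a * letter x) w = (if x = y then cf a w else 0)" for x
    proof -
      have "cf (dd x a * letter x) w =
          (\<Sum>k\<le>length w. if k = length v then (if x = y then cf a w else 0) else 0)"
        unfolding cf_mult
      proof (rule sum.cong)
        fix k assume "k \<in> {..length w}"
        then have k: "k \<le> Suc (length v)" using snoc by simp
        have "drop k w = [x] \<longleftrightarrow> k = length v \<and> x = y"
        proof
          assume d: "drop k w = [x]"
          then have "length w - k = 1" by (metis length_drop length_Cons list.size(3) One_nat_def)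
          then have "k = length v" using snoc k by simp
          then show "k = length v \<and> x = y" using d snoc by simp
        qed (simp add: snoc)
        then show "cf (dd x a) (take k w) * cf (letter x) (drop k w) =
            (if k = length v then if x = y then cf a w else 0 else 0)"
          by (auto simp: letter_def dd_def snoc)
      qed simp
      then show ?thesis using snoc by simp
    qed
    moreover have "y \<in> gens g n" if "cf a w \<noteq> 0"
      using assms that snoc unfolding Alg_def by fastforce
    ultimately show ?thesis
      using fin snoc by (auto simp: cfsum smul_def cf_one)
  qed
qed

text \<open>The elements of weight at least \<open>m\<close>; these sets are the basic neighbourhoods of 0.\<close>

definition Filt :: "nat \<Rightarrow> nat \<Rightarrow> nat \<Rightarrow> 'k::field_char_0 ser set" where
  "Filt g n m = {a \<in> Alg g n. \<forall>w. cf a w \<noteq> 0 \<longrightarrow> m \<le> wtw w}"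

definition Alg_closure :: "nat \<Rightarrow> nat \<Rightarrow> 'k::field_char_0 ser set \<Rightarrow> 'k ser set" where
  "Alg_closure g n V = {a \<in> Alg g n. \<forall>m. \<exists>b\<in>V. a - b \<in> Filt g n m}"

inductive_set lie_polys :: "nat \<Rightarrow> nat \<Rightarrow> 'k::field_char_0 ser set" for g n where
  "x \<in> gens g n \<Longrightarrow> letter x \<in> lie_polys g n"
| "0 \<in> lie_polys g n"
| "a \<in> lie_polys g n \<Longrightarrow> b \<in> lie_polys g n \<Longrightarrow> a + b \<in> lie_polys g n"
| "a \<in> lie_polys g n \<Longrightarrow> c \<odot> a \<in> lie_polys g n"
| "a \<in> lie_polys g n \<Longrightarrow> b \<in> lie_polys g n \<Longrightarrow> commutator a b \<in> lie_polys g n"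

definition Lie :: "nat \<Rightarrow> nat \<Rightarrow> 'k::field_char_0 ser set" where
  "Lie g n = Alg_closure g n (lie_polys g n)"

definition expL :: "nat \<Rightarrow> nat \<Rightarrow> 'k::field_char_0 ser set" where
  "expL g n = ncs_exp ` Lie g n"

definition commA :: "nat \<Rightarrow> nat \<Rightarrow> 'k::field_char_0 ser set" where
  "commA g n =
     Alg_closure g n (ncs.span {commutator a b | a b. a \<in> Alg g n \<and> b \<in> Alg g n})"

text \<open>
  The class \<open>|a|\<close> of \<open>a\<close> in \<open>|A| = A / [A, A]\<close>, as a coset. The operations on \<open>|A|\<close> are those
  of cosets, and an automorphism \<open>F\<close> of \<open>A\<close> acts on \<open>|A|\<close> as the image \<open>F ` P\<close>. Finite sums of
  classes are written as the class of the sum.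
\<close>

type_synonym 'k cyc = "'k ser set"

definition cyc :: "nat \<Rightarrow> nat \<Rightarrow> 'k::field_char_0 ser \<Rightarrow> 'k cyc" where
  "cyc g n a = {b \<in> Alg g n. b - a \<in> commA g n}"

definition cyc_plus :: "'k::field_char_0 cyc \<Rightarrow> 'k cyc \<Rightarrow> 'k cyc" (infixl \<open>\<boxplus>\<close> 65) where
  "P \<boxplus> Q = {a + b | a b. a \<in> P \<and> b \<in> Q}"

definition cyc_minus :: "'k::field_char_0 cyc \<Rightarrow> 'k cyc \<Rightarrow> 'k cyc" (infixl \<open>\<boxminus>\<close> 65) where
  "P \<boxminus> Q = {a - b | a b. a \<in> P \<and> b \<in> Q}"


section \<open>Automorphisms and derivations\<close>

definition linear_on_Alg :: "nat \<Rightarrow> nat \<Rightarrow> ('k::field_char_0 ser \<Rightarrow> 'k ser) \<Rightarrow> bool" where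
  "linear_on_Alg g n F \<longleftrightarrow> F \<in> Alg g n \<rightarrow> Alg g n \<and>
     (\<forall>a\<in>Alg g n. \<forall>b\<in>Alg g n. F (a + b) = F a + F b) \<and>
     (\<forall>c. \<forall>a\<in>Alg g n. F (c \<odot> a) = c \<odot> F a)"

text \<open>Continuity of a linear map, tested at 0.\<close>

definition continuous_on_Alg :: "nat \<Rightarrow> nat \<Rightarrow> ('k::field_char_0 ser \<Rightarrow> 'k ser) \<Rightarrow> bool" where
  "continuous_on_Alg g n F \<longleftrightarrow> (\<forall>m. \<exists>k. F ` Filt g n k \<subseteq> Filt g n m)"

text \<open>
  An automorphism of \<open>L\<close> is represented by its extension to a continuous algebra endomorphism
  of \<open>A\<close>, as a function that is \<open>undefined\<close> outside \<open>A\<close>.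
\<close>

definition Aut_plus :: "nat \<Rightarrow> nat \<Rightarrow> ('k::field_char_0 ser \<Rightarrow> 'k ser) set" where
  "Aut_plus g n = {F \<in> extensional (Alg g n).
     linear_on_Alg g n F \<and> F 1 = 1 \<and>
     (\<forall>a\<in>Alg g n. \<forall>b\<in>Alg g n. F (a * b) = F a * F b) \<and>
     continuous_on_Alg g n F \<and>
     bij_betw F (Lie g n) (Lie g n) \<and>
     (\<forall>x\<in>gens g n. F (letter x) - letter x \<in> Filt g n (wt x + 1))}"

text \<open>Derivations of \<open>L\<close> of positive weight, again represented by their extension to \<open>A\<close>.\<close>

definition Der_plus :: "nat \<Rightarrow> nat \<Rightarrow> ('k::field_char_0 ser \<Rightarrow> 'k ser) set" where
  "Der_plus g n = {u. linear_on_Alg g n u \<and>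
     (\<forall>a\<in>Alg g n. \<forall>b\<in>Alg g n. u (a * b) = u a * b + a * u b) \<and>
     u ` Lie g n \<subseteq> Lie g n \<and>
     (\<forall>m. u ` Filt g n m \<subseteq> Filt g n (m + 1))}"

text \<open>
  As \<open>u\<^sup>k(a)\<close> has weight at least \<open>k\<close>, only \<open>k \<le> wtw w\<close> contributes to the coefficient of \<open>w\<close>
  in the two series below.
\<close>

definition exp_der :: "nat \<Rightarrow> nat \<Rightarrow> ('k::field_char_0 ser \<Rightarrow> 'k ser) \<Rightarrow> 'k ser \<Rightarrow> 'k ser" where
  "exp_der g n u = (\<lambda>a\<in>Alg g n. Ncs (\<lambda>w. \<Sum>k\<le>wtw w. cf ((u ^^ k) a) w / fact k))"

definition div_lift :: "nat \<Rightarrow> nat \<Rightarrow> ('k::field_char_0 ser \<Rightarrow> 'k ser) \<Rightarrow> 'k ser" where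
  "div_lift g n u = (\<Sum>x\<in>gens g n. dd x (u (letter x)))"

definition j_exp :: "nat \<Rightarrow> nat \<Rightarrow> ('k::field_char_0 ser \<Rightarrow> 'k ser) \<Rightarrow> 'k cyc" where
  "j_exp g n u =
     cyc g n (Ncs (\<lambda>w. \<Sum>k\<le>wtw w. cf ((u ^^ k) (div_lift g n u)) w / fact (k + 1)))"

definition jj :: "nat \<Rightarrow> nat \<Rightarrow> ('k::field_char_0 ser \<Rightarrow> 'k ser) \<Rightarrow> 'k cyc" where
  "jj g n F = (THE P. \<exists>u\<in>Der_plus g n. F = exp_der g n u \<and> P = j_exp g n u)"

type_synonym 'k taut = "('k ser \<Rightarrow> 'k ser) \<times> (nat \<Rightarrow> 'k ser)"

definition tAut_plus :: "nat \<Rightarrow> nat \<Rightarrow> 'k::field_char_0 taut monoid" where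
  "tAut_plus g n =
     \<lparr>carrier = {(F, f). F \<in> Aut_plus g n \<and> f \<in> {1..n} \<rightarrow>\<^sub>E expL g n \<and>
        (\<forall>j\<in>{1..n}. F (letter (Z j)) = ncs_inv (f j) * letter (Z j) * f j)},
      mult = (\<lambda>(F, f) (G, h). (compose (Alg g n) F G, \<lambda>j\<in>{1..n}. f j * F (h j))),
      one = (\<lambda>a\<in>Alg g n. a, \<lambda>j\<in>{1..n}. 1)\<rparr>"


section \<open>The Kashiwara--Vergne groups and the set of solutions\<close>

definition omega :: "nat \<Rightarrow> nat \<Rightarrow> 'k::field_char_0 ser" where
  "omega g n = (\<Sum>i\<in>{1..g}. commutator (letter (X i)) (letter (Y i))) + (\<Sum>j\<in>{1..n}. letter (Z j))"

definition xi :: "nat \<Rightarrow> nat \<Rightarrow> 'k::field_char_0 ser" where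
  "xi g n = ncs_log (
     prod_list (map (\<lambda>i. ncs_exp (letter (X i)) * ncs_exp (letter (Y i)) *
                         ncs_exp (- letter (X i)) * ncs_exp (- letter (Y i))) [1..<Suc g]) *
     prod_list (map (\<lambda>j. ncs_exp (letter (Z j))) [1..<Suc n]))"

definition r_fps :: "'k::field_char_0 fps" where
  "r_fps = fps_compose (fps_ln 1) ((fps_exp 1 - 1) / fps_X - 1)"

definition r_cyc :: "nat \<Rightarrow> nat \<Rightarrow> 'k::field_char_0 cyc" where
  "r_cyc g n =
     cyc g n (\<Sum>i\<in>{1..g}. fps_app r_fps (letter (X i)) + fps_app r_fps (letter (Y i)))"

text \<open>
  Here and below \<open>\<rho>\<close> is the family of rotation numbers of the generators \<open>\<alpha>\<^sub>i = X i\<close>,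
  \<open>\<beta>\<^sub>i = Y i\<close>, \<open>\<gamma>\<^sub>j = Z j\<close>.
\<close>

definition p_cyc :: "nat \<Rightarrow> nat \<Rightarrow> (gen \<Rightarrow> int) \<Rightarrow> 'k::field_char_0 cyc" where
  "p_cyc g n \<rho> =
     cyc g n (\<Sum>i\<in>{1..g}. of_int (\<rho> (X i)) \<odot> letter (Y i) - of_int (\<rho> (Y i)) \<odot> letter (X i))"

definition c_cyc :: "nat \<Rightarrow> nat \<Rightarrow> (gen \<Rightarrow> int) \<Rightarrow> 'k::field_char_0 taut \<Rightarrow> 'k cyc" where
  "c_cyc g n \<rho> F = cyc g n (\<Sum>j\<in>{1..n}. of_int (\<rho> (Z j)) \<odot> ncs_log (snd F j))"

definition j_gr :: "nat \<Rightarrow> nat \<Rightarrow> (gen \<Rightarrow> int) \<Rightarrow> 'k::field_char_0 taut \<Rightarrow> 'k cyc" where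
  "j_gr g n \<rho> G = jj g n (fst G) \<boxminus> c_cyc g n \<rho> G"

definition j_f :: "nat \<Rightarrow> nat \<Rightarrow> (gen \<Rightarrow> int) \<Rightarrow> 'k::field_char_0 taut \<Rightarrow> 'k cyc" where
  "j_f g n \<rho> G = jj g n (fst G) \<boxminus> c_cyc g n \<rho> G
     \<boxplus> fst G ` (r_cyc g n \<boxminus> p_cyc g n \<rho>) \<boxminus> (r_cyc g n \<boxminus> p_cyc g n \<rho>)"

definition R_f :: "nat \<Rightarrow> nat \<Rightarrow> (gen \<Rightarrow> int) \<Rightarrow> 'k::field_char_0 taut \<Rightarrow> 'k cyc" where
  "R_f g n \<rho> F = j_gr g n \<rho> F \<boxplus> fst F ` (r_cyc g n \<boxminus> p_cyc g n \<rho>)"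

text \<open>\<open>\<Sum>\<^sub>j |h\<^sub>j(z\<^sub>j)| - |h(a)|\<close>, to be used for \<open>a = \<omega>\<close> and \<open>a = \<xi>\<close>.\<close>

definition duflo_sum ::
  "nat \<Rightarrow> nat \<Rightarrow> (nat \<Rightarrow> 'k fps) \<Rightarrow> 'k fps \<Rightarrow> 'k::field_char_0 ser \<Rightarrow> 'k cyc" where
  "duflo_sum g n hs h a =
     cyc g n (\<Sum>j\<in>{1..n}. fps_app (hs j) (letter (Z j))) \<boxminus> cyc g n (fps_app h a)"

definition duflo_admissible :: "nat \<Rightarrow> (nat \<Rightarrow> 'k::field_char_0 fps) \<Rightarrow> 'k fps \<Rightarrow> bool" where
  "duflo_admissible n hs h \<longleftrightarrow>
     (\<forall>j\<in>{1..n}. fps_nth (hs j) 0 = 0) \<and> fps_nth h 0 = 0 \<and> fps_nth h 1 = 0"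

definition KV_duflo ::
  "nat \<Rightarrow> nat \<Rightarrow> (gen \<Rightarrow> int) \<Rightarrow> 'k::field_char_0 taut \<Rightarrow> (nat \<Rightarrow> 'k fps) \<Rightarrow> 'k fps \<Rightarrow> bool" where
  "KV_duflo g n \<rho> G hs h \<longleftrightarrow>
     duflo_admissible n hs h \<and> j_f g n \<rho> G = duflo_sum g n hs h (xi g n)"

definition KRV_duflo ::
  "nat \<Rightarrow> nat \<Rightarrow> (gen \<Rightarrow> int) \<Rightarrow> 'k::field_char_0 taut \<Rightarrow> (nat \<Rightarrow> 'k fps) \<Rightarrow> 'k fps \<Rightarrow> bool" where
  "KRV_duflo g n \<rho> G hs h \<longleftrightarrow>
     duflo_admissible n hs h \<and> j_gr g n \<rho> G = duflo_sum g n hs h (omega g n)"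

definition SolKV :: "nat \<Rightarrow> nat \<Rightarrow> (gen \<Rightarrow> int) \<Rightarrow> 'k::field_char_0 taut set" where
  "SolKV g n \<rho> = {F \<in> carrier (tAut_plus g n). fst F (xi g n) = omega g n \<and>
     (\<exists>hs h. duflo_admissible n hs h \<and> R_f g n \<rho> F = duflo_sum g n hs h (omega g n))}"

definition KV :: "nat \<Rightarrow> nat \<Rightarrow> (gen \<Rightarrow> int) \<Rightarrow> 'k::field_char_0 taut monoid" where
  "KV g n \<rho> = (tAut_plus g n)\<lparr>carrier := {G \<in> carrier (tAut_plus g n).
     fst G (xi g n) = xi g n \<and> (\<exists>hs h. KV_duflo g n \<rho> G hs h)}\<rparr>"

definition KRV :: "nat \<Rightarrow> nat \<Rightarrow> (gen \<Rightarrow> int) \<Rightarrow> 'k::field_char_0 taut monoid" where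
  "KRV g n \<rho> = (tAut_plus g n)\<lparr>carrier := {G \<in> carrier (tAut_plus g n).
     fst G (omega g n) = omega g n \<and> (\<exists>hs h. KRV_duflo g n \<rho> G hs h)}\<rparr>"


section \<open>Free and transitive actions\<close>

text \<open>
  The library's \<open>group_action\<close> is a left action; a right action is a left action of the
  opposite group.
\<close>

definition free_transitive_left_action ::
  "('a, 'c) monoid_scheme \<Rightarrow> 'b set \<Rightarrow> ('a \<Rightarrow> 'b \<Rightarrow> 'b) \<Rightarrow> bool" where
  "free_transitive_left_action G E \<phi> \<longleftrightarrow>
     transitive_action G E \<phi> \<and> (\<forall>x\<in>E. stabilizer G \<phi> x = {\<one>\<^bsub>G\<^esub>})"

definition opposite_group :: "('a, 'c) monoid_scheme \<Rightarrow> ('a, 'c) monoid_scheme" where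
  "opposite_group G = G\<lparr>mult := (\<lambda>x y. y \<otimes>\<^bsub>G\<^esub> x)\<rparr>"

definition free_transitive_right_action ::
  "('a, 'c) monoid_scheme \<Rightarrow> 'b set \<Rightarrow> ('a \<Rightarrow> 'b \<Rightarrow> 'b) \<Rightarrow> bool" where
  "free_transitive_right_action G E \<phi> \<longleftrightarrow>
     group G \<and> free_transitive_left_action (opposite_group G) E \<phi>"

end

theory Submission
  imports Defs
begin

text \<open>
  \<open>KV\<close>, \<open>KRV\<close> and \<open>SolKV\<close> consist of the morphisms of a groupoid with objects \<open>(\<xi>, r - p)\<close> and
  \<open>(\<omega>, 0)\<close>: a morphism from \<open>(a, e)\<close> to \<open>(a', e')\<close> is an \<open>F\<close> with \<open>F(a) = a'\<close> such that
  \<open>j(F) - c(F) + F(e) - e'\<close> is a Duflo sum at \<open>a'\<close>. Because \<open>c\<close> and \<open>j\<close> are group cocycles,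
  these morphisms are closed under composition and their Duflo functions add up. In particular
  Duflo functions are invariant under conjugation by a morphism between the two objects.

  For \<open>c\<close> the cocycle property says that \<open>log\<close> is additive modulo commutators, by the
  Baker--Campbell--Hausdorff theorem. For \<open>j\<close>, let a derivation \<open>u\<close> act on \<open>A \<oplus> K\<close> by
  \<open>(a, s) \<mapsto> (u a + s div u, 0)\<close>. Modulo commutators this is a representation, as \<open>div\<close> is a Lie
  algebra cocycle, and the exponential of the operator maps \<open>(0, 1)\<close> to \<open>(j (exp u), 1)\<close>. So the
  cocycle property is the Baker--Campbell--Hausdorff theorem for these operators.
\<close>

subsection \<open>Complete filtered rings and the Baker--Campbell--Hausdorff theorem\<close>

text \<open>The Baker--Campbell--Hausdorff theorem is proved once, for an abstract complete filtered
  ring, because two very different rings call for it: noncommutative series under concatenation and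
  linear operators under composition. It is stated with two sets \<open>L\<close> and
  \<open>L'\<close>, so that one proof yields both that all terms are Lie elements and that the
  terms of degree at least 2 come from commutators. Quotients are avoided throughout. Classes in
  \<open>|A|\<close> are handled through lifts to \<open>A\<close>, and equality of classes through
  membership in the closed subspace \<open>commA\<close>. The price is that every set fed to the
  theorem has to be shown closed under convergent sums. The definition of \<open>j\<close> refers to
  a derivation \<open>u\<close> with \<open>F = exp u\<close>. So the existence of such a
  \<open>u\<close> for every \<open>F\<close> in \<open>Aut_plus\<close> and its uniqueness on
  \<open>A\<close> have to be settled as well. Existence is the delicate half, since the logarithm
  series of \<open>F\<close> is not visibly a derivation.\<close>

locale central_scalars =
  fixes \<kappa> :: "'c::field_char_0 \<Rightarrow> 'r::ring_1"
  assumes scal_one [simp]: "\<kappa> 1 = 1"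
    and scal_add: "\<kappa> (a + b) = \<kappa> a + \<kappa> b"
    and scal_mult: "\<kappa> (a * b) = \<kappa> a * \<kappa> b"
    and scal_commute: "\<kappa> a * r = r * \<kappa> a"
begin

lemma scal_zero [simp]: "\<kappa> 0 = 0"
  using scal_add[of 0 0] by simp

lemma scal_uminus: "\<kappa> (- a) = - \<kappa> a"
  using scal_add[of a "- a"] by (simp add: eq_neg_iff_add_eq_0 add.commute)

lemma scal_sum: "\<kappa> (sum f A) = (\<Sum>i\<in>A. \<kappa> (f i))"
  by (induction A rule: infinite_finite_induct) (simp_all add: scal_add)

lemma scal_of_nat: "\<kappa> (of_nat n) = of_nat n"
  by (induction n) (simp_all add: scal_add)

lemma scal_of_int: "\<kappa> (of_int i) = of_int i"
proof (cases i)
  case (nonneg n)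
  then show ?thesis by (simp add: scal_of_nat)
next
  case (neg n)
  then show ?thesis by (simp add: scal_uminus scal_of_nat[symmetric] scal_add del: of_nat_Suc)
qed

lemma scal_left_commute: "r * (\<kappa> a * s) = \<kappa> a * (r * s)"
  by (metis scal_commute mult.assoc)

lemma scal_inverse_of_nat: "n > 0 \<Longrightarrow> \<kappa> (1 / of_nat n) * (of_nat n * r) = r"
  by (simp add: scal_of_nat[symmetric] mult.assoc[symmetric] scal_mult[symmetric])

lemma scal_mult_left: "\<kappa> a * (\<kappa> b * r) = \<kappa> (a * b) * r"
  by (simp add: scal_mult mult.assoc)

end

text \<open>\<open>Fl 0\<close> is a subring but need not be everything: in the operator instance
  \<open>oFl 0\<close> consists of the operators that preserve the filtration. Completeness is
  required only for series whose \<open>m\<close>-th term lies in \<open>Fl m\<close>, the only kind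
  of limit taken.\<close>

locale complete_filtered_ring = central_scalars \<kappa>
  for \<kappa> :: "'c::field_char_0 \<Rightarrow> 'r::ring_1" +
  fixes Fl :: "nat \<Rightarrow> 'r set"
  assumes scal_Fl: "\<kappa> c \<in> Fl 0"
    and Fl_zero: "0 \<in> Fl m"
    and Fl_add: "a \<in> Fl m \<Longrightarrow> b \<in> Fl m \<Longrightarrow> a + b \<in> Fl m"
    and Fl_uminus: "a \<in> Fl m \<Longrightarrow> - a \<in> Fl m"
    and Fl_antimono: "k \<le> m \<Longrightarrow> Fl m \<subseteq> Fl k"
    and Fl_mult: "a \<in> Fl k \<Longrightarrow> b \<in> Fl m \<Longrightarrow> a * b \<in> Fl (k + m)"
    and Fl_separated: "(\<And>m. a \<in> Fl m) \<Longrightarrow> a = 0"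
    and Fl_complete: "(\<And>m. x m \<in> Fl m) \<Longrightarrow> \<exists>s. \<forall>n. s - (\<Sum>m<n. x m) \<in> Fl n"
begin

lemma Fl_diff: "a \<in> Fl m \<Longrightarrow> b \<in> Fl m \<Longrightarrow> a - b \<in> Fl m"
  using Fl_add[of a m "- b"] Fl_uminus by simp

lemma Fl_le: "a \<in> Fl m \<Longrightarrow> k \<le> m \<Longrightarrow> a \<in> Fl k"
  using Fl_antimono by blast

lemma Fl_sum: "(\<And>i. i \<in> A \<Longrightarrow> f i \<in> Fl m) \<Longrightarrow> sum f A \<in> Fl m"
  by (induction A rule: infinite_finite_induct) (simp_all add: Fl_zero Fl_add)

lemma Fl_one: "1 \<in> Fl 0"
  using scal_Fl[of 1] by simp

lemma Fl_scal: "a \<in> Fl m \<Longrightarrow> \<kappa> c * a \<in> Fl m"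
  using Fl_mult[OF scal_Fl] by simp

lemma Fl_mult_le: "a \<in> Fl k \<Longrightarrow> b \<in> Fl m \<Longrightarrow> n \<le> k + m \<Longrightarrow> a * b \<in> Fl n"
  using Fl_mult Fl_le by blast

lemma Fl_power: "a \<in> Fl 1 \<Longrightarrow> a ^ k \<in> Fl k"
  by (induction k) (use Fl_one Fl_mult_le in \<open>auto simp: intro!: Fl_mult_le\<close>)

section \<open>Convergent series and their products\<close>

definition sums_to :: "(nat \<Rightarrow> 'r) \<Rightarrow> 'r \<Rightarrow> bool" where
  "sums_to x s \<longleftrightarrow> (\<forall>m. x m \<in> Fl m) \<and> (\<forall>n. s - (\<Sum>m<n. x m) \<in> Fl n)"

lemma sums_toI: "(\<And>m. x m \<in> Fl m) \<Longrightarrow> (\<And>n. s - (\<Sum>m<n. x m) \<in> Fl n) \<Longrightarrow> sums_to x s"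
  by (simp add: sums_to_def)

lemma sums_to_Fl0: "sums_to x s \<Longrightarrow> s \<in> Fl 0"
  unfolding sums_to_def by (metis diff_zero lessThan_0 sum.empty)

lemma sums_to_unique:
  assumes "sums_to x s" "sums_to x t"
  shows "s = t"
proof -
  have "s - t \<in> Fl n" for n
    using Fl_diff[of "s - (\<Sum>m<n. x m)" n "t - (\<Sum>m<n. x m)"] assms by (simp add: sums_to_def)
  then show ?thesis using Fl_separated by force
qed

lemma sums_to_exists: "(\<And>m. x m \<in> Fl m) \<Longrightarrow> \<exists>s. sums_to x s"
  using Fl_complete unfolding sums_to_def by blast

lemma sums_to_tail:
  assumes "sums_to x s" "\<And>m. m < n \<Longrightarrow> x m = 0"
  shows "s \<in> Fl n"
  using assms by (metis (no_types, lifting) sums_to_def diff_zero lessThan_iff sum.neutral)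

lemma sums_to_add: "sums_to x s \<Longrightarrow> sums_to y t \<Longrightarrow> sums_to (\<lambda>n. x n + y n) (s + t)"
  by (simp add: sums_to_def Fl_add sum.distrib add_diff_add)

lemma sums_to_scal: "sums_to x s \<Longrightarrow> sums_to (\<lambda>n. \<kappa> c * x n) (\<kappa> c * s)"
  unfolding sums_to_def
  by (simp add: Fl_scal sum_distrib_left[symmetric] right_diff_distrib[symmetric])

text \<open>The convergence rate is built into \<open>sums_to\<close>, so no limits occur: modulo
  \<open>Fl n\<close> both factors may be replaced by their \<open>n\<close>-th partial sums, and
  the left-over products \<open>x i * y j\<close> with \<open>n \<le> i + j\<close> lie in
  \<open>Fl n\<close> themselves.\<close>

lemma sums_to_mult:
  assumes x: "sums_to x s" and y: "sums_to y t"
  shows "sums_to (\<lambda>n. \<Sum>i\<le>n. x i * y (n - i)) (s * t)"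
proof (rule sums_toI)
  have xF: "x i \<in> Fl i" and yF: "y i \<in> Fl i" for i using x y by (auto simp: sums_to_def)
  show "(\<Sum>i\<le>m. x i * y (m - i)) \<in> Fl m" for m
    by (rule Fl_sum) (rule Fl_mult_le[OF xF yF], auto)
  fix n
  let ?X = "\<Sum>i<n. x i" and ?Y = "\<Sum>i<n. y i"
  have Y: "?Y \<in> Fl 0" by (rule Fl_sum) (rule Fl_le[OF yF], simp)
  have "s * t - ?X * ?Y = s * (t - ?Y) + (s - ?X) * ?Y"
    by (simp add: algebra_simps)
  moreover have "s * (t - ?Y) \<in> Fl n" "(s - ?X) * ?Y \<in> Fl n"
    using sums_to_Fl0[OF x] Y x y unfolding sums_to_def by (auto intro!: Fl_mult_le)
  ultimately have 1: "s * t - ?X * ?Y \<in> Fl n" by (simp add: Fl_add)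
  have "?X * ?Y = (\<Sum>(i,j)\<in>{..<n} \<times> {..<n}. x i * y j)"
    by (simp add: sum_product sum.cartesian_product)
  also have "{..<n} \<times> {..<n} = {(i,j). i + j < n} \<union> {(i,j). i < n \<and> j < n \<and> n \<le> i + j}"
    by auto
  also have "(\<Sum>(i,j)\<in>\<dots>. x i * y j) = (\<Sum>(i,j)\<in>{(i,j). i + j < n}. x i * y j) +
      (\<Sum>(i,j)\<in>{(i,j). i < n \<and> j < n \<and> n \<le> i + j}. x i * y j)"
  proof (rule sum.union_disjoint)
    have "{(i,j). i + j < n} \<subseteq> {..<n} \<times> {..<n}" by auto
    then show "finite {(i,j). i + j < n}" by (rule finite_subset) simp
    have "{(i,j). i < n \<and> j < n \<and> n \<le> i + j} \<subseteq> {..<n} \<times> {..<n}" by auto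
    then show "finite {(i,j). i < n \<and> j < n \<and> n \<le> i + j}" by (rule finite_subset) simp
  qed auto
  finally have "?X * ?Y - (\<Sum>(i,j)\<in>{(i,j). i + j < n}. x i * y j) =
     (\<Sum>(i,j)\<in>{(i,j). i < n \<and> j < n \<and> n \<le> i + j}. x i * y j)" by simp
  also have "\<dots> \<in> Fl n"
    by (rule Fl_sum) (auto intro!: Fl_mult_le[OF xF yF])
  also have "(\<Sum>(i,j)\<in>{(i,j). i + j < n}. x i * y j) = (\<Sum>k<n. \<Sum>i\<le>k. x i * y (k - i))"
    by (rule sum.triangle_reindex)
  finally have 2: "?X * ?Y - (\<Sum>k<n. \<Sum>i\<le>k. x i * y (k - i)) \<in> Fl n" .
  show "s * t - (\<Sum>k<n. \<Sum>i\<le>k. x i * y (k - i)) \<in> Fl n"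
    using Fl_add[OF 1 2] by simp
qed

section \<open>Substitution into one-variable power series\<close>

definition app :: "'c fps \<Rightarrow> 'r \<Rightarrow> 'r" where
  "app h a = (THE s. sums_to (\<lambda>k. \<kappa> (fps_nth h k) * a ^ k) s)"

lemma app_eqI: "sums_to (\<lambda>k. \<kappa> (fps_nth h k) * a ^ k) s \<Longrightarrow> app h a = s"
  unfolding app_def using sums_to_unique by blast

context
  fixes a assumes a: "a \<in> Fl 1"
begin

lemma app_terms: "\<kappa> (fps_nth h k) * a ^ k \<in> Fl k"
  using Fl_scal Fl_power a by blast

lemma app_sums: "sums_to (\<lambda>k. \<kappa> (fps_nth h k) * a ^ k) (app h a)"
proof -
  obtain s where "sums_to (\<lambda>k. \<kappa> (fps_nth h k) * a ^ k) s"
    using sums_to_exists[OF app_terms[of h]] by blast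
  then show ?thesis using app_eqI by simp
qed

lemma app_add: "app (h + k) a = app h a + app k a"
  by (rule app_eqI) (use sums_to_add[OF app_sums app_sums] in \<open>simp add: scal_add distrib_right\<close>)

lemma app_const: "app (fps_const c) a = \<kappa> c"
proof (rule app_eqI, rule sums_toI)
  show "\<kappa> (fps_nth (fps_const c) m) * a ^ m \<in> Fl m" for m by (rule app_terms)
  show "\<kappa> c - (\<Sum>m<n. \<kappa> (fps_nth (fps_const c) m) * a ^ m) \<in> Fl n" for n
  proof (cases n)
    case (Suc n')
    have "(\<Sum>m<n. \<kappa> (fps_nth (fps_const c) m) * a ^ m) = (\<Sum>m<n. if m = 0 then \<kappa> c else 0)"
      by (rule sum.cong) auto
    then show ?thesis using Suc Fl_zero by simp
  qed (simp add: scal_Fl)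
qed

lemma app_one: "app 1 a = 1"
  using app_const[of 1] by simp

lemma app_zero: "app 0 a = 0"
  using app_const[of 0] by simp

lemma app_X: "app fps_X a = a"
proof (rule app_eqI, rule sums_toI)
  show "\<kappa> (fps_nth fps_X m) * a ^ m \<in> Fl m" for m by (rule app_terms)
  show "a - (\<Sum>m<n. \<kappa> (fps_nth fps_X m) * a ^ m) \<in> Fl n" for n
  proof (cases "n \<le> 1")
    case True
    then have "(\<Sum>m<n. \<kappa> (fps_nth fps_X m) * a ^ m) = 0" by (auto intro!: sum.neutral)
    then show ?thesis using Fl_le[OF a True] by simp
  next
    case False
    have "(\<Sum>m<n. \<kappa> (fps_nth fps_X m) * a ^ m) = (\<Sum>m<n. if m = 1 then a else 0)"
      by (rule sum.cong) auto
    then show ?thesis using False Fl_zero by simp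
  qed
qed

lemma app_mult: "app (h * k) a = app h a * app k a"
proof (rule app_eqI)
  have E: "(\<lambda>n. \<Sum>i\<le>n. \<kappa> (fps_nth h i) * a ^ i * (\<kappa> (fps_nth k (n - i)) * a ^ (n - i))) =
     (\<lambda>n. \<kappa> (fps_nth (h * k) n) * a ^ n)"
  proof
    fix n
    have "(\<Sum>i\<le>n. \<kappa> (fps_nth h i) * a ^ i * (\<kappa> (fps_nth k (n - i)) * a ^ (n - i))) =
        (\<Sum>i\<le>n. \<kappa> (fps_nth h i * fps_nth k (n - i)) * a ^ n)"
    proof (rule sum.cong)
      fix i assume "i \<in> {..n}"
      then have "a ^ n = a ^ i * a ^ (n - i)" by (simp flip: power_add)
      then show "\<kappa> (fps_nth h i) * a ^ i * (\<kappa> (fps_nth k (n - i)) * a ^ (n - i)) =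
         \<kappa> (fps_nth h i * fps_nth k (n - i)) * a ^ n"
        by (simp add: scal_mult mult.assoc scal_left_commute[of "a ^ i"])
    qed simp
    then show "(\<Sum>i\<le>n. \<kappa> (fps_nth h i) * a ^ i * (\<kappa> (fps_nth k (n - i)) * a ^ (n - i))) =
      \<kappa> (fps_nth (h * k) n) * a ^ n"
      by (simp add: fps_mult_nth scal_sum sum_distrib_right atMost_atLeast0)
  qed
  show "sums_to (\<lambda>n. \<kappa> (fps_nth (h * k) n) * a ^ n) (app h a * app k a)"
    using sums_to_mult[OF app_sums[of h] app_sums[of k]] unfolding E .
qed

lemma app_power: "app (h ^ i) a = app h a ^ i"
  by (induction i) (simp_all add: app_one app_mult)

lemma app_Fl: "(\<And>i. i < n \<Longrightarrow> fps_nth h i = 0) \<Longrightarrow> app h a \<in> Fl n"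
  by (rule sums_to_tail[OF app_sums]) simp

lemma app_sum: "app (sum h A) a = (\<Sum>i\<in>A. app (h i) a)"
  by (induction A rule: infinite_finite_induct) (simp_all add: app_zero app_add)

text \<open>Modulo degree \<open>n\<close> the composite \<open>h oo k\<close> is a polynomial in
  \<open>k\<close>, because \<open>k ^ i\<close> starts in degree \<open>i\<close>;
  \<open>app_Fl\<close> carries this error estimate from one-variable series over to the
  ring.\<close>

lemma app_compose:
  assumes k: "fps_nth k 0 = 0"
  shows "app (h oo k) a = app h (app k a)"
proof (rule app_eqI[symmetric], rule sums_toI)
  have ka: "app k a \<in> Fl 1" by (rule app_Fl) (simp add: k)
  show "\<kappa> (fps_nth h m) * app k a ^ m \<in> Fl m" for m using Fl_scal Fl_power ka by blast
  fix n
  let ?d = "(h oo k) - (\<Sum>i<n. fps_const (fps_nth h i) * k ^ i)"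
  have "app (h oo k) a - (\<Sum>i<n. \<kappa> (fps_nth h i) * app k a ^ i) = app ?d a"
  proof -
    have "app (h oo k) a = app ?d a + app (\<Sum>i<n. fps_const (fps_nth h i) * k ^ i) a"
      using app_add[of ?d "\<Sum>i<n. fps_const (fps_nth h i) * k ^ i"] by (simp only: diff_add_cancel)
    then show ?thesis by (simp add: app_sum app_mult app_const app_power)
  qed
  moreover have "app ?d a \<in> Fl n"
  proof (rule app_Fl)
    fix j assume that: "j < n"
    have "(\<Sum>i<n. fps_nth h i * fps_nth (k ^ i) j) = (\<Sum>i\<in>{0..j}. fps_nth h i * fps_nth (k ^ i) j)"
      using that by (intro sum.mono_neutral_right) (auto simp: startsby_zero_power_prefix[OF k])
    then show "fps_nth ?d j = 0" by (simp add: fps_compose_nth fps_sum_nth)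
  qed
  ultimately show "app (h oo k) a - (\<Sum>i<n. \<kappa> (fps_nth h i) * app k a ^ i) \<in> Fl n"
    by simp
qed

end

section \<open>Exponential and logarithm\<close>

definition ex :: "'r \<Rightarrow> 'r" where "ex a = app (fps_exp 1) a"

text \<open>\<open>fps_ln 1\<close> is the series of \<open>log (1 + X)\<close>, hence the argument
  \<open>b - 1\<close>.\<close>

definition lg :: "'r \<Rightarrow> 'r" where "lg b = app (fps_ln 1) (b - 1)"

lemma ex_Fl: "a \<in> Fl 1 \<Longrightarrow> ex a - 1 \<in> Fl 1"
proof -
  assume a: "a \<in> Fl 1"
  have "ex a = app (fps_exp 1 - 1) a + app 1 a"
    unfolding ex_def by (simp add: app_add[OF a, symmetric])
  moreover have "app (fps_exp 1 - 1) a \<in> Fl 1" by (rule app_Fl[OF a]) simp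
  ultimately show ?thesis by (simp add: app_one[OF a])
qed

lemma fps_exp_ln: "(fps_exp 1 oo fps_ln 1) = (1 + fps_X :: 'c fps)"
  using fps_inv_fps_exp_compose(2)[of "1::'c"]
  by (simp add: fps_ln_fps_exp_inv fps_compose_sub_distrib algebra_simps)

lemma fps_ln_exp: "fps_ln 1 oo (fps_exp 1 - 1) = (fps_X :: 'c fps)"
  using fps_inv_fps_exp_compose(1)[of "1::'c"] by (simp add: fps_ln_fps_exp_inv)

lemma ex_lg: "b - 1 \<in> Fl 1 \<Longrightarrow> ex (lg b) = b"
  unfolding ex_def lg_def
  by (simp add: app_compose[symmetric] fps_exp_ln app_add app_one app_X)

lemma lg_Fl: "b - 1 \<in> Fl 1 \<Longrightarrow> lg b \<in> Fl 1"
  unfolding lg_def by (rule app_Fl) auto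

lemma lg_ex:
  assumes a: "a \<in> Fl 1" shows "lg (ex a) = a"
proof -
  have "ex a - 1 = app (fps_exp 1 - 1) a"
    using app_add[OF a, of "fps_exp 1 - 1" 1] by (simp add: app_one[OF a] ex_def)
  then have "lg (ex a) = app (fps_ln 1 oo (fps_exp 1 - 1)) a"
    unfolding lg_def by (simp add: app_compose[OF a])
  then show ?thesis by (simp add: fps_ln_exp app_X[OF a])
qed

text \<open>Writing \<open>e^(-a)\<close> as another series in the same \<open>a\<close> reduces the
  inverse laws to \<open>exp(-X) exp(X) = 1\<close> for one-variable series.\<close>

lemma ex_uminus:
  assumes a: "a \<in> Fl 1" shows "ex (- a) = app (fps_exp (- 1)) a"
proof -
  have "sums_to (\<lambda>k. \<kappa> (fps_nth (fps_exp 1) k) * (- a) ^ k) (app (fps_exp (- 1)) a)"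
  proof -
    have "\<kappa> (fps_nth (fps_exp 1) k) * (- a) ^ k = \<kappa> (fps_nth (fps_exp (- 1)) k) * a ^ k" for k
    proof (cases "even k")
      case False
      then show ?thesis by (simp add: scal_uminus)
    qed simp
    then show ?thesis using app_sums[OF a, of "fps_exp (- 1)"] by (simp only:)
  qed
  then show ?thesis unfolding ex_def by (rule app_eqI)
qed

lemma ex_zero: "ex 0 = 1"
  unfolding ex_def
proof (rule app_eqI, rule sums_toI)
  have E: "\<kappa> (fps_nth (fps_exp 1) m) * 0 ^ m = (if m = 0 then 1 else 0)" for m
    by (simp add: power_0_left)
  show "\<kappa> (fps_nth (fps_exp 1) m) * 0 ^ m \<in> Fl m" for m
    unfolding E using Fl_zero Fl_one by simp
  show "1 - (\<Sum>m<n. \<kappa> (fps_nth (fps_exp 1) m) * 0 ^ m) \<in> Fl n" for n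
    unfolding E using Fl_zero Fl_one by (cases n) simp_all
qed

lemma ex_minus_mult: "a \<in> Fl 1 \<Longrightarrow> ex (- a) * ex a = 1"
  unfolding ex_uminus
  by (simp add: ex_def app_mult[symmetric] fps_exp_add_mult[symmetric] app_one)

lemma ex_mult_minus: "a \<in> Fl 1 \<Longrightarrow> ex a * ex (- a) = 1"
  unfolding ex_uminus
  by (simp add: ex_def app_mult[symmetric] fps_exp_add_mult[symmetric] app_one)

end

text \<open>Each factor \<open>U\<close> to the right of \<open>D U\<close> is moved to the left by
  \<open>A U = U A - [U, A]\<close>, and Pascal's rule collects the binomial coefficients. After
  division by factorials this becomes
  \<open>(exp U)' = exp U ((1 - e^(-ad U)) / ad U)(U')\<close>.\<close>

lemma derivation_power:
  fixes D :: "'r::ring_1 \<Rightarrow> 'r"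
  assumes D: "\<And>a b. D (a * b) = a * D b + D a * b"
  shows "D (U ^ Suc n) = (\<Sum>k\<le>n. of_int ((- 1) ^ k * int (Suc n choose Suc k)) *
    (U ^ (n - k) * (commutator U ^^ k) (D U)))"
proof (induction n)
  case 0
  then show ?case by simp
next
  case (Suc n)
  let ?A = "\<lambda>k. (commutator U ^^ k) (D U)"
  let ?q = "\<lambda>k j. of_int ((- 1) ^ k * int (Suc n choose j)) :: 'r"
  have A: "?A k * U = U * ?A k - ?A (Suc k)" for k
    by (simp add: commutator_def)
  have "D (U ^ Suc (Suc n)) = U ^ Suc n * ?A 0 + D (U ^ Suc n) * U"
    by (simp only: power_Suc2[of U "Suc n"] D) simp
  also have "D (U ^ Suc n) * U = (\<Sum>k\<le>n. ?q k (Suc k) * (U ^ (n - k) * (?A k * U)))"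
    unfolding Suc.IH sum_distrib_right by (simp only: mult.assoc)
  also have "\<dots> = (\<Sum>k\<le>n. ?q k (Suc k) * (U ^ (Suc n - k) * ?A k)
      - ?q k (Suc k) * (U ^ (n - k) * ?A (Suc k)))"
  proof (rule sum.cong)
    fix k assume "k \<in> {..n}"
    then have "U ^ (Suc n - k) = U ^ (n - k) * U" by (simp add: Suc_diff_le power_Suc2 del: power_Suc)
    then show "?q k (Suc k) * (U ^ (n - k) * (?A k * U)) =
        ?q k (Suc k) * (U ^ (Suc n - k) * ?A k) - ?q k (Suc k) * (U ^ (n - k) * ?A (Suc k))"
      by (simp only: A right_diff_distrib mult.assoc)
  qed simp
  also have "U ^ Suc n * ?A 0 + \<dots> = (\<Sum>k\<le>n. ?q k (Suc k) * (U ^ (Suc n - k) * ?A k)) +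
      (U ^ Suc n * ?A 0 + (\<Sum>k\<le>n. ?q (Suc k) (Suc k) * (U ^ (n - k) * ?A (Suc k))))"
    by (simp add: sum_subtractf sum_negf)
  also have "U ^ Suc n * ?A 0 + (\<Sum>k\<le>n. ?q (Suc k) (Suc k) * (U ^ (n - k) * ?A (Suc k))) =
      (\<Sum>k\<le>Suc n. ?q k k * (U ^ (Suc n - k) * ?A k))"
    by (subst sum.atMost_Suc_shift) simp
  also have "(\<Sum>k\<le>n. ?q k (Suc k) * (U ^ (Suc n - k) * ?A k)) =
      (\<Sum>k\<le>Suc n. ?q k (Suc k) * (U ^ (Suc n - k) * ?A k))"
    by (simp add: binomial_eq_0 del: binomial_Suc_Suc)
  also have "\<dots> + (\<Sum>k\<le>Suc n. ?q k k * (U ^ (Suc n - k) * ?A k)) =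
     (\<Sum>k\<le>Suc n. of_int ((- 1) ^ k * int (Suc (Suc n) choose Suc k)) * (U ^ (Suc n - k) * ?A k))"
    unfolding sum.distrib[symmetric] distrib_right[symmetric] of_int_add[symmetric]
    by (simp only: binomial_Suc_Suc[of "Suc n"] of_nat_add distrib_left add.commute)
  finally show ?case .
qed

section \<open>Power series in a central variable t over a ring\<close>

context central_scalars
begin

text \<open>The auxiliary variable \<open>t\<close> makes \<open>e^(ta)\<close> converge for every
  ring element \<open>a\<close>, and the coefficient of \<open>t^n\<close> isolates the part of
  degree \<open>n\<close> in \<open>a\<close> and \<open>b\<close>.\<close>

definition tFl :: "nat \<Rightarrow> 'r fps set" where
  "tFl m = {f. \<forall>i<m. fps_nth f i = 0}"

lemma fps_complete_filtered_ring: "complete_filtered_ring (\<lambda>c. fps_const (\<kappa> c)) tFl"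
proof
  fix f g :: "'r fps" and m k :: nat and c :: 'c and x :: "nat \<Rightarrow> 'r fps"
  show "f \<in> tFl k \<Longrightarrow> g \<in> tFl m \<Longrightarrow> f * g \<in> tFl (k + m)"
  proof -
    assume f: "f \<in> tFl k" and g: "g \<in> tFl m"
    have "fps_nth (f * g) i = 0" if "i < k + m" for i
      unfolding fps_mult_nth
    proof (rule sum.neutral, rule ballI)
      fix j assume "j \<in> {0..i}"
      have "j < k \<or> i - j < m" using that \<open>j \<in> {0..i}\<close> by auto
      then show "fps_nth f j * fps_nth g (i - j) = 0" using f g by (auto simp: tFl_def)
    qed
    then show ?thesis by (simp add: tFl_def)
  qed
  show "(\<And>m. x m \<in> tFl m) \<Longrightarrow> \<exists>s. \<forall>n. s - (\<Sum>m<n. x m) \<in> tFl n"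
  proof (rule exI, rule allI)
    fix n assume x: "\<And>m. x m \<in> tFl m"
    have "(\<Sum>m\<le>i. fps_nth (x m) i) = (\<Sum>m<n. fps_nth (x m) i)" if "i < n" for i
      using that x by (intro sum.mono_neutral_left) (auto simp: tFl_def)
    then show "Abs_fps (\<lambda>i. \<Sum>m\<le>i. fps_nth (x m) i) - (\<Sum>m<n. x m) \<in> tFl n"
      by (simp add: tFl_def fps_sum_nth)
  qed
  show "fps_const (\<kappa> c) * f = f * fps_const (\<kappa> c)"
    by (rule fps_ext) (simp add: scal_commute)
  show "(\<And>m. f \<in> tFl m) \<Longrightarrow> f = 0"
    by (rule fps_ext) (auto simp: tFl_def)
qed (auto simp: tFl_def scal_add scal_mult simp flip: fps_const_add fps_const_mult)

interpretation tadic: complete_filtered_ring "\<lambda>c. fps_const (\<kappa> c)" tFl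
  by (rule fps_complete_filtered_ring)

abbreviation "texp \<equiv> complete_filtered_ring.ex (\<lambda>c. fps_const (\<kappa> c)) tFl"
abbreviation "tsums \<equiv> complete_filtered_ring.sums_to tFl"

lemma tsums_nth:
  assumes "tsums x s"
  shows "fps_nth s n = (\<Sum>m\<le>n. fps_nth (x m) n)"
proof -
  have "s - (\<Sum>m<Suc n. x m) \<in> tFl (Suc n)" using assms by (simp only: tadic.sums_to_def)
  then have "fps_nth (s - (\<Sum>m<Suc n. x m)) n = 0" unfolding tFl_def by blast
  then show ?thesis by (simp add: fps_sum_nth lessThan_Suc_atMost)
qed

lemma texp_nth_0: "U \<in> tFl 1 \<Longrightarrow> fps_nth (texp U) 0 = 1"
  using tadic.ex_Fl[of U] by (simp add: tFl_def)

text \<open>\<open>\<Phi>\<close> is \<open>((1 - e^(-ad U)) / ad U)(U')\<close>: the numbers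
  \<open>(-1)^k / (k+1)!\<close> are the coefficients of \<open>(1 - e^(-s)) / s\<close>. By
  \<open>derivation_power\<close> both sides are sums of the same series.\<close>

lemma fps_deriv_texp:
  assumes U: "U \<in> tFl 1"
  defines "y \<equiv> \<lambda>k. fps_const (\<kappa> ((- 1) ^ k / fact (Suc k))) * (commutator U ^^ k) (fps_deriv U)"
  obtains \<Phi> where "tsums y \<Phi>" "fps_deriv (texp U) = texp U * \<Phi>"
proof -
  let ?A = "\<lambda>k. (commutator U ^^ k) (fps_deriv U)"
  let ?s = "\<lambda>c. fps_const (\<kappa> c)"
  have A: "?A k \<in> tFl k" for k
  proof (induction k)
    case 0
    then show ?case by (simp add: tFl_def)
  next
    case (Suc k)
    then show ?case using tadic.Fl_mult[OF U Suc] tadic.Fl_mult[OF Suc U] tadic.Fl_diff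
      by (simp add: commutator_def)
  qed
  have yF: "y k \<in> tFl k" for k unfolding y_def by (rule tadic.Fl_scal[OF A])
  then obtain \<Phi> where \<Phi>: "tsums y \<Phi>" using tadic.sums_to_exists by blast
  let ?x = "\<lambda>k. ?s (fps_nth (fps_exp 1) k) * U ^ k"
  have ex: "tsums ?x (texp U)" unfolding tadic.ex_def by (rule tadic.app_sums[OF U])
  \<comment> \<open>Differentiation in \<open>t\<close> lowers the degree by one, so the exponential
    term of index \<open>n + 1\<close> is matched with the Cauchy product of index
    \<open>n\<close>.\<close>
  have E: "(\<Sum>i\<le>n. ?x i * y (n - i)) = fps_deriv (?x (Suc n))" for n
  proof -
    have "fps_deriv (?x (Suc n)) = ?s (1 / fact (Suc n)) * fps_deriv (U ^ Suc n)"
      by (simp del: power_Suc fact_Suc)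
    also have "\<dots> = (\<Sum>k\<le>n. ?s (1 / fact (Suc n)) *
        (of_int ((- 1) ^ k * int (Suc n choose Suc k)) * (U ^ (n - k) * ?A k)))"
      by (subst derivation_power) (simp_all only: fps_deriv_mult sum_distrib_left)
    also have "\<dots> = (\<Sum>k\<le>n. ?x (n - k) * y k)"
    proof (rule sum.cong)
      fix k assume "k \<in> {..n}"
      then have k: "k \<le> n" by simp
      have "?s (1 / fact (Suc n)) * (of_int ((- 1) ^ k * int (Suc n choose Suc k)) * (U ^ (n - k) * ?A k))
        = ?s (1 / fact (Suc n) * of_int ((- 1) ^ k * int (Suc n choose Suc k))) * (U ^ (n - k) * ?A k)"
        by (simp only: tadic.scal_of_int[symmetric] tadic.scal_mult_left)
      \<comment> \<open>This is
        \<open>(n+1 choose k+1) / (n+1)! = 1 / ((n-k)! (k+1)!)\<close>.\<close>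
      also have "1 / fact (Suc n) * of_int ((- 1) ^ k * int (Suc n choose Suc k)) =
          fps_nth (fps_exp 1) (n - k) * ((- 1) ^ k / fact (Suc k) :: 'c)"
        using k by (simp add: binomial_fact del: fact_Suc of_nat_Suc binomial_Suc_Suc)
      also have "?s \<dots> * (U ^ (n - k) * ?A k) = ?x (n - k) * y k"
        unfolding y_def mult.assoc tadic.scal_left_commute[of "U ^ (n - k)"]
        by (simp only: tadic.scal_mult_left)
      finally show "?s (1 / fact (Suc n)) *
        (of_int ((- 1) ^ k * int (Suc n choose Suc k)) * (U ^ (n - k) * ?A k)) = ?x (n - k) * y k" .
    qed simp
    also have "\<dots> = (\<Sum>i\<le>n. ?x i * y (n - i))"
      by (rule sum.reindex_bij_witness[of _ "\<lambda>i. n - i" "\<lambda>i. n - i"]) auto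
    finally show ?thesis by simp
  qed
  have "tsums (\<lambda>n. \<Sum>i\<le>n. ?x i * y (n - i)) (fps_deriv (texp U))"
    unfolding E
  proof (rule tadic.sums_toI)
    have dF: "fps_deriv f \<in> tFl m" if "f \<in> tFl (Suc m)" for f m using that by (auto simp: tFl_def)
    show "fps_deriv (?x (Suc m)) \<in> tFl m" for m
      by (rule dF) (use ex in \<open>unfold tadic.sums_to_def, blast\<close>)
    fix n
    have "texp U - (\<Sum>m<Suc n. ?x m) \<in> tFl (Suc n)" using ex by (simp only: tadic.sums_to_def)
    from dF[OF this] show "fps_deriv (texp U) - (\<Sum>m<n. fps_deriv (?x (Suc m))) \<in> tFl n"
      by (simp add: sum.lessThan_Suc_shift fps_deriv_sum del: sum.lessThan_Suc power_Suc fps_exp_nth)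
  qed
  moreover have "tsums (\<lambda>n. \<Sum>i\<le>n. ?x i * y (n - i)) (texp U * \<Phi>)"
    by (rule tadic.sums_to_mult[OF ex \<Phi>])
  ultimately have "fps_deriv (texp U) = texp U * \<Phi>" using tadic.sums_to_unique by blast
  then show thesis using \<Phi> that by blast
qed

lemma fps_commutator_nth:
  fixes f h :: "'r fps"
  shows "fps_nth (commutator f h) n = (\<Sum>i\<le>n. commutator (fps_nth f i) (fps_nth h (n - i)))"
proof -
  have "fps_nth (h * f) n = (\<Sum>i=0..n. fps_nth h (n - i) * fps_nth f i)"
    unfolding fps_mult_nth by (rule sum.reindex_bij_witness[of _ "\<lambda>i. n - i" "\<lambda>i. n - i"]) auto
  then show ?thesis
    by (simp add: commutator_def fps_mult_nth sum_subtractf atMost_atLeast0)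
qed

lemma linear_tFl: "fps_const a * fps_X \<in> tFl 1" "- (fps_const a * fps_X) \<in> tFl 1"
  by (auto simp: tFl_def)

text \<open>\<open>at\<close> commutes with \<open>a\<close>, so only the term \<open>k = 0\<close>
  of \<open>\<Phi>\<close> survives.\<close>

lemma fps_deriv_texp_linear:
  "fps_deriv (texp (fps_const a * fps_X)) = texp (fps_const a * fps_X) * fps_const a"
proof -
  let ?U = "fps_const a * fps_X :: 'r fps"
  define y where "y = (\<lambda>k. fps_const (\<kappa> ((- 1) ^ k / fact (Suc k))) * (commutator ?U ^^ k) (fps_deriv ?U))"
  have 1: "fps_deriv ?U = fps_const a" by simp
  have "commutator ?U (fps_const a) = 0"
    by (simp add: commutator_def mult.assoc fps_mult_fps_X_commute)
  then have "(commutator ?U ^^ Suc k) (fps_const a) = 0" for k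
    by (induction k) (simp_all add: commutator_def)
  then have y: "y k = (if k = 0 then fps_const a else 0)" for k
    unfolding y_def 1 by (cases k) simp_all
  obtain \<Phi> where \<Phi>: "tsums y \<Phi>" "fps_deriv (texp ?U) = texp ?U * \<Phi>"
    using fps_deriv_texp[OF linear_tFl(1)[of a]] unfolding y_def by blast
  have "\<Phi> = fps_const a"
  proof (rule fps_ext)
    fix n
    have "fps_nth \<Phi> n = (\<Sum>m\<le>n. if m = 0 then fps_nth (fps_const a) n else 0)"
      unfolding tsums_nth[OF \<Phi>(1)] by (rule sum.cong) (auto simp: y)
    then show "fps_nth \<Phi> n = fps_nth (fps_const a) n" by simp
  qed
  then show ?thesis using \<Phi>(2) by simp
qed

text \<open>\<open>U = log (e^(ta) e^(tb))\<close> satisfies the differential equation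
  \<open>\<Phi> = b + B\<close> with \<open>B = e^(-tb) a e^(tb)\<close>. Comparing coefficients of
  \<open>t^n\<close> expresses \<open>(n+1) U_(n+1)\<close> through \<open>b\<close>,
  \<open>B\<close> and iterated commutators of lower coefficients of \<open>U\<close>, so induction
  on \<open>n\<close> applies. As \<open>L'\<close> is not assumed to lie in \<open>L\<close>,
  membership in the two sets is carried along separately.\<close>

theorem formal_Baker_Campbell_Hausdorff:
  fixes L L' :: "'r set"
  assumes L: "a \<in> L" "b \<in> L"
    and L_add: "\<And>x y. x \<in> L \<Longrightarrow> y \<in> L \<Longrightarrow> x + y \<in> L"
    and L_scal: "\<And>c x. x \<in> L \<Longrightarrow> \<kappa> c * x \<in> L"
    and L_comm: "\<And>x y. x \<in> L \<Longrightarrow> y \<in> L \<Longrightarrow> commutator x y \<in> L"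
    and L'_add: "\<And>x y. x \<in> L' \<Longrightarrow> y \<in> L' \<Longrightarrow> x + y \<in> L'"
    and L'_scal: "\<And>c x. x \<in> L' \<Longrightarrow> \<kappa> c * x \<in> L'"
    and L'_comm: "\<And>x y. x \<in> L \<Longrightarrow> y \<in> L \<Longrightarrow> commutator x y \<in> L'"
  obtains U where "U \<in> tFl 1"
    "texp U = texp (fps_const a * fps_X) * texp (fps_const b * fps_X)"
    "\<And>n. fps_nth U n \<in> L" "fps_nth U 1 = a + b" "\<And>n. n \<ge> 2 \<Longrightarrow> fps_nth U n \<in> L'"
proof -
  have L0: "0 \<in> L" using L_scal[OF L(1), of 0] by simp
  have L'0: "0 \<in> L'" using L'_comm[OF L0 L0] by (simp add: commutator_def)
  have L_uminus: "- x \<in> L" if "x \<in> L" for x using L_scal[OF that, of "- 1"] by (simp add: scal_uminus)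
  have L'_uminus: "- x \<in> L'" if "x \<in> L'" for x using L'_scal[OF that, of "- 1"] by (simp add: scal_uminus)
  have L_sum: "sum f A \<in> L" if "\<And>i. i \<in> A \<Longrightarrow> f i \<in> L" for f and A :: "nat set"
    using that by (induction A rule: infinite_finite_induct) (simp_all add: L0 L_add)
  have L'_sum: "sum f A \<in> L'" if "\<And>i. i \<in> A \<Longrightarrow> f i \<in> L'" for f and A :: "nat set"
    using that by (induction A rule: infinite_finite_induct) (simp_all add: L'0 L'_add)
  let ?ta = "fps_const a * fps_X" and ?tb = "fps_const b * fps_X"
  let ?Ma = "texp ?ta" and ?Mb = "texp ?tb"
  define V where "V = ?Ma * ?Mb"
  define U where "U = complete_filtered_ring.lg (\<lambda>c. fps_const (\<kappa> c)) tFl V"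
  have V0: "V - 1 \<in> tFl 1"
    using texp_nth_0[OF linear_tFl(1)[of a]] texp_nth_0[OF linear_tFl(1)[of b]] by (simp add: V_def tFl_def)
  have U: "U \<in> tFl 1" and texpU: "texp U = V"
    unfolding U_def using tadic.lg_Fl[OF V0] tadic.ex_lg[OF V0] by auto
  have U0: "fps_nth U 0 = 0" using U by (simp add: tFl_def)
  \<comment> \<open>The conjugate of \<open>a\<close> that appears when the factor \<open>a\<close>
    in the derivative of \<open>e^(ta) e^(tb)\<close> is moved to the right of
    \<open>e^(tb)\<close>.\<close>
  define B where "B = texp (- ?tb) * (fps_const a * ?Mb)"
  have inv: "texp (- ?tb) * ?Mb = 1" "?Mb * texp (- ?tb) = 1" "texp (- ?ta) * ?Ma = 1"
    using tadic.ex_minus_mult tadic.ex_mult_minus linear_tFl by blast+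
  have MB: "?Mb * B = fps_const a * ?Mb"
    unfolding B_def mult.assoc[symmetric] inv(2) by simp
  \<comment> \<open>Differentiating \<open>e^(tb) B = a e^(tb)\<close> and cancelling
    \<open>e^(tb)\<close> gives \<open>B' = [B, b]\<close>, so all coefficients of \<open>B\<close>
    beyond the constant one are multiples of commutators.\<close>
  have "?Mb * fps_deriv B + ?Mb * (fps_const b * B) = ?Mb * (B * fps_const b)"
  proof -
    have "fps_deriv (?Mb * B) = ?Mb * fps_deriv B + ?Mb * (fps_const b * B)"
      by (simp only: fps_deriv_mult fps_deriv_texp_linear mult.assoc)
    moreover have "fps_deriv (fps_const a * ?Mb) = ?Mb * (B * fps_const b)"
      by (simp only: fps_deriv_mult_const_left fps_deriv_texp_linear mult.assoc[symmetric] MB)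
    ultimately show ?thesis using MB by simp
  qed
  then have "?Mb * fps_deriv B = ?Mb * commutator B (fps_const b)"
    by (simp add: commutator_def right_diff_distrib eq_diff_eq)
  then have "texp (- ?tb) * ?Mb * fps_deriv B = texp (- ?tb) * ?Mb * commutator B (fps_const b)"
    by (simp only: mult.assoc)
  then have DB: "fps_deriv B = commutator B (fps_const b)" by (simp add: inv)
  have BS: "fps_nth B (Suc n) = \<kappa> (1 / of_nat (Suc n)) * commutator (fps_nth B n) b" for n
  proof -
    have "fps_nth (fps_deriv B) n = commutator (fps_nth B n) b"
      unfolding DB by (simp add: commutator_def)
    then have "of_nat (Suc n) * fps_nth B (Suc n) = commutator (fps_nth B n) b" by simp
    then show ?thesis by (metis scal_inverse_of_nat zero_less_Suc)
  qed
  have B0: "fps_nth B 0 = a"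
    using arg_cong[OF MB, of "\<lambda>f. fps_nth f 0"] texp_nth_0[OF linear_tFl(1)[of b]] by simp
  have BL: "fps_nth B n \<in> L" for n
    by (induction n) (simp_all only: B0 BS L L_scal L_comm)
  have BL': "fps_nth B (Suc n) \<in> L'" for n
    by (simp only: BS L'_scal L'_comm BL L)
  define A where "A = (\<lambda>k. (commutator U ^^ k) (fps_deriv U))"
  obtain \<Phi> where \<Phi>: "tsums (\<lambda>k. fps_const (\<kappa> ((- 1) ^ k / fact (Suc k))) * A k) \<Phi>"
      "fps_deriv V = V * \<Phi>"
    using fps_deriv_texp[OF U] unfolding A_def texpU by blast
  have "fps_deriv V = V * (fps_const b + B)"
    unfolding V_def fps_deriv_mult fps_deriv_texp_linear distrib_left mult.assoc MB by simp
  then have "texp (- ?tb) * texp (- ?ta) * V * \<Phi> = texp (- ?tb) * texp (- ?ta) * V * (fps_const b + B)"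
    using \<Phi>(2) by (simp only: mult.assoc)
  moreover have "texp (- ?tb) * texp (- ?ta) * V = 1"
    by (metis (no_types, lifting) V_def inv(1,3) mult.assoc mult_1)
  ultimately have \<Phi>_eq: "\<Phi> = fps_const b + B" by simp
  \<comment> \<open>The term \<open>m = 0\<close> of \<open>\<Phi>\<close> is \<open>U'\<close>,
    whose \<open>n\<close>-th coefficient \<open>(n+1) U_(n+1)\<close> is the new unknown; the other
    terms involve only \<open>U_1, ..., U_n\<close>.\<close>
  have rec: "of_nat (Suc n) * fps_nth U (Suc n) = fps_nth (fps_const b + B) n -
      (\<Sum>m\<in>{1..n}. \<kappa> ((- 1) ^ m / fact (Suc m)) * fps_nth (A m) n)" for n
  proof -
    have "fps_nth \<Phi> n = (\<Sum>m\<in>insert 0 {1..n}. \<kappa> ((- 1) ^ m / fact (Suc m)) * fps_nth (A m) n)"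
      unfolding tsums_nth[OF \<Phi>(1)] by (rule sum.cong) auto
    then show ?thesis unfolding \<Phi>_eq by (simp add: A_def)
  qed
  \<comment> \<open>Since \<open>U_0 = 0\<close>, the coefficients of \<open>[U, f]\<close> up to
    index \<open>n\<close> use only coefficients of \<open>f\<close> below \<open>n\<close>. This is
    decisive for \<open>f = U'\<close>, whose coefficient \<open>n\<close> contains the still
    unknown \<open>U_(n+1)\<close>.\<close>
  have comm_LL': "fps_nth (commutator U f) i \<in> L \<and> fps_nth (commutator U f) i \<in> L'"
    if "\<And>j. j \<le> n \<Longrightarrow> fps_nth U j \<in> L" "\<And>j. j < n \<Longrightarrow> fps_nth f j \<in> L" "i \<le> n" for f i n
  proof -
    have *: "commutator (fps_nth U j) (fps_nth f (i - j)) \<in> L \<inter> L'" if "j \<in> {..i}" for j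
    proof (cases j)
      case 0
      then show ?thesis by (simp add: U0 commutator_def L0 L'0)
    next
      case (Suc j')
      then have "fps_nth U j \<in> L" "fps_nth f (i - j) \<in> L" using that \<open>i \<le> n\<close> \<open>\<And>j. j \<le> n \<Longrightarrow> fps_nth U j \<in> L\<close>
        \<open>\<And>j. j < n \<Longrightarrow> fps_nth f j \<in> L\<close> by auto
      then show ?thesis using L_comm L'_comm by simp
    qed
    show ?thesis unfolding fps_commutator_nth
      by (intro conjI L_sum L'_sum) (use * in blast)+
  qed
  have UL: "\<forall>i\<le>n. fps_nth U i \<in> L \<and> (2 \<le> i \<longrightarrow> fps_nth U i \<in> L')" for n
  proof (induction n)
    case 0
    then show ?case using U0 L0 by simp
  next
    case (Suc n)
    then have IH: "fps_nth U i \<in> L" if "i \<le> n" for i using that by blast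
    have AL: "(\<forall>i<n. fps_nth (A k) i \<in> L) \<and> (k \<ge> 1 \<longrightarrow> fps_nth (A k) n \<in> L \<and> fps_nth (A k) n \<in> L')" for k
    proof (induction k)
      case 0
      have "of_nat (Suc i) * fps_nth U (Suc i) \<in> L" if "i < n" for i
        using L_scal[OF IH[of "Suc i"], of "of_nat (Suc i)"] that by (simp only: scal_of_nat Suc_leI)
      then show ?case by (simp add: A_def)
    next
      case (Suc k)
      have "fps_nth (A (Suc k)) i \<in> L \<and> fps_nth (A (Suc k)) i \<in> L'" if "i \<le> n" for i
        using comm_LL'[of n "A k" i] IH Suc that by (simp add: A_def)
      then show ?case by simp
    qed
    have S: "(\<Sum>m\<in>{1..n}. \<kappa> ((- 1) ^ m / fact (Suc m)) * fps_nth (A m) n) \<in> L"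
      "(\<Sum>m\<in>{1..n}. \<kappa> ((- 1) ^ m / fact (Suc m)) * fps_nth (A m) n) \<in> L'"
      by (rule L_sum L'_sum, rule L_scal L'_scal, use AL in auto)+
    have "fps_nth (fps_const b + B) n \<in> L"
      using BL L L0 L_add by (cases n) simp_all
    then have 1: "of_nat (Suc n) * fps_nth U (Suc n) \<in> L"
      unfolding rec using S(1) L_add L_uminus by (metis add_uminus_conv_diff)
    have 2: "of_nat (Suc n) * fps_nth U (Suc n) \<in> L'" if n2: "2 \<le> Suc n"
    proof -
      obtain n' where "n = Suc n'" using n2 by (cases n) auto
      then have "fps_nth (fps_const b + B) n \<in> L'" using BL' by simp
      then show ?thesis
        unfolding rec using S(2) L'_add L'_uminus by (metis add_uminus_conv_diff)
    qed
    have "fps_nth U (Suc n) = \<kappa> (1 / of_nat (Suc n)) * (of_nat (Suc n) * fps_nth U (Suc n))"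
      by (simp only: scal_inverse_of_nat[OF zero_less_Suc])
    then have "fps_nth U (Suc n) \<in> L \<and> (2 \<le> Suc n \<longrightarrow> fps_nth U (Suc n) \<in> L')"
      using 1 2 L_scal L'_scal by metis
    then show ?case using Suc le_Suc_eq by auto
  qed
  moreover have "fps_nth U 1 = a + b"
    using rec[of 0] B0 by (simp add: add.commute)
  ultimately show thesis using that[OF U] texpU V_def by blast
qed

end

section \<open>Setting t = 1\<close>

context complete_filtered_ring
begin

interpretation tadic: complete_filtered_ring "\<lambda>c. fps_const (\<kappa> c)" tFl
  by (rule fps_complete_filtered_ring)

lemma fps_mult_nth_fun: "fps_nth (f * h) = (\<lambda>n. \<Sum>i\<le>n. fps_nth f i * fps_nth h (n - i))"
  for f h :: "'r fps"
  by (rule ext) (simp add: fps_mult_nth atMost_atLeast0)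

text \<open>\<open>sums_to (fps_nth f) s\<close> says that \<open>f\<close> can be evaluated at
  \<open>t = 1\<close>, with value \<open>s\<close>.\<close>

lemma sums_to_fps_mult:
  "sums_to (fps_nth f) s \<Longrightarrow> sums_to (fps_nth h) t \<Longrightarrow> sums_to (fps_nth (f * h)) (s * t)"
  unfolding fps_mult_nth_fun by (rule sums_to_mult)

lemma sums_to_fps_const:
  assumes "a \<in> Fl 0" shows "sums_to (fps_nth (fps_const a)) a"
proof (rule sums_toI)
  show "fps_nth (fps_const a) m \<in> Fl m" for m using assms Fl_zero by simp
  show "a - (\<Sum>m<n. fps_nth (fps_const a) m) \<in> Fl n" for n
    using assms Fl_zero by (cases n) simp_all
qed

lemma sums_to_fps_power: "sums_to (fps_nth f) s \<Longrightarrow> sums_to (fps_nth (f ^ k)) (s ^ k)"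
proof (induction k)
  case 0
  then show ?case using sums_to_fps_const[OF Fl_one] by (simp only: fps_const_1_eq_1 power_0)
qed (simp add: sums_to_fps_mult)

lemma sums_to_fps_linear:
  assumes "a \<in> Fl 1" shows "sums_to (fps_nth (fps_const a * fps_X)) a"
proof (rule sums_toI)
  show "fps_nth (fps_const a * fps_X) m \<in> Fl m" for m
    using assms Fl_zero by (cases "m = 1") simp_all
  show "a - (\<Sum>m<n. fps_nth (fps_const a * fps_X) m) \<in> Fl n" for n
  proof (cases "n \<le> 1")
    case True
    then show ?thesis using Fl_le[OF assms True] by (cases n) simp_all
  next
    case False
    have "(\<Sum>m<n. fps_nth (fps_const a * fps_X) m) = (\<Sum>m<n. if m = 1 then a else 0)"
      by (rule sum.cong) auto
    then show ?thesis using False Fl_zero by simp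
  qed
qed

text \<open>An interchange of two summations: modulo \<open>Fl n\<close> only the powers
  \<open>k < n\<close> matter on both sides, since \<open>f ^ k\<close> starts in degree
  \<open>k\<close> and \<open>s ^ k\<close> lies in \<open>Fl k\<close>, and each of these finitely
  many powers is evaluated separately.\<close>

lemma sums_to_fps_app:
  assumes f: "f \<in> tFl 1" and s: "sums_to (fps_nth f) s"
  shows "sums_to (fps_nth (tadic.app h f)) (app h s)"
proof (rule sums_toI)
  have s1: "s \<in> Fl 1" by (rule sums_to_tail[OF s]) (use f in \<open>simp add: tFl_def\<close>)
  have nth: "fps_nth (tadic.app h f) m = (\<Sum>k\<le>m. \<kappa> (fps_nth h k) * fps_nth (f ^ k) m)" for m
    using tsums_nth[OF tadic.app_sums[OF f, of h]] by simp
  have pF: "fps_nth (f ^ k) m \<in> Fl m" for k m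
    using sums_to_fps_power[OF s] by (simp add: sums_to_def)
  show "fps_nth (tadic.app h f) m \<in> Fl m" for m
    unfolding nth by (intro Fl_sum Fl_scal pF)
  fix n
  have nth': "fps_nth (tadic.app h f) m = (\<Sum>k<n. \<kappa> (fps_nth h k) * fps_nth (f ^ k) m)" if "m < n" for m
    unfolding nth
  proof (rule sum.mono_neutral_left)
    show "\<forall>k\<in>{..<n} - {..m}. \<kappa> (fps_nth h k) * fps_nth (f ^ k) m = 0"
      using tadic.Fl_power[OF f] by (auto simp: tFl_def)
  qed (use that in auto)
  have "app h s - (\<Sum>m<n. fps_nth (tadic.app h f) m) =
    (app h s - (\<Sum>k<n. \<kappa> (fps_nth h k) * s ^ k)) +
    (\<Sum>k<n. \<kappa> (fps_nth h k) * (s ^ k - (\<Sum>m<n. fps_nth (f ^ k) m)))"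
  proof -
    have "(\<Sum>m<n. fps_nth (tadic.app h f) m) = (\<Sum>m<n. \<Sum>k<n. \<kappa> (fps_nth h k) * fps_nth (f ^ k) m)"
      by (rule sum.cong) (simp_all add: nth')
    also have "\<dots> = (\<Sum>k<n. \<Sum>m<n. \<kappa> (fps_nth h k) * fps_nth (f ^ k) m)"
      by (rule sum.swap)
    finally show ?thesis by (simp add: right_diff_distrib sum_subtractf sum_distrib_left)
  qed
  moreover have "app h s - (\<Sum>k<n. \<kappa> (fps_nth h k) * s ^ k) \<in> Fl n"
    using app_sums[OF s1] by (simp add: sums_to_def)
  moreover have "(\<Sum>k<n. \<kappa> (fps_nth h k) * (s ^ k - (\<Sum>m<n. fps_nth (f ^ k) m))) \<in> Fl n"
    using sums_to_fps_power[OF s] by (intro Fl_sum Fl_scal) (simp add: sums_to_def)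
  ultimately show "app h s - (\<Sum>m<n. fps_nth (tadic.app h f) m) \<in> Fl n"
    by (simp only: Fl_add)
qed

text \<open>The formal theorem at \<open>t = 1\<close>, with \<open>z m\<close> the coefficient of
  \<open>t^m\<close>. The conclusion concerns the terms and not their sum, because \<open>L\<close>
  and \<open>L'\<close> carry no closedness assumption; each application supplies its own limit
  argument.\<close>

theorem Baker_Campbell_Hausdorff:
  fixes L L' :: "'r set"
  assumes a: "a \<in> Fl 1" and b: "b \<in> Fl 1" and L: "a \<in> L" "b \<in> L"
    and "\<And>x y. x \<in> L \<Longrightarrow> y \<in> L \<Longrightarrow> x + y \<in> L"
    and "\<And>c x. x \<in> L \<Longrightarrow> \<kappa> c * x \<in> L"
    and "\<And>x y. x \<in> L \<Longrightarrow> y \<in> L \<Longrightarrow> commutator x y \<in> L"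
    and "\<And>x y. x \<in> L' \<Longrightarrow> y \<in> L' \<Longrightarrow> x + y \<in> L'"
    and "\<And>c x. x \<in> L' \<Longrightarrow> \<kappa> c * x \<in> L'"
    and "\<And>x y. x \<in> L \<Longrightarrow> y \<in> L \<Longrightarrow> commutator x y \<in> L'"
  obtains z where "sums_to z (lg (ex a * ex b))"
    "\<And>m. z m \<in> L" "z 0 = 0" "z 1 = a + b" "\<And>m. m \<ge> 2 \<Longrightarrow> z m \<in> L'"
proof -
  obtain U where U: "U \<in> tFl 1"
    "texp U = texp (fps_const a * fps_X) * texp (fps_const b * fps_X)"
    "\<And>n. fps_nth U n \<in> L" "fps_nth U 1 = a + b" "\<And>n. n \<ge> 2 \<Longrightarrow> fps_nth U n \<in> L'"
    using formal_Baker_Campbell_Hausdorff[of a L b L', OF L assms(5-10)] by blast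
  let ?V = "texp (fps_const a * fps_X) * texp (fps_const b * fps_X)"
  have V: "sums_to (fps_nth ?V) (ex a * ex b)"
    unfolding tadic.ex_def ex_def
    by (intro sums_to_fps_mult sums_to_fps_app linear_tFl sums_to_fps_linear a b)
  have V1: "?V - 1 \<in> tFl 1"
    unfolding U(2)[symmetric] by (rule tadic.ex_Fl[OF U(1)])
  have "sums_to (fps_nth (?V - 1)) (ex a * ex b - 1)"
  proof -
    have "fps_nth (?V - 1) = (\<lambda>n. fps_nth ?V n + \<kappa> (- 1) * fps_nth (fps_const 1) n)"
      by (rule ext) (simp add: scal_uminus)
    then show ?thesis
      using sums_to_add[OF V sums_to_scal[OF sums_to_fps_const[OF Fl_one], of "- 1"]]
      by (simp only: scal_uminus scal_one mult_minus_left mult_1 add_uminus_conv_diff)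
  qed
  from sums_to_fps_app[OF V1 this, of "fps_ln 1"]
  have "sums_to (fps_nth (tadic.lg ?V)) (lg (ex a * ex b))"
    by (simp add: tadic.lg_def lg_def)
  then have "sums_to (fps_nth U) (lg (ex a * ex b))"
    unfolding U(2)[symmetric] by (simp add: tadic.lg_ex[OF U(1)])
  moreover have "fps_nth U 0 = 0" using U(1) by (simp add: tFl_def)
  ultimately show thesis using U(3-5) by (intro that)
qed

end

subsection \<open>Noncommutative power series\<close>

lemma cf_smul [simp]: "cf (c \<odot> a) w = c * cf a w"
  by (simp add: smul_def)

lemma cf_sum: "cf (sum f A) w = (\<Sum>i\<in>A. cf (f i) w)"
  by (induction A rule: infinite_finite_induct) simp_all

lemma cf_letter: "cf (letter x) w = (if w = [x] then 1 else 0)"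
  by (simp add: letter_def)

lemma cf_mult_Nil: "cf (a * b) [] = cf a [] * cf b []"
  by (simp add: cf_mult)

lemma smul_one_mult [simp]: "(c \<odot> 1) * a = c \<odot> a"
proof (rule ncs_eqI)
  fix w
  have "cf ((c \<odot> 1) * a) w = (\<Sum>k\<le>length w. if k = 0 then c * cf a w else 0)"
    unfolding cf_mult by (rule sum.cong) (auto simp: cf_one)
  then show "cf ((c \<odot> 1) * a) w = cf (c \<odot> a) w" by simp
qed

lemma smul_mult_left: "(c \<odot> a) * b = c \<odot> (a * b)"
  by (rule ncs_eqI) (simp add: cf_mult sum_distrib_left mult.assoc)

lemma smul_mult_right: "a * (c \<odot> b) = c \<odot> (a * b)"
  by (rule ncs_eqI) (simp add: cf_mult sum_distrib_left mult.left_commute)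

lemma mult_smul_one: "a * (c \<odot> 1) = c \<odot> a"
  by (simp add: smul_mult_right)

text \<open>
  \<open>ncs_ge \<nu> m\<close> is used with \<open>\<nu> = length\<close>, which \<open>fps_app\<close> refers to, and with \<open>\<nu> = wtw\<close>.
\<close>

definition ncs_ge :: "('x list \<Rightarrow> nat) \<Rightarrow> nat \<Rightarrow> ('x, 'k::zero) ncs set" where
  "ncs_ge \<nu> m = {a. \<forall>w. cf a w \<noteq> 0 \<longrightarrow> m \<le> \<nu> w}"

lemma ncs_geD: "a \<in> ncs_ge \<nu> m \<Longrightarrow> \<nu> w < m \<Longrightarrow> cf a w = 0"
  unfolding ncs_ge_def using not_le by blast

lemma ncs_geI: "(\<And>w. \<nu> w < m \<Longrightarrow> cf a w = 0) \<Longrightarrow> a \<in> ncs_ge \<nu> m"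
  unfolding ncs_ge_def using not_le by blast

lemma ncs_ge_mult:
  fixes a b :: "('x, 'k::comm_ring_1) ncs"
  assumes \<nu>: "\<And>u v. \<nu> (u @ v) = \<nu> u + \<nu> v" and a: "a \<in> ncs_ge \<nu> k" and b: "b \<in> ncs_ge \<nu> m"
  shows "a * b \<in> ncs_ge \<nu> (k + m)"
proof (rule ncs_geI)
  fix w assume w: "\<nu> w < k + m"
  have "cf a (take i w) * cf b (drop i w) = 0" for i
  proof -
    have "\<nu> w = \<nu> (take i w) + \<nu> (drop i w)" by (simp flip: \<nu>)
    then have "\<nu> (take i w) < k \<or> \<nu> (drop i w) < m" using w by linarith
    then show ?thesis using ncs_geD[OF a] ncs_geD[OF b] by auto
  qed
  then show "cf (a * b) w = 0" by (simp add: cf_mult)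
qed

lemma ncs_ge_complete:
  fixes x :: "nat \<Rightarrow> ('x, 'k::comm_ring_1) ncs"
  assumes "\<And>m. x m \<in> ncs_ge \<nu> m"
  shows "Ncs (\<lambda>w. \<Sum>m\<le>\<nu> w. cf (x m) w) - (\<Sum>m<n. x m) \<in> ncs_ge \<nu> n"
proof (rule ncs_geI)
  fix w assume "\<nu> w < n"
  then have "(\<Sum>m\<le>\<nu> w. cf (x m) w) = (\<Sum>m<n. cf (x m) w)"
    by (intro sum.mono_neutral_left) (auto intro!: ncs_geD[OF assms])
  then show "cf (Ncs (\<lambda>w. \<Sum>m\<le>\<nu> w. cf (x m) w) - (\<Sum>m<n. x m)) w = 0"
    by (simp add: cf_sum)
qed

interpretation nps: complete_filtered_ring
  "\<lambda>c::'k::field_char_0. c \<odot> (1 :: ('x, 'k) ncs)" "ncs_ge length"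
proof
  fix a b :: "('x, 'k) ncs" and c d :: 'k and k m :: nat and x :: "nat \<Rightarrow> ('x, 'k) ncs"
  show "a \<in> ncs_ge length k \<Longrightarrow> b \<in> ncs_ge length m \<Longrightarrow> a * b \<in> ncs_ge length (k + m)"
    by (rule ncs_ge_mult) simp_all
  show "(\<And>m. x m \<in> ncs_ge length m) \<Longrightarrow> \<exists>s. \<forall>n. s - (\<Sum>m<n. x m) \<in> ncs_ge length n"
    using ncs_ge_complete[of x length] by blast
  show "(\<And>m. a \<in> ncs_ge length m) \<Longrightarrow> a = 0"
    by (rule ncs_eqI) (metis cf_simps(1) lessI ncs_geD)
  show "(c \<odot> 1) * a = a * (c \<odot> 1)" by (simp add: mult_smul_one)
  show "a \<in> ncs_ge length m \<Longrightarrow> b \<in> ncs_ge length m \<Longrightarrow> a + b \<in> ncs_ge length m"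
    by (auto simp: ncs_ge_def) (metis add.right_neutral add_0)
qed (auto simp: ncs_ge_def cf_one ncs.scale_left_distrib)

lemma in_ncs_ge_length_1: "a \<in> ncs_ge length 1 \<longleftrightarrow> cf a [] = 0"
  by (auto simp: ncs_ge_def Suc_le_eq)

lemma fps_app_sums:
  fixes a :: "('x, 'k::field_char_0) ncs"
  assumes "cf a [] = 0"
  shows "nps.sums_to (\<lambda>k. fps_nth h k \<odot> a ^ k) (fps_app h a)"
proof -
  have "fps_nth h k \<odot> a ^ k \<in> ncs_ge length k" for k
    using nps.app_terms[of a h k] assms by (simp only: in_ncs_ge_length_1 smul_one_mult)
  from ncs_ge_complete[of "\<lambda>k. fps_nth h k \<odot> a ^ k", OF this] this show ?thesis
    unfolding nps.sums_to_def fps_app_def cf_smul by blast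
qed

text \<open>The bridge from the coefficientwise definition, truncated at the length of the word, to
  the abstract \<open>app\<close> and all its laws.\<close>

lemma fps_app_eq:
  fixes a :: "('x, 'k::field_char_0) ncs"
  assumes "cf a [] = 0"
  shows "fps_app h a = nps.app h a"
  using fps_app_sums[OF assms] by (intro nps.app_eqI[symmetric]) (simp only: smul_one_mult)

lemma ncs_exp_eq: "cf a [] = 0 \<Longrightarrow> ncs_exp a = nps.ex a"
  by (simp add: ncs_exp_def nps.ex_def fps_app_eq)

lemma ncs_log_eq: "cf b [] = 1 \<Longrightarrow> ncs_log b = nps.lg b"
  by (simp add: ncs_log_def nps.lg_def fps_app_eq cf_one)

lemma cf_ncs_exp_Nil: "cf (ncs_exp a) [] = 1"
  by (simp add: ncs_exp_def fps_app_def cf_one)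

lemma cf_ncs_log_Nil: "cf (ncs_log b) [] = 0"
  by (simp add: ncs_log_def fps_app_def)

lemma ncs_log_exp: "cf a [] = 0 \<Longrightarrow> ncs_log (ncs_exp a) = a"
  using nps.lg_ex[OF in_ncs_ge_length_1[THEN iffD2, of a]]
  by (simp add: ncs_log_eq cf_ncs_exp_Nil ncs_exp_eq[symmetric])

lemma ncs_exp_log:
  assumes "cf b [] = 1"
  shows "ncs_exp (ncs_log b) = b"
proof -
  have "nps.ex (nps.lg b) = b"
    by (rule nps.ex_lg) (use assms in \<open>simp only: in_ncs_ge_length_1, simp add: cf_one\<close>)
  then show ?thesis using assms cf_ncs_log_Nil[of b] by (simp add: ncs_exp_eq ncs_log_eq)
qed

lemma ncs_exp_inverse:
  assumes "cf a [] = 0"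
  shows "ncs_exp (- a) * ncs_exp a = 1" "ncs_exp a * ncs_exp (- a) = 1"
  using nps.ex_minus_mult[OF in_ncs_ge_length_1[THEN iffD2], of a]
    nps.ex_mult_minus[OF in_ncs_ge_length_1[THEN iffD2], of a] assms
  by (simp_all add: ncs_exp_eq)

lemma ncs_inv_eqI:
  assumes "a * b = 1" "b * a = 1"
  shows "ncs_inv a = b"
  unfolding ncs_inv_def
proof (rule the_equality)
  show "c = b" if "a * c = 1 \<and> c * a = 1" for c
    using that assms by (metis mult.assoc mult.left_neutral mult.right_neutral)
qed (use assms in simp)

lemma finite_gens: "finite (gens g n)"
  by (simp add: gens_def)

lemma wt_pos: "1 \<le> wt x"
  by (cases x) simp_all

lemma wtw_append: "wtw (u @ v) = wtw u + wtw v"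
  by (simp add: wtw_def)

lemma wtw_simps [simp]: "wtw [] = 0" "wtw (x # w) = wt x + wtw w"
  by (simp_all add: wtw_def)

lemma length_le_wtw: "length w \<le> wtw w"
proof (induction w)
  case (Cons x w)
  then show ?case using wt_pos[of x] by simp
qed simp

subsection \<open>The filtered algebra\<close>

lemma Alg_zero [simp]: "0 \<in> Alg g n"
  and Alg_one [simp]: "1 \<in> Alg g n"
  and Alg_add: "a \<in> Alg g n \<Longrightarrow> b \<in> Alg g n \<Longrightarrow> a + b \<in> Alg g n"
  and Alg_uminus: "a \<in> Alg g n \<Longrightarrow> - a \<in> Alg g n"
  and Alg_smul: "a \<in> Alg g n \<Longrightarrow> c \<odot> a \<in> Alg g n"
  and Alg_letter: "x \<in> gens g n \<Longrightarrow> letter x \<in> Alg g n"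
  by (auto simp: Alg_def cf_one cf_letter) (metis add.right_neutral subsetD)

lemma Alg_diff: "a \<in> Alg g n \<Longrightarrow> b \<in> Alg g n \<Longrightarrow> a - b \<in> Alg g n"
  using Alg_add[of a g n "- b"] Alg_uminus[of b g n] by simp

lemma Alg_sum: "(\<And>i. i \<in> I \<Longrightarrow> f i \<in> Alg g n) \<Longrightarrow> sum f I \<in> Alg g n"
  by (induction I rule: infinite_finite_induct) (simp_all add: Alg_add)

lemma Alg_mult:
  assumes a: "a \<in> Alg g n" and b: "b \<in> Alg g n" shows "a * b \<in> Alg g n"
  unfolding Alg_def
proof (intro CollectI allI impI)
  fix w assume "cf (a * b) w \<noteq> 0"
  then obtain k where "cf a (take k w) * cf b (drop k w) \<noteq> 0"
    unfolding cf_mult by (rule sum.not_neutral_contains_not_neutral)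
  then have "set (take k w) \<subseteq> gens g n" "set (drop k w) \<subseteq> gens g n"
    using a b unfolding Alg_def by auto
  then show "set w \<subseteq> gens g n" by (metis append_take_drop_id set_append Un_subset_iff)
qed

lemma Alg_power: "a \<in> Alg g n \<Longrightarrow> a ^ k \<in> Alg g n"
  by (induction k) (simp_all add: Alg_mult)

lemma Alg_prod_list: "(\<And>a. a \<in> set as \<Longrightarrow> a \<in> Alg g n) \<Longrightarrow> prod_list as \<in> Alg g n"
  by (induction as) (simp_all add: Alg_mult)

lemma Alg_commutator: "a \<in> Alg g n \<Longrightarrow> b \<in> Alg g n \<Longrightarrow> commutator a b \<in> Alg g n"
  by (simp add: commutator_def Alg_diff Alg_mult)

lemma Alg_Ncs_sum:
  assumes "\<And>k. x k \<in> Alg g n"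
  shows "Ncs (\<lambda>w. \<Sum>k\<le>N w. c k * cf (x k) w) \<in> Alg g n"
  unfolding Alg_def
proof (intro CollectI allI impI)
  fix w assume "cf (Ncs (\<lambda>w. \<Sum>k\<le>N w. c k * cf (x k) w)) w \<noteq> 0"
  then have "(\<Sum>k\<le>N w. c k * cf (x k) w) \<noteq> 0" by simp
  then obtain k where "c k * cf (x k) w \<noteq> 0"
    by (rule sum.not_neutral_contains_not_neutral)
  then show "set w \<subseteq> gens g n" using assms unfolding Alg_def by fastforce
qed

lemma Alg_fps_app: "a \<in> Alg g n \<Longrightarrow> fps_app h a \<in> Alg g n"
  unfolding fps_app_def by (rule Alg_Ncs_sum) (rule Alg_power)

lemma Alg_exp: "a \<in> Alg g n \<Longrightarrow> ncs_exp a \<in> Alg g n"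
  by (simp add: ncs_exp_def Alg_fps_app)

lemma Alg_log: "b \<in> Alg g n \<Longrightarrow> ncs_log b \<in> Alg g n"
  by (simp add: ncs_log_def Alg_fps_app Alg_diff)

lemma Filt_eq: "Filt g n m = Alg g n \<inter> ncs_ge wtw m"
  by (auto simp: Filt_def ncs_ge_def)

lemma Filt_Alg: "a \<in> Filt g n m \<Longrightarrow> a \<in> Alg g n"
  by (simp add: Filt_def)

lemma FiltI: "a \<in> Alg g n \<Longrightarrow> (\<And>w. wtw w < m \<Longrightarrow> cf a w = 0) \<Longrightarrow> a \<in> Filt g n m"
  by (simp add: Filt_eq ncs_geI)

lemma FiltD: "a \<in> Filt g n m \<Longrightarrow> wtw w < m \<Longrightarrow> cf a w = 0"
  using ncs_geD[of a wtw m w] by (simp add: Filt_eq)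

lemma Filt_0 [simp]: "Filt g n 0 = Alg g n"
  by (simp add: Filt_def)

lemma Filt_zero [simp]: "0 \<in> Filt g n m"
  by (simp add: Filt_def)

lemma Filt_add: "a \<in> Filt g n m \<Longrightarrow> b \<in> Filt g n m \<Longrightarrow> a + b \<in> Filt g n m"
  by (intro FiltI) (simp_all add: Filt_Alg Alg_add FiltD)

lemma Filt_uminus: "a \<in> Filt g n m \<Longrightarrow> - a \<in> Filt g n m"
  by (intro FiltI) (simp_all add: Filt_Alg Alg_uminus FiltD)

lemma Filt_diff: "a \<in> Filt g n m \<Longrightarrow> b \<in> Filt g n m \<Longrightarrow> a - b \<in> Filt g n m"
  by (intro FiltI) (simp_all add: Filt_Alg Alg_diff FiltD)

lemma Filt_smul: "a \<in> Filt g n m \<Longrightarrow> c \<odot> a \<in> Filt g n m"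
  by (intro FiltI) (simp_all add: Filt_Alg Alg_smul FiltD)

lemma Filt_sum: "(\<And>i. i \<in> I \<Longrightarrow> f i \<in> Filt g n m) \<Longrightarrow> sum f I \<in> Filt g n m"
  by (induction I rule: infinite_finite_induct) (simp_all add: Filt_add)

lemma Filt_le: "a \<in> Filt g n m \<Longrightarrow> k \<le> m \<Longrightarrow> a \<in> Filt g n k"
  by (force simp: Filt_def)

lemma Filt_mult: "a \<in> Filt g n k \<Longrightarrow> b \<in> Filt g n m \<Longrightarrow> a * b \<in> Filt g n (k + m)"
  by (simp add: Filt_eq Alg_mult ncs_ge_mult wtw_append)

lemma Filt_mult_left: "a \<in> Alg g n \<Longrightarrow> b \<in> Filt g n m \<Longrightarrow> a * b \<in> Filt g n m"
  using Filt_mult[of a g n 0 b m] by simp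

lemma Filt_mult_right: "a \<in> Filt g n m \<Longrightarrow> b \<in> Alg g n \<Longrightarrow> a * b \<in> Filt g n m"
  using Filt_mult[of a g n m b 0] by simp

lemma Filt_letter: "x \<in> gens g n \<Longrightarrow> letter x \<in> Filt g n (wt x)"
  by (intro FiltI) (auto simp: Alg_letter cf_letter)

lemma Filt_1_iff: "a \<in> Filt g n 1 \<longleftrightarrow> a \<in> Alg g n \<and> cf a [] = 0"
proof -
  have "cf a w = 0" if "cf a [] = 0" "wtw w < 1" for w :: "gen list"
    using that length_le_wtw[of w] by simp
  then show ?thesis by (auto intro: FiltI simp: Filt_Alg FiltD)
qed

lemma Filt_separated: "(\<And>m. a \<in> Filt g n m) \<Longrightarrow> a = 0"
  by (rule ncs_eqI) (metis FiltD cf_simps(1) lessI)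

text \<open>Every letter has weight at least 1, so weight dominates length. Series that converge
  with respect to length therefore converge in the weight filtration, which defines the topology of
  \<open>A\<close>.\<close>

lemma ncs_ge_length_Filt: "a \<in> Alg g n \<Longrightarrow> a \<in> ncs_ge length m \<Longrightarrow> a \<in> Filt g n m"
  by (intro FiltI) (auto intro: ncs_geD le_less_trans[OF length_le_wtw])

lemma sums_to_Filt:
  assumes "nps.sums_to x s" "s \<in> Alg g n" "\<And>m. x m \<in> Alg g n"
  shows "s - (\<Sum>m<N. x m) \<in> Filt g n N"
  using assms by (intro ncs_ge_length_Filt Alg_diff Alg_sum) (auto simp: nps.sums_to_def)

lemma fps_app_Filt:
  assumes "a \<in> Filt g n 1"
  shows "fps_app h a - (\<Sum>k<N. fps_nth h k \<odot> a ^ k) \<in> Filt g n N"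
  using assms unfolding Filt_1_iff
  by (intro sums_to_Filt fps_app_sums) (simp_all add: Alg_smul Alg_power Alg_fps_app)

section \<open>Closed subspaces, the Lie algebra L and the commutator space [A, A]\<close>

definition closed_in_Alg :: "nat \<Rightarrow> nat \<Rightarrow> 'k::field_char_0 ser set \<Rightarrow> bool" where
  "closed_in_Alg g n V \<longleftrightarrow> (\<forall>a\<in>Alg g n. (\<forall>m. \<exists>b\<in>V. a - b \<in> Filt g n m) \<longrightarrow> a \<in> V)"

lemma closed_in_AlgD:
  "closed_in_Alg g n V \<Longrightarrow> a \<in> Alg g n \<Longrightarrow> (\<And>m. \<exists>b\<in>V. a - b \<in> Filt g n m) \<Longrightarrow> a \<in> V"
  unfolding closed_in_Alg_def by blast

lemma closed_Alg_closure: "closed_in_Alg g n (Alg_closure g n V)"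
  unfolding closed_in_Alg_def
proof (intro ballI impI)
  fix a assume a: "a \<in> Alg g n" and *: "\<forall>m. \<exists>b\<in>Alg_closure g n V. a - b \<in> Filt g n m"
  have "\<exists>c\<in>V. a - c \<in> Filt g n m" for m
  proof -
    obtain b where b: "b \<in> Alg_closure g n V" "a - b \<in> Filt g n m" using * by blast
    then obtain c where "c \<in> V" "b - c \<in> Filt g n m" unfolding Alg_closure_def by blast
    then show ?thesis using Filt_add[OF b(2), of "b - c"] by auto
  qed
  then show "a \<in> Alg_closure g n V" using a by (simp add: Alg_closure_def)
qed

lemma Alg_closure_superset: "V \<subseteq> Alg g n \<Longrightarrow> V \<subseteq> Alg_closure g n V"
  unfolding Alg_closure_def by (force intro: exI)

text \<open>An operation that does not lower the precision \<open>m\<close> of approximations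
  extends from a set to its closure. Unary operations are covered by ignoring one argument.\<close>

lemma Alg_closure_binary:
  assumes V: "\<And>a b. a \<in> V \<Longrightarrow> b \<in> V \<Longrightarrow> f a b \<in> V" "V \<subseteq> Alg g n"
    and f: "\<And>a b. a \<in> Alg g n \<Longrightarrow> b \<in> Alg g n \<Longrightarrow> f a b \<in> Alg g n"
    and cont: "\<And>a b a' b' m. a \<in> Alg g n \<Longrightarrow> b \<in> Alg g n \<Longrightarrow> a' \<in> Alg g n \<Longrightarrow> b' \<in> Alg g n \<Longrightarrow>
      a - a' \<in> Filt g n m \<Longrightarrow> b - b' \<in> Filt g n m \<Longrightarrow> f a b - f a' b' \<in> Filt g n m"
    and ab: "a \<in> Alg_closure g n V" "b \<in> Alg_closure g n V"
  shows "f a b \<in> Alg_closure g n V"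
proof -
  have A: "a \<in> Alg g n" "b \<in> Alg g n" using ab by (auto simp: Alg_closure_def)
  have "\<exists>c\<in>V. f a b - c \<in> Filt g n m" for m
  proof -
    obtain a' b' where "a' \<in> V" "a - a' \<in> Filt g n m" "b' \<in> V" "b - b' \<in> Filt g n m"
      using ab unfolding Alg_closure_def by blast
    moreover from this have "f a b - f a' b' \<in> Filt g n m" using A V(2) by (intro cont) auto
    ultimately show ?thesis using V(1) by blast
  qed
  then show ?thesis using f A by (simp add: Alg_closure_def)
qed

lemma Alg_closure_add:
  assumes "\<And>a b. a \<in> V \<Longrightarrow> b \<in> V \<Longrightarrow> a + b \<in> V" "V \<subseteq> Alg g n"
    "a \<in> Alg_closure g n V" "b \<in> Alg_closure g n V"
  shows "a + b \<in> Alg_closure g n V"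
  by (rule Alg_closure_binary[of V "(+)"]) (use assms Filt_add Alg_add in \<open>auto simp: add_diff_add\<close>)

lemma Alg_closure_smul:
  assumes "\<And>a. a \<in> V \<Longrightarrow> c \<odot> a \<in> V" "V \<subseteq> Alg g n" "a \<in> Alg_closure g n V"
  shows "c \<odot> a \<in> Alg_closure g n V"
  by (rule Alg_closure_binary[of V "\<lambda>a b. c \<odot> a" _ _ a a])
    (use assms Filt_smul Alg_smul in \<open>auto simp flip: ncs.scale_right_diff_distrib\<close>)

lemma Alg_closure_commutator:
  assumes "\<And>a b. a \<in> V \<Longrightarrow> b \<in> V \<Longrightarrow> commutator a b \<in> V" "V \<subseteq> Alg g n"
    "a \<in> Alg_closure g n V" "b \<in> Alg_closure g n V"
  shows "commutator a b \<in> Alg_closure g n V"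
proof (rule Alg_closure_binary[of V commutator])
  fix a b a' b' :: "'a ser" and m
  assume *: "a \<in> Alg g n" "b \<in> Alg g n" "a' \<in> Alg g n" "b' \<in> Alg g n"
    "a - a' \<in> Filt g n m" "b - b' \<in> Filt g n m"
  have "commutator a b - commutator a' b' =
    (a - a') * b + a' * (b - b') - ((b - b') * a + b' * (a - a'))"
    by (simp add: commutator_def algebra_simps)
  then show "commutator a b - commutator a' b' \<in> Filt g n m"
    using * by (simp add: Filt_diff Filt_add Filt_mult_left Filt_mult_right)
qed (use assms Alg_commutator in auto)

lemma lie_polys_Filt: "a \<in> lie_polys g n \<Longrightarrow> a \<in> Filt g n 1"
proof (induction rule: lie_polys.induct)
  case (1 x)
  then show ?case using Filt_letter Filt_le wt_pos by blast
next
  case (5 a b)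
  then show ?case by (simp add: commutator_def Filt_diff Filt_mult_left Filt_Alg)
qed (simp_all add: Filt_add Filt_smul)

lemma lie_polys_Alg: "lie_polys g n \<subseteq> Alg g n"
  using lie_polys_Filt Filt_Alg by blast

lemma Lie_Alg: "a \<in> Lie g n \<Longrightarrow> a \<in> Alg g n"
  by (simp add: Lie_def Alg_closure_def)

lemma closed_Lie: "closed_in_Alg g n (Lie g n)"
  by (simp add: Lie_def closed_Alg_closure)

lemma Lie_letter: "x \<in> gens g n \<Longrightarrow> letter x \<in> Lie g n"
  and Lie_zero: "0 \<in> Lie g n"
  unfolding Lie_def using Alg_closure_superset[OF lie_polys_Alg] lie_polys.intros(1,2) by blast+

lemma Lie_add: "a \<in> Lie g n \<Longrightarrow> b \<in> Lie g n \<Longrightarrow> a + b \<in> Lie g n"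
  unfolding Lie_def by (rule Alg_closure_add[OF lie_polys.intros(3) lie_polys_Alg])

lemma Lie_smul: "a \<in> Lie g n \<Longrightarrow> c \<odot> a \<in> Lie g n"
  unfolding Lie_def by (rule Alg_closure_smul[OF lie_polys.intros(4) lie_polys_Alg])

lemma Lie_commutator: "a \<in> Lie g n \<Longrightarrow> b \<in> Lie g n \<Longrightarrow> commutator a b \<in> Lie g n"
  unfolding Lie_def by (rule Alg_closure_commutator[OF lie_polys.intros(5) lie_polys_Alg])

lemma Lie_uminus: "a \<in> Lie g n \<Longrightarrow> - a \<in> Lie g n"
  using Lie_smul[of a g n "- 1"] by simp

lemma Lie_diff: "a \<in> Lie g n \<Longrightarrow> b \<in> Lie g n \<Longrightarrow> a - b \<in> Lie g n"
  using Lie_add[of a g n "- b"] Lie_uminus[of b g n] by simp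

lemma Lie_sum: "(\<And>i. i \<in> I \<Longrightarrow> f i \<in> Lie g n) \<Longrightarrow> sum f I \<in> Lie g n"
  by (induction I rule: infinite_finite_induct) (simp_all add: Lie_add Lie_zero)

lemma Lie_Filt_1: "a \<in> Lie g n \<Longrightarrow> a \<in> Filt g n 1"
proof -
  assume "a \<in> Lie g n"
  then obtain b where "b \<in> lie_polys g n" "a - b \<in> Filt g n 1"
    unfolding Lie_def Alg_closure_def by blast
  then show ?thesis using Filt_add[of "a - b" g n 1 b] lie_polys_Filt by auto
qed

lemma Lie_cf_Nil: "a \<in> Lie g n \<Longrightarrow> cf a [] = 0"
  using Lie_Filt_1 Filt_1_iff by blast

abbreviation comm_span :: "nat \<Rightarrow> nat \<Rightarrow> 'k::field_char_0 ser set" where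
  "comm_span g n \<equiv> ncs.span {commutator a b | a b. a \<in> Alg g n \<and> b \<in> Alg g n}"

lemma comm_span_Alg: "comm_span g n \<subseteq> Alg g n"
  by (intro ncs.span_minimal ncs.subspaceI) (auto simp: Alg_add Alg_smul Alg_commutator)

lemma commA_Alg: "a \<in> commA g n \<Longrightarrow> a \<in> Alg g n"
  by (simp add: commA_def Alg_closure_def)

lemma closed_commA: "closed_in_Alg g n (commA g n)"
  by (simp add: commA_def closed_Alg_closure)

lemma commA_commutator: "a \<in> Alg g n \<Longrightarrow> b \<in> Alg g n \<Longrightarrow> commutator a b \<in> commA g n"
  unfolding commA_def
  by (rule subsetD[OF Alg_closure_superset[OF comm_span_Alg]], rule ncs.span_base) blast

lemma commA_zero: "0 \<in> commA g n"
  unfolding commA_def by (rule subsetD[OF Alg_closure_superset[OF comm_span_Alg]], rule ncs.span_zero)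

lemma commA_add: "a \<in> commA g n \<Longrightarrow> b \<in> commA g n \<Longrightarrow> a + b \<in> commA g n"
  unfolding commA_def by (rule Alg_closure_add[OF ncs.span_add comm_span_Alg])

lemma commA_smul: "a \<in> commA g n \<Longrightarrow> c \<odot> a \<in> commA g n"
  unfolding commA_def by (rule Alg_closure_smul[OF ncs.span_scale comm_span_Alg])

lemma commA_uminus: "a \<in> commA g n \<Longrightarrow> - a \<in> commA g n"
  using commA_smul[of a g n "- 1"] by simp

lemma commA_diff: "a \<in> commA g n \<Longrightarrow> b \<in> commA g n \<Longrightarrow> a - b \<in> commA g n"
  using commA_add[of a g n "- b"] commA_uminus[of b g n] by simp

lemma commA_sum: "(\<And>i. i \<in> I \<Longrightarrow> f i \<in> commA g n) \<Longrightarrow> sum f I \<in> commA g n"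
  by (induction I rule: infinite_finite_induct) (simp_all add: commA_add commA_zero)

text \<open>The device by which membership of the Baker--Campbell--Hausdorff terms passes to the
  logarithm itself.\<close>

lemma closed_sums_to:
  assumes V: "closed_in_Alg g n V" and s: "s \<in> Alg g n" "nps.sums_to z s"
    and z: "\<And>m. z m \<in> Alg g n" "\<And>N. (\<Sum>m<N. z m) \<in> V"
  shows "s \<in> V"
  by (rule closed_in_AlgD[OF V s(1)]) (use sums_to_Filt[OF s(2,1) z(1)] z(2) in blast)

subsection \<open>Group-like elements\<close>

lemma expL_Alg: "f \<in> expL g n \<Longrightarrow> f \<in> Alg g n"
  by (auto simp: expL_def Alg_exp Lie_Alg)

lemma expL_cf_Nil: "f \<in> expL g n \<Longrightarrow> cf f [] = 1"
  by (auto simp: expL_def cf_ncs_exp_Nil)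

lemma expLI: "b \<in> Alg g n \<Longrightarrow> cf b [] = 1 \<Longrightarrow> ncs_log b \<in> Lie g n \<Longrightarrow> b \<in> expL g n"
  unfolding expL_def by (metis image_eqI ncs_exp_log)

lemma expL_one: "1 \<in> expL g n"
proof -
  have "ncs_exp 0 = (1 :: 'a ser)" by (simp add: ncs_exp_eq nps.ex_zero)
  then show ?thesis unfolding expL_def using Lie_zero by (metis image_eqI)
qed

lemma expL_inverse:
  assumes "f \<in> expL g n"
  shows "ncs_inv f \<in> expL g n" "ncs_inv f * f = 1" "f * ncs_inv f = 1"
proof -
  obtain a where a: "a \<in> Lie g n" "f = ncs_exp a" using assms by (auto simp: expL_def)
  then have "ncs_inv f = ncs_exp (- a)"
    by (intro ncs_inv_eqI) (simp_all add: ncs_exp_inverse Lie_cf_Nil)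
  then show "ncs_inv f \<in> expL g n" "ncs_inv f * f = 1" "f * ncs_inv f = 1"
    using a by (auto simp: expL_def Lie_uminus ncs_exp_inverse Lie_cf_Nil)
qed

text \<open>Baker--Campbell--Hausdorff with \<open>Lie g n\<close> as \<open>L\<close> and
  \<open>commA g n\<close> as \<open>L'\<close>: the whole series lies in the Lie algebra, and
  everything but the linear term \<open>a + b\<close> lies in \<open>[A, A]\<close>.\<close>

lemma expL_mult_log:
  assumes f: "f \<in> expL g n" and h: "h \<in> expL g n"
  shows "ncs_log (f * h) \<in> Lie g n"
    and "ncs_log (f * h) - (ncs_log f + ncs_log h) \<in> commA g n"
proof -
  obtain a b where a: "a \<in> Lie g n" "f = ncs_exp a" and b: "b \<in> Lie g n" "h = ncs_exp b"
    using assms by (auto simp: expL_def)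
  have ab: "a \<in> ncs_ge length 1" "b \<in> ncs_ge length 1"
    using a b Lie_cf_Nil by (simp_all only: in_ncs_ge_length_1)
  obtain z where z: "nps.sums_to z (nps.lg (nps.ex a * nps.ex b))"
    "\<And>m. z m \<in> Lie g n" "z 0 = 0" "z 1 = a + b" "\<And>m. m \<ge> 2 \<Longrightarrow> z m \<in> commA g n"
    by (rule nps.Baker_Campbell_Hausdorff[OF ab a(1) b(1), of "commA g n"])
      (simp_all add: Lie_add Lie_smul Lie_commutator commA_add commA_smul commA_commutator Lie_Alg)
  have eq: "nps.lg (nps.ex a * nps.ex b) = ncs_log (f * h)"
    using a b by (simp add: ncs_log_eq ncs_exp_eq[symmetric] Lie_cf_Nil cf_mult_Nil cf_ncs_exp_Nil)
  have A: "ncs_log (f * h) \<in> Alg g n"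
    using f h by (intro Alg_log Alg_mult expL_Alg)
  show "ncs_log (f * h) \<in> Lie g n"
    by (rule closed_sums_to[OF closed_Lie A z(1)[unfolded eq]]) (simp_all add: z(2) Lie_Alg Lie_sum)
  have log: "ncs_log f = a" "ncs_log h = b" using a b by (simp_all add: ncs_log_exp Lie_cf_Nil)
  show "ncs_log (f * h) - (ncs_log f + ncs_log h) \<in> commA g n"
    unfolding log
  proof (rule closed_in_AlgD[OF closed_commA])
    show "ncs_log (f * h) - (a + b) \<in> Alg g n" using A a b by (simp add: Alg_diff Alg_add Lie_Alg)
    fix N
    \<comment> \<open>Two extra terms, since \<open>z 0 = 0\<close> and \<open>z 1 = a + b\<close>
      are split off and only the remaining ones, of index at least 2, are known to lie in
      \<open>commA\<close>.\<close>
    have "ncs_log (f * h) - (\<Sum>m<Suc (Suc N). z m) \<in> Filt g n (Suc (Suc N))"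
      by (rule sums_to_Filt[OF z(1)[unfolded eq] A]) (simp add: z(2) Lie_Alg)
    also have "(\<Sum>m<Suc (Suc N). z m) = a + b + (\<Sum>m<N. z (Suc (Suc m)))"
      using z(3,4) by (simp add: sum.lessThan_Suc_shift del: sum.lessThan_Suc)
    finally have "ncs_log (f * h) - (a + b) - (\<Sum>m<N. z (Suc (Suc m))) \<in> Filt g n N"
      using Filt_le by (force simp: algebra_simps)
    then show "\<exists>c\<in>commA g n. ncs_log (f * h) - (a + b) - c \<in> Filt g n N"
      using commA_sum[of "{..<N}" "\<lambda>m. z (Suc (Suc m))"] z(5) by force
  qed
qed

lemma expL_mult: "f \<in> expL g n \<Longrightarrow> h \<in> expL g n \<Longrightarrow> f * h \<in> expL g n"
  by (rule expLI) (simp_all add: Alg_mult expL_Alg cf_mult_Nil expL_cf_Nil expL_mult_log)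

subsection \<open>Automorphisms\<close>

lemma linear_on_AlgD:
  assumes "linear_on_Alg g n F"
  shows "a \<in> Alg g n \<Longrightarrow> F a \<in> Alg g n"
    and "a \<in> Alg g n \<Longrightarrow> b \<in> Alg g n \<Longrightarrow> F (a + b) = F a + F b"
    and "a \<in> Alg g n \<Longrightarrow> F (c \<odot> a) = c \<odot> F a"
  using assms unfolding linear_on_Alg_def by auto

lemma linear_on_Alg_zero:
  assumes "linear_on_Alg g n F" shows "F 0 = 0"
  using linear_on_AlgD(3)[OF assms, of 0 0] by simp

lemma linear_on_Alg_uminus:
  assumes "linear_on_Alg g n F" "a \<in> Alg g n" shows "F (- a) = - F a"
  using linear_on_AlgD(3)[OF assms, of "- 1"] by simp

lemma linear_on_Alg_diff:
  assumes "linear_on_Alg g n F" "a \<in> Alg g n" "b \<in> Alg g n"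
  shows "F (a - b) = F a - F b"
  using linear_on_AlgD(2)[OF assms(1,2) Alg_uminus[OF assms(3)]] linear_on_Alg_uminus[OF assms(1,3)]
  by simp

lemma linear_on_Alg_sum:
  assumes "linear_on_Alg g n F" "\<And>i. i \<in> I \<Longrightarrow> f i \<in> Alg g n"
  shows "F (sum f I) = (\<Sum>i\<in>I. F (f i))"
  using assms(2)
  by (induction I rule: infinite_finite_induct)
    (simp_all add: linear_on_Alg_zero[OF assms(1)] linear_on_AlgD(2)[OF assms(1)] Alg_sum)

lemma continuous_on_AlgD:
  assumes "continuous_on_Alg g n F"
  obtains k where "\<And>a. a \<in> Filt g n k \<Longrightarrow> F a \<in> Filt g n m"
  using assms unfolding continuous_on_Alg_def by blast

text \<open>Stated for linear maps, because it serves automorphisms and derivations alike: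
  continuity reduces the claim from the closure to the span, linearity reduces it to single
  commutators.\<close>

lemma commA_image:
  assumes lin: "linear_on_Alg g n F" and cont: "continuous_on_Alg g n F"
    and comm: "\<And>a b. a \<in> Alg g n \<Longrightarrow> b \<in> Alg g n \<Longrightarrow> F (commutator a b) \<in> commA g n"
    and c: "c \<in> commA g n"
  shows "F c \<in> commA g n"
proof (rule closed_in_AlgD[OF closed_commA])
  have cA: "c \<in> Alg g n" using c by (rule commA_Alg)
  then show "F c \<in> Alg g n" by (rule linear_on_AlgD[OF lin])
  fix m
  obtain k where k: "\<And>a. a \<in> Filt g n k \<Longrightarrow> F a \<in> Filt g n m"
    using continuous_on_AlgD[OF cont] by metis
  obtain b where b: "b \<in> comm_span g n" "c - b \<in> Filt g n k"
    using c unfolding commA_def Alg_closure_def by blast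
  have "comm_span g n \<subseteq> {a \<in> Alg g n. F a \<in> commA g n}"
    by (intro ncs.span_minimal ncs.subspaceI)
      (auto simp: Alg_add Alg_smul Alg_commutator comm commA_zero commA_add commA_smul
        linear_on_Alg_zero[OF lin] linear_on_AlgD[OF lin])
  then have "b \<in> Alg g n" "F b \<in> commA g n" using b(1) by auto
  moreover have "F c - F b \<in> Filt g n m"
    using k[OF b(2)] linear_on_Alg_diff[OF lin cA \<open>b \<in> Alg g n\<close>] by simp
  ultimately show "\<exists>b\<in>commA g n. F c - b \<in> Filt g n m" by blast
qed

text \<open>Weaker than \<open>Aut_plus\<close>, so that conjugation by a group-like element is an
  instance as well; see \<open>fps_app_conjugate\<close>.\<close>

locale alg_hom =
  fixes g n :: nat and F :: "'k::field_char_0 ser \<Rightarrow> 'k ser"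
  assumes linear: "linear_on_Alg g n F"
    and hom_one: "F 1 = 1"
    and hom_mult: "a \<in> Alg g n \<Longrightarrow> b \<in> Alg g n \<Longrightarrow> F (a * b) = F a * F b"
    and continuous: "continuous_on_Alg g n F"
begin

lemmas hom_Alg = linear_on_AlgD(1)[OF linear]
lemmas hom_add = linear_on_AlgD(2)[OF linear]
lemmas hom_smul = linear_on_AlgD(3)[OF linear]
lemmas hom_zero = linear_on_Alg_zero[OF linear]
lemmas hom_diff = linear_on_Alg_diff[OF linear]
lemmas hom_sum = linear_on_Alg_sum[OF linear]

lemma hom_power: "a \<in> Alg g n \<Longrightarrow> F (a ^ k) = F a ^ k"
  by (induction k) (simp_all add: hom_one hom_mult Alg_power)

lemma hom_commutator: "a \<in> Alg g n \<Longrightarrow> b \<in> Alg g n \<Longrightarrow> F (commutator a b) = commutator (F a) (F b)"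
  by (simp add: commutator_def hom_diff hom_mult Alg_mult)

lemma hom_commA: "c \<in> commA g n \<Longrightarrow> F c \<in> commA g n"
  by (rule commA_image[OF linear continuous]) (simp_all add: hom_commutator commA_commutator hom_Alg)

lemma hom_fps_app:
  assumes a: "a \<in> Filt g n 1" and Fa: "F a \<in> Filt g n 1"
  shows "F (fps_app h a) = fps_app h (F a)"
proof -
  have aA: "a \<in> Alg g n" using a by (rule Filt_Alg)
  have "F (fps_app h a) - fps_app h (F a) \<in> Filt g n m" for m
  proof -
    obtain k where k: "\<And>a. a \<in> Filt g n k \<Longrightarrow> F a \<in> Filt g n m"
      using continuous_on_AlgD[OF continuous] by metis
    \<comment> \<open>The bound \<open>k\<close> serves the continuity of \<open>F\<close> on the
      remainder, the bound \<open>m\<close> the precision on the target side.\<close>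
    define N where "N = max k m"
    have S: "(\<Sum>i<N. fps_nth h i \<odot> a ^ i) \<in> Alg g n"
      by (intro Alg_sum Alg_smul Alg_power aA)
    have "fps_app h a - (\<Sum>i<N. fps_nth h i \<odot> a ^ i) \<in> Filt g n k"
      using Filt_le[OF fps_app_Filt[OF a, of h N]] by (simp add: N_def)
    from k[OF this] have "F (fps_app h a) - F (\<Sum>i<N. fps_nth h i \<odot> a ^ i) \<in> Filt g n m"
      using hom_diff[OF Alg_fps_app[OF aA] S] by simp
    moreover have "F (\<Sum>i<N. fps_nth h i \<odot> a ^ i) = (\<Sum>i<N. fps_nth h i \<odot> F a ^ i)"
      by (subst hom_sum) (simp_all add: Alg_smul Alg_power aA hom_smul hom_power)
    moreover have "fps_app h (F a) - (\<Sum>i<N. fps_nth h i \<odot> F a ^ i) \<in> Filt g n m"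
      using Filt_le[OF fps_app_Filt[OF Fa, of h N]] by (simp add: N_def)
    ultimately show ?thesis using Filt_diff by fastforce
  qed
  then have "F (fps_app h a) - fps_app h (F a) = 0" by (rule Filt_separated)
  then show ?thesis by simp
qed

end

section \<open>Monomials and truncation\<close>

definition monomial :: "gen list \<Rightarrow> 'k::field_char_0 ser" where
  "monomial w = prod_list (map letter w)"

lemma cf_letter_mult: "cf (letter x * a) w = (case w of [] \<Rightarrow> 0 | y # v \<Rightarrow> if x = y then cf a v else 0)"
proof (cases w)
  case Nil
  then show ?thesis by (simp add: cf_mult_Nil cf_letter)
next
  case (Cons y v)
  have "cf (letter x * a) w = (\<Sum>k\<le>length w. if k = 1 then (if x = y then cf a v else 0) else 0)"
    unfolding cf_mult
  proof (rule sum.cong)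
    fix k assume "k \<in> {..length w}"
    then have "take k w = [x] \<longleftrightarrow> k = 1 \<and> x = y" using Cons by (cases k) auto
    then show "cf (letter x) (take k w) * cf a (drop k w) = (if k = 1 then (if x = y then cf a v else 0) else 0)"
      using Cons by (auto simp: cf_letter)
  qed simp
  then show ?thesis using Cons by (simp del: sum.atMost_Suc)
qed

lemma cf_monomial: "cf (monomial v) w = (if w = v then 1 else 0)"
  by (induction v arbitrary: w) (auto simp: monomial_def cf_one cf_letter_mult split: list.split)

lemma monomial_Filt: "set w \<subseteq> gens g n \<Longrightarrow> monomial w \<in> Filt g n (wtw w)"
  by (auto simp: Filt_def Alg_def cf_monomial split: if_splits)

definition words_below :: "nat \<Rightarrow> nat \<Rightarrow> nat \<Rightarrow> gen list set" where
  "words_below g n N = {w. set w \<subseteq> gens g n \<and> wtw w < N}"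

lemma finite_words_below: "finite (words_below g n N)"
proof (rule finite_subset)
  show "words_below g n N \<subseteq> {w. set w \<subseteq> gens g n \<and> length w \<le> N}"
    by (auto simp: words_below_def intro: le_trans[OF length_le_wtw less_imp_le])
qed (rule finite_lists_length_le[OF finite_gens])

text \<open>Only finitely many words lie below a given weight, as the alphabet is finite and letters
  have positive weight. So modulo \<open>Filt\<close> every element is a finite combination of
  monomials, and continuous linear maps can be tested on monomials.\<close>

lemma truncation:
  assumes "a \<in> Alg g n"
  shows "a - (\<Sum>w\<in>words_below g n N. cf a w \<odot> monomial w) \<in> Filt g n N"
proof (rule FiltI)
  show "a - (\<Sum>w\<in>words_below g n N. cf a w \<odot> monomial w) \<in> Alg g n"
    using assms by (intro Alg_diff Alg_sum Alg_smul) (auto simp: words_below_def intro: Filt_Alg[OF monomial_Filt])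
  fix v assume v: "wtw v < N"
  have "(\<Sum>w\<in>words_below g n N. cf a w * cf (monomial w) v) =
      (\<Sum>w\<in>words_below g n N. if w = v then cf a v else 0)"
    by (rule sum.cong) (auto simp: cf_monomial)
  also have "\<dots> = cf a v"
    using v assms finite_words_below[of g n N]
    by (subst sum.delta) (auto simp: words_below_def Alg_def)
  finally show "cf (a - (\<Sum>w\<in>words_below g n N. cf a w \<odot> monomial w)) v = 0"
    by (simp add: cf_sum)
qed

lemma Aut_plus_alg_hom: "F \<in> Aut_plus g n \<Longrightarrow> alg_hom g n F"
  by (simp add: Aut_plus_def alg_hom_def)

lemma Aut_plus_Lie: "F \<in> Aut_plus g n \<Longrightarrow> a \<in> Lie g n \<Longrightarrow> F a \<in> Lie g n"
  by (auto simp: Aut_plus_def bij_betw_def)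

lemma Aut_plus_eqI:
  assumes "F \<in> Aut_plus g n" "G \<in> Aut_plus g n" "\<And>a. a \<in> Alg g n \<Longrightarrow> F a = G a"
  shows "F = G"
  using assms by (intro extensionalityI[of F "Alg g n"]) (auto simp: Aut_plus_def)

text \<open>The condition on generators spreads to all of \<open>A\<close>: to monomials by
  \<open>F(xw) - xw = (F x - x) F(w) + x (F w - w)\<close>, in general by truncation and continuity.
  Thus \<open>F - 1\<close> is topologically nilpotent, which is the source of bijectivity on
  \<open>A\<close> and of \<open>log F\<close>.\<close>

lemma Aut_plus_raises:
  assumes F: "F \<in> Aut_plus g n" and a: "a \<in> Filt g n m"
  shows "F a - a \<in> Filt g n (m + 1)"
proof -
  interpret alg_hom g n F using F by (rule Aut_plus_alg_hom)
  have mono: "F (monomial w) - monomial w \<in> Filt g n (wtw w + 1)" if "set w \<subseteq> gens g n" for w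
    using that
  proof (induction w)
    case Nil
    then show ?case by (simp add: monomial_def hom_one)
  next
    case (Cons x w)
    then have x: "x \<in> gens g n" and w: "set w \<subseteq> gens g n" by auto
    let ?m = "monomial w"
    have m: "?m \<in> Filt g n (wtw w)" using w by (rule monomial_Filt)
    have Fm: "F ?m \<in> Filt g n (wtw w)"
      using Filt_add[OF Filt_le[OF Cons.IH[OF w]] m] by simp
    have Fx: "F (letter x) - letter x \<in> Filt g n (wt x + 1)" using F x by (simp add: Aut_plus_def)
    have eq: "monomial (x # w) = letter x * ?m" by (simp add: monomial_def)
    have "F (monomial (x # w)) - monomial (x # w) =
        (F (letter x) - letter x) * F ?m + letter x * (F ?m - ?m)"
      unfolding eq by (subst hom_mult) (simp_all add: Alg_letter x Filt_Alg[OF m] algebra_simps)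
    moreover have "(F (letter x) - letter x) * F ?m \<in> Filt g n (wtw (x # w) + 1)"
      using Filt_mult[OF Fx Fm] by (simp add: add.commute add.left_commute)
    moreover have "letter x * (F ?m - ?m) \<in> Filt g n (wtw (x # w) + 1)"
      using Filt_mult[OF Filt_letter[OF x] Cons.IH[OF w]] by (simp add: add.assoc)
    ultimately show ?case by (simp add: Filt_add)
  qed
  obtain k where k: "\<And>a. a \<in> Filt g n k \<Longrightarrow> F a \<in> Filt g n (m + 1)"
    using continuous_on_AlgD[OF continuous] by metis
  \<comment> \<open>The bound \<open>k\<close> makes \<open>F\<close> of the remainder small by
    continuity, the bound \<open>m + 1\<close> makes the remainder itself small.\<close>
  define W where "W = words_below g n (max k (m + 1))"
  define s where "s = (\<Sum>w\<in>W. cf a w \<odot> monomial w)"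
  have aA: "a \<in> Alg g n" using a by (rule Filt_Alg)
  have mA: "monomial w \<in> Alg g n" if "w \<in> W" for w
    using that monomial_Filt Filt_Alg unfolding W_def words_below_def by blast
  have sA: "s \<in> Alg g n" unfolding s_def by (intro Alg_sum Alg_smul mA)
  have r: "a - s \<in> Filt g n (max k (m + 1))" unfolding s_def W_def by (rule truncation[OF aA])
  have "F s - s = (\<Sum>w\<in>W. cf a w \<odot> (F (monomial w) - monomial w))"
    unfolding s_def by (subst hom_sum) (simp_all add: Alg_smul mA hom_smul ncs.scale_right_diff_distrib sum_subtractf)
  moreover have "\<dots> \<in> Filt g n (m + 1)"
  proof (rule Filt_sum)
    fix w assume w: "w \<in> W"
    show "cf a w \<odot> (F (monomial w) - monomial w) \<in> Filt g n (m + 1)"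
    proof (cases "wtw w < m")
      case True
      then show ?thesis using FiltD[OF a] by simp
    next
      case False
      then show ?thesis using w unfolding W_def words_below_def
        by (intro Filt_smul Filt_le[OF mono]) auto
    qed
  qed
  moreover have "F (a - s) - (a - s) \<in> Filt g n (m + 1)"
    by (rule Filt_diff[OF k[OF Filt_le[OF r]] Filt_le[OF r]]) simp_all
  moreover have "F a - a = (F s - s) + (F (a - s) - (a - s))"
    by (simp add: hom_diff aA sA)
  ultimately show ?thesis using Filt_add by metis
qed

lemma Aut_plus_Filt: "F \<in> Aut_plus g n \<Longrightarrow> a \<in> Filt g n m \<Longrightarrow> F a \<in> Filt g n m"
  using Filt_add[OF Filt_le[OF Aut_plus_raises] , of F g n a m m a] by simp

text \<open>If \<open>a\<close> has weight at least \<open>k\<close>, then \<open>F a\<close> and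
  \<open>a\<close> agree modulo weight \<open>k + 1\<close>, so the weight bound for
  \<open>a\<close> can be raised step by step to that of \<open>F a\<close>.\<close>

lemma Aut_plus_Filt_converse:
  assumes F: "F \<in> Aut_plus g n" and a: "a \<in> Alg g n" and Fa: "F a \<in> Filt g n m"
  shows "a \<in> Filt g n m"
proof -
  have "k \<le> m \<Longrightarrow> a \<in> Filt g n k" for k
  proof (induction k)
    case (Suc k)
    then have "F a - a \<in> Filt g n (Suc k)" using Aut_plus_raises[OF F, of a k] by simp
    then show ?case using Filt_diff[OF Filt_le[OF Fa Suc.prems]] by force
  qed (simp add: a)
  then show ?thesis by simp
qed

text \<open>\<open>Aut_plus\<close> asks for bijectivity on \<open>L\<close>. On \<open>A\<close> it
  comes from the nilpotence of \<open>F - 1\<close>: the preceding lemma gives injectivity, a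
  Neumann series surjectivity.\<close>

lemma Aut_plus_bij:
  assumes F: "F \<in> Aut_plus g n"
  shows "bij_betw F (Alg g n) (Alg g n)"
proof -
  interpret alg_hom g n F using F by (rule Aut_plus_alg_hom)
  have inj: "inj_on F (Alg g n)"
  proof (rule inj_onI)
    fix a b assume ab: "a \<in> Alg g n" "b \<in> Alg g n" "F a = F b"
    have "a - b \<in> Filt g n m" for m
      by (rule Aut_plus_Filt_converse[OF F]) (use ab in \<open>simp_all add: hom_diff Alg_diff\<close>)
    then have "a - b = 0" by (rule Filt_separated)
    then show "a = b" by simp
  qed
  have "b \<in> F ` Alg g n" if b: "b \<in> Alg g n" for b
  proof -
    define N where "N = (\<lambda>a. a - F a)"
    have Nk: "(N ^^ k) b \<in> Filt g n k" for k
    proof (induction k)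
      case (Suc k)
      then show ?case using Filt_uminus[OF Aut_plus_raises[OF F Suc]] by (simp add: N_def)
    qed (simp add: b)
    \<comment> \<open>The Neumann series \<open>\<Sum>k. (1 - F)^k b\<close>; its
      \<open>k\<close>-th term has weight at least \<open>k\<close>, so each coefficient is a finite
      sum.\<close>
    define a where "a = Ncs (\<lambda>w. \<Sum>k\<le>wtw w. cf ((N ^^ k) b) w)"
    have aA: "a \<in> Alg g n"
      using Alg_Ncs_sum[of "\<lambda>k. (N ^^ k) b" g n "\<lambda>_. 1" wtw] Filt_Alg[OF Nk] by (simp add: a_def)
    have "F a - b \<in> Filt g n m" for m
    proof -
      let ?p = "\<Sum>k<m. (N ^^ k) b"
      have pA: "?p \<in> Alg g n" by (intro Alg_sum Filt_Alg[OF Nk])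
      have "a - ?p \<in> ncs_ge wtw m"
        unfolding a_def by (rule ncs_ge_complete) (use Nk in \<open>simp add: Filt_eq\<close>)
      then have "a - ?p \<in> Filt g n m" using aA pA by (simp add: Filt_eq Alg_diff)
      from Aut_plus_Filt[OF F this] have "F a - F ?p \<in> Filt g n m"
        using hom_diff[OF aA pA] by simp
      moreover have "F ?p = (\<Sum>k<m. (N ^^ k) b - (N ^^ Suc k) b)"
        by (subst hom_sum) (simp_all add: N_def Filt_Alg[OF Nk[unfolded N_def]])
      then have "F ?p = b - (N ^^ m) b"
        using sum_lessThan_telescope'[of "\<lambda>k. (N ^^ k) b" m] by simp
      ultimately show ?thesis using Filt_diff[OF _ Nk, of "F a - F ?p" m] by simp
    qed
    then have "F a - b = 0" by (rule Filt_separated)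
    then show ?thesis using aA by (metis eq_iff_diff_eq_0 imageI)
  qed
  then show ?thesis using inj hom_Alg unfolding bij_betw_def by blast
qed

text \<open>Restricted to \<open>A\<close>, since membership in \<open>Aut_plus\<close> requires an
  extensional function.\<close>

definition Aut_inv :: "nat \<Rightarrow> nat \<Rightarrow> ('k::field_char_0 ser \<Rightarrow> 'k ser) \<Rightarrow> 'k ser \<Rightarrow> 'k ser" where
  "Aut_inv g n F = (\<lambda>b\<in>Alg g n. inv_into (Alg g n) F b)"

context
  fixes g n :: nat and F :: "'k::field_char_0 ser \<Rightarrow> 'k ser"
  assumes F: "F \<in> Aut_plus g n"
begin

interpretation alg_hom g n F using F by (rule Aut_plus_alg_hom)

lemma Aut_inv_Alg: "b \<in> Alg g n \<Longrightarrow> Aut_inv g n F b \<in> Alg g n"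
  and Aut_inv_right: "b \<in> Alg g n \<Longrightarrow> F (Aut_inv g n F b) = b"
  and Aut_inv_left: "a \<in> Alg g n \<Longrightarrow> Aut_inv g n F (F a) = a"
  using Aut_plus_bij[OF F] hom_Alg
  by (auto simp: Aut_inv_def bij_betw_def inv_into_into f_inv_into_f inv_into_f_f)

lemma Aut_inv_eqI: "a \<in> Alg g n \<Longrightarrow> F a = b \<Longrightarrow> Aut_inv g n F b = a"
  using Aut_inv_left by blast

lemma Aut_inv_Aut_plus: "Aut_inv g n F \<in> Aut_plus g n"
  unfolding Aut_plus_def linear_on_Alg_def continuous_on_Alg_def
proof (intro CollectI conjI ballI allI)
  let ?I = "Aut_inv g n F"
  show "?I \<in> extensional (Alg g n)" by (simp add: Aut_inv_def)
  show "?I \<in> Alg g n \<rightarrow> Alg g n" using Aut_inv_Alg by blast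
  show "?I (a + b) = ?I a + ?I b" if "a \<in> Alg g n" "b \<in> Alg g n" for a b
    using that by (intro Aut_inv_eqI) (simp_all add: Aut_inv_Alg Alg_add hom_add Aut_inv_right)
  show "?I (c \<odot> a) = c \<odot> ?I a" if "a \<in> Alg g n" for a c
    using that by (intro Aut_inv_eqI) (simp_all add: Aut_inv_Alg Alg_smul hom_smul Aut_inv_right)
  show "?I 1 = 1" by (intro Aut_inv_eqI) (simp_all add: hom_one)
  show "?I (a * b) = ?I a * ?I b" if "a \<in> Alg g n" "b \<in> Alg g n" for a b
    using that by (intro Aut_inv_eqI) (simp_all add: Aut_inv_Alg Alg_mult hom_mult Aut_inv_right)
  have Filt: "?I b \<in> Filt g n m" if "b \<in> Filt g n m" for b m
    by (rule Aut_plus_Filt_converse[OF F]) (use that in \<open>simp_all add: Aut_inv_Alg Aut_inv_right Filt_Alg\<close>)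
  then show "\<exists>k. ?I ` Filt g n k \<subseteq> Filt g n m" for m by blast
  have bij: "bij_betw F (Lie g n) (Lie g n)" using F by (simp add: Aut_plus_def)
  then have "bij_betw ?I (F ` Lie g n) (Lie g n)"
    using Aut_inv_left[OF Lie_Alg] by (intro bij_betw_byWitness[where f' = F]) auto
  then show "bij_betw ?I (Lie g n) (Lie g n)" using bij by (simp add: bij_betw_def)
  show "?I (letter x) - letter x \<in> Filt g n (wt x + 1)" if x: "x \<in> gens g n" for x
    using Filt_uminus[OF Aut_plus_raises[OF F Filt[OF Filt_letter[OF x]]]]
    by (simp add: Aut_inv_right Alg_letter x)
qed

lemma Aut_plus_expL: "f \<in> expL g n \<Longrightarrow> F f \<in> expL g n"
  and Aut_plus_log: "f \<in> expL g n \<Longrightarrow> ncs_log (F f) = F (ncs_log f)"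
proof -
  assume "f \<in> expL g n"
  then obtain a where a: "a \<in> Lie g n" "f = ncs_exp a" by (auto simp: expL_def)
  have "F f = ncs_exp (F a)"
    unfolding a(2) ncs_exp_def using a(1) Lie_Filt_1 Aut_plus_Lie[OF F] by (intro hom_fps_app) auto
  then show "F f \<in> expL g n" "ncs_log (F f) = F (ncs_log f)"
    using a(1) Aut_plus_Lie[OF F a(1)] ncs_log_exp[OF Lie_cf_Nil[OF a(1)]]
      ncs_log_exp[OF Lie_cf_Nil[OF Aut_plus_Lie[OF F a(1)]]] by (simp_all add: expL_def a(2))
qed

lemma Aut_plus_inv: "f \<in> expL g n \<Longrightarrow> F (ncs_inv f) = ncs_inv (F f)"
  by (intro ncs_inv_eqI[symmetric])
    (simp_all add: hom_mult[symmetric] expL_inverse expL_Alg hom_one)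

end

lemma Aut_plus_id: "(\<lambda>a\<in>Alg g n. a) \<in> Aut_plus g n"
  by (auto simp: Aut_plus_def linear_on_Alg_def continuous_on_Alg_def Alg_add Alg_smul Alg_mult
      bij_betw_def inj_on_def Lie_Alg Alg_letter Filt_Alg image_iff)

lemma Aut_plus_compose:
  assumes F: "F \<in> Aut_plus g n" and G: "G \<in> Aut_plus g n"
  shows "compose (Alg g n) F G \<in> Aut_plus g n"
proof -
  interpret F: alg_hom g n F using F by (rule Aut_plus_alg_hom)
  interpret G: alg_hom g n G using G by (rule Aut_plus_alg_hom)
  have c: "compose (Alg g n) F G a = F (G a)" if "a \<in> Alg g n" for a
    using that by (simp add: compose_def)
  show ?thesis
    unfolding Aut_plus_def linear_on_Alg_def continuous_on_Alg_def
  proof (intro CollectI conjI ballI allI)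
    show "\<exists>k. compose (Alg g n) F G ` Filt g n k \<subseteq> Filt g n m" for m
    proof (rule exI[of _ m], rule image_subsetI)
      fix a :: "'a ser" assume a: "a \<in> Filt g n m"
      show "compose (Alg g n) F G a \<in> Filt g n m"
        unfolding c[OF Filt_Alg[OF a]] by (rule Aut_plus_Filt[OF F Aut_plus_Filt[OF G a]])
    qed
    have "bij_betw (F \<circ> G) (Lie g n) (Lie g n)"
      using F G by (auto simp: Aut_plus_def intro: bij_betw_trans)
    then show "bij_betw (compose (Alg g n) F G) (Lie g n) (Lie g n)"
      by (subst bij_betw_cong[of _ _ "F \<circ> G"]) (simp_all add: c Lie_Alg)
    show "compose (Alg g n) F G (letter x) - letter x \<in> Filt g n (wt x + 1)" if "x \<in> gens g n" for x
    proof -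
      have x: "letter x \<in> Filt g n (wt x)" using that by (rule Filt_letter)
      show ?thesis
        using Filt_add[OF Aut_plus_raises[OF F Aut_plus_Filt[OF G x]] Aut_plus_raises[OF G x]]
        by (simp add: c Filt_Alg[OF x])
    qed
  qed (auto simp: c Alg_add Alg_smul Alg_mult F.hom_add F.hom_smul F.hom_mult F.hom_one F.hom_Alg
      G.hom_add G.hom_smul G.hom_mult G.hom_one G.hom_Alg)
qed

section \<open>The group of tangential automorphisms and the cocycle c\<close>

lemma tAut_plus_simps:
  "F \<in> carrier (tAut_plus g n) \<longleftrightarrow> fst F \<in> Aut_plus g n \<and> snd F \<in> {1..n} \<rightarrow>\<^sub>E expL g n \<and>
     (\<forall>j\<in>{1..n}. fst F (letter (Z j)) = ncs_inv (snd F j) * letter (Z j) * snd F j)"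
  "F \<otimes>\<^bsub>tAut_plus g n\<^esub> G = (compose (Alg g n) (fst F) (fst G), \<lambda>j\<in>{1..n}. snd F j * fst F (snd G j))"
  "\<one>\<^bsub>tAut_plus g n\<^esub> = (\<lambda>a\<in>Alg g n. a, \<lambda>j\<in>{1..n}. 1)"
  by (auto simp: tAut_plus_def split: prod.splits)

lemma letter_Z_Alg: "j \<in> {1..n} \<Longrightarrow> letter (Z j) \<in> Alg g n"
  by (rule Alg_letter) (simp add: gens_def)

lemma ncs_inv_mult:
  "f \<in> expL g n \<Longrightarrow> h \<in> expL g n \<Longrightarrow> ncs_inv (f * h) = ncs_inv h * ncs_inv f"
  by (rule ncs_inv_eqI) (metis (no_types) expL_inverse(2,3) mult.assoc mult_1_left)+

lemma group_tAut_plus: "group (tAut_plus g n :: 'k::field_char_0 taut monoid)"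
proof (rule groupI)
  let ?T = "tAut_plus g n :: 'k taut monoid"
  fix F :: "'k taut" assume F: "F \<in> carrier ?T"
  then have F1: "fst F \<in> Aut_plus g n" and F2: "\<And>j. j \<in> {1..n} \<Longrightarrow> snd F j \<in> expL g n"
    and F3: "\<And>j. j \<in> {1..n} \<Longrightarrow> fst F (letter (Z j)) = ncs_inv (snd F j) * letter (Z j) * snd F j"
    and F4: "snd F \<in> extensional {1..n}"
    by (auto simp: tAut_plus_simps PiE_def)
  interpret F: alg_hom g n "fst F" using F1 by (rule Aut_plus_alg_hom)
  show "\<one>\<^bsub>?T\<^esub> \<otimes>\<^bsub>?T\<^esub> F = F"
  proof (rule prod_eqI)
    show "fst (\<one>\<^bsub>?T\<^esub> \<otimes>\<^bsub>?T\<^esub> F) = fst F"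
      by (rule Aut_plus_eqI[of _ g n], simp_all only: tAut_plus_simps fst_conv Aut_plus_compose Aut_plus_id F1)
        (simp add: compose_def F.hom_Alg)
    show "snd (\<one>\<^bsub>?T\<^esub> \<otimes>\<^bsub>?T\<^esub> F) = snd F"
      by (rule extensionalityI[of _ "{1..n}"]) (use F4 in \<open>simp_all add: tAut_plus_simps expL_Alg F2\<close>)
  qed
  show "\<exists>G\<in>carrier ?T. G \<otimes>\<^bsub>?T\<^esub> F = \<one>\<^bsub>?T\<^esub>"
  proof
    let ?I = "Aut_inv g n (fst F)"
    \<comment> \<open>The product with \<open>F\<close> has second component
      \<open>g_j F^(-1)(f_j)\<close>; setting it to 1 forces
      \<open>g_j = F^(-1)(f_j^(-1))\<close>.\<close>
    let ?G = "(?I, \<lambda>j\<in>{1..n}. ?I (ncs_inv (snd F j)))"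
    have I: "?I \<in> Aut_plus g n" using F1 by (rule Aut_inv_Aut_plus)
    interpret I: alg_hom g n ?I using I by (rule Aut_plus_alg_hom)
    have IF: "?I (fst F a) = a" if "a \<in> Alg g n" for a using that Aut_inv_left[OF F1] by blast
    have "?I (letter (Z j)) = ncs_inv (?I (ncs_inv (snd F j))) * letter (Z j) * ?I (ncs_inv (snd F j))"
      if j: "j \<in> {1..n}" for j
    proof -
      let ?f = "snd F j" and ?z = "letter (Z j) :: 'k ser"
      have f: "?f \<in> expL g n" and zA: "?z \<in> Alg g n" using F2 j letter_Z_Alg by auto
      have fA: "?f \<in> Alg g n" "ncs_inv ?f \<in> Alg g n" using f expL_inverse(1) expL_Alg by blast+
      have "?I (ncs_inv ?f) * ?I ?f = 1" "?I ?f * ?I (ncs_inv ?f) = 1"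
        using expL_inverse(2,3)[OF f] by (simp_all add: I.hom_mult[symmetric] fA I.hom_one)
      then have inv: "ncs_inv (?I (ncs_inv ?f)) = ?I ?f" by (intro ncs_inv_eqI)
      have "?z = ?I (fst F ?z)" by (rule IF[OF zA, symmetric])
      also have "\<dots> = ?I (ncs_inv ?f) * ?I ?z * ?I ?f"
        by (simp add: F3[OF j] I.hom_mult Alg_mult fA zA)
      finally have "?I ?f * ?z * ?I (ncs_inv ?f) =
          ?I ?f * (?I (ncs_inv ?f) * ?I ?z * ?I ?f) * ?I (ncs_inv ?f)"
        by (rule arg_cong)
      also have "\<dots> = (?I ?f * ?I (ncs_inv ?f)) * ?I ?z * (?I ?f * ?I (ncs_inv ?f))"
        by (simp only: mult.assoc)
      finally have "?I ?f * ?z * ?I (ncs_inv ?f) = \<dots>" .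
      then show ?thesis unfolding inv using \<open>?I ?f * ?I (ncs_inv ?f) = 1\<close> by simp
    qed
    moreover have "?I (ncs_inv (snd F j)) \<in> expL g n" if "j \<in> {1..n}" for j
      by (rule Aut_plus_expL[OF I expL_inverse(1)[OF F2[OF that]]])
    ultimately show "?G \<in> carrier ?T"
      using I by (auto simp: tAut_plus_simps)
    show "?G \<otimes>\<^bsub>?T\<^esub> F = \<one>\<^bsub>?T\<^esub>"
    proof (rule prod_eqI)
      show "fst (?G \<otimes>\<^bsub>?T\<^esub> F) = fst \<one>\<^bsub>?T\<^esub>"
        by (rule Aut_plus_eqI[of _ g n], simp_all only: tAut_plus_simps fst_conv Aut_plus_compose Aut_plus_id F1 I)
          (simp add: compose_def IF)
      have "?I (ncs_inv (snd F j)) * ?I (snd F j) = 1" if "j \<in> {1..n}" for j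
        using F2[OF that] by (simp add: I.hom_mult[symmetric] expL_Alg expL_inverse I.hom_one)
      then show "snd (?G \<otimes>\<^bsub>?T\<^esub> F) = snd \<one>\<^bsub>?T\<^esub>"
        by (intro extensionalityI[of _ "{1..n}"]) (simp_all add: tAut_plus_simps)
    qed
  qed
  fix G :: "'k taut" assume G: "G \<in> carrier ?T"
  then have G1: "fst G \<in> Aut_plus g n" and G2: "\<And>j. j \<in> {1..n} \<Longrightarrow> snd G j \<in> expL g n"
    and G3: "\<And>j. j \<in> {1..n} \<Longrightarrow> fst G (letter (Z j)) = ncs_inv (snd G j) * letter (Z j) * snd G j"
    by (auto simp: tAut_plus_simps PiE_def)
  interpret G: alg_hom g n "fst G" using G1 by (rule Aut_plus_alg_hom)
  \<comment> \<open>\<open>F(g^(-1) z g) = F(g)^(-1) f^(-1) z f F(g)\<close>, so the conjugating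
    element of the composite is \<open>f F(g)\<close>, in the order used by the group law.\<close>
  have "compose (Alg g n) (fst F) (fst G) (letter (Z j)) =
     ncs_inv (snd F j * fst F (snd G j)) * letter (Z j) * (snd F j * fst F (snd G j))"
    if j: "j \<in> {1..n}" for j
  proof -
    have zA: "(letter (Z j) :: 'k ser) \<in> Alg g n" using j by (rule letter_Z_Alg)
    have GA: "snd G j \<in> Alg g n" "ncs_inv (snd G j) \<in> Alg g n"
      using G2[OF j] expL_inverse(1) expL_Alg by blast+
    have "compose (Alg g n) (fst F) (fst G) (letter (Z j)) = fst F (ncs_inv (snd G j) * letter (Z j) * snd G j)"
      using zA by (simp add: compose_def G3[OF j])
    also have "\<dots> = ncs_inv (fst F (snd G j)) * (ncs_inv (snd F j) * letter (Z j) * snd F j) * fst F (snd G j)"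
      by (simp add: F.hom_mult Alg_mult GA zA F3[OF j] Aut_plus_inv[OF F1 G2[OF j]])
    finally show ?thesis
      by (simp add: ncs_inv_mult[OF F2[OF j] Aut_plus_expL[OF F1 G2[OF j]]] mult.assoc)
  qed
  then show "F \<otimes>\<^bsub>?T\<^esub> G \<in> carrier ?T"
    using F1 G1 F2 G2 by (auto simp: tAut_plus_simps Aut_plus_compose expL_mult Aut_plus_expL)
  fix H :: "'k taut" assume H: "H \<in> carrier ?T"
  then have H1: "fst H \<in> Aut_plus g n" and H2: "\<And>j. j \<in> {1..n} \<Longrightarrow> snd H j \<in> expL g n"
    by (auto simp: tAut_plus_simps PiE_def)
  interpret H: alg_hom g n "fst H" using H1 by (rule Aut_plus_alg_hom)
  show "F \<otimes>\<^bsub>?T\<^esub> G \<otimes>\<^bsub>?T\<^esub> H = F \<otimes>\<^bsub>?T\<^esub> (G \<otimes>\<^bsub>?T\<^esub> H)"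
  proof (rule prod_eqI)
    show "fst (F \<otimes>\<^bsub>?T\<^esub> G \<otimes>\<^bsub>?T\<^esub> H) = fst (F \<otimes>\<^bsub>?T\<^esub> (G \<otimes>\<^bsub>?T\<^esub> H))"
      by (rule Aut_plus_eqI[of _ g n], simp_all only: tAut_plus_simps fst_conv Aut_plus_compose F1 G1 H1)
        (simp add: compose_def H.hom_Alg)
    show "snd (F \<otimes>\<^bsub>?T\<^esub> G \<otimes>\<^bsub>?T\<^esub> H) = snd (F \<otimes>\<^bsub>?T\<^esub> (G \<otimes>\<^bsub>?T\<^esub> H))"
      by (rule extensionalityI[of _ "{1..n}"])
        (simp_all add: tAut_plus_simps compose_def expL_Alg H2 G2 F.hom_mult G.hom_Alg mult.assoc)
  qed
next
  show "\<one>\<^bsub>tAut_plus g n\<^esub> \<in> carrier (tAut_plus g n :: 'k taut monoid)"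
  proof -
    have "ncs_inv (1 :: 'k ser) = 1" by (rule ncs_inv_eqI) simp_all
    then show ?thesis
      by (auto simp: tAut_plus_simps Aut_plus_id expL_one letter_Z_Alg)
  qed
qed

text \<open>Names ending in \<open>_rep\<close> denote lifts to \<open>A\<close> of classes in
  \<open>|A|\<close>; equations in \<open>|A|\<close> become membership of differences in
  \<open>commA\<close>.\<close>

definition c_rep :: "nat \<Rightarrow> (gen \<Rightarrow> int) \<Rightarrow> 'k::field_char_0 taut \<Rightarrow> 'k ser" where
  "c_rep n \<rho> F = (\<Sum>j\<in>{1..n}. of_int (\<rho> (Z j)) \<odot> ncs_log (snd F j))"

lemma c_rep_Alg: "F \<in> carrier (tAut_plus g n) \<Longrightarrow> c_rep n \<rho> F \<in> Alg g n"
  unfolding c_rep_def by (intro Alg_sum Alg_smul Alg_log) (auto simp: tAut_plus_simps intro: expL_Alg)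

lemma c_rep_cocycle:
  assumes F: "F \<in> carrier (tAut_plus g n)" and G: "G \<in> carrier (tAut_plus g n)"
  shows "c_rep n \<rho> (F \<otimes>\<^bsub>tAut_plus g n\<^esub> G) - (c_rep n \<rho> F + fst F (c_rep n \<rho> G)) \<in> commA g n"
proof -
  have F1: "fst F \<in> Aut_plus g n" and F2: "\<And>j. j \<in> {1..n} \<Longrightarrow> snd F j \<in> expL g n"
    and G2: "\<And>j. j \<in> {1..n} \<Longrightarrow> snd G j \<in> expL g n"
    using F G by (auto simp: tAut_plus_simps)
  interpret F: alg_hom g n "fst F" using F1 by (rule Aut_plus_alg_hom)
  have logA: "ncs_log (snd G j) \<in> Alg g n" if "j \<in> {1..n}" for j
    using G2[OF that] Alg_log expL_Alg by blast
  have "fst F (c_rep n \<rho> G) = (\<Sum>j\<in>{1..n}. of_int (\<rho> (Z j)) \<odot> ncs_log (fst F (snd G j)))"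
    unfolding c_rep_def
    by (subst F.hom_sum) (simp_all add: Alg_smul logA F.hom_smul Aut_plus_log[OF F1 G2])
  then have "c_rep n \<rho> (F \<otimes>\<^bsub>tAut_plus g n\<^esub> G) - (c_rep n \<rho> F + fst F (c_rep n \<rho> G)) =
    (\<Sum>j\<in>{1..n}. of_int (\<rho> (Z j)) \<odot> (ncs_log (snd F j * fst F (snd G j)) -
       (ncs_log (snd F j) + ncs_log (fst F (snd G j)))))"
    by (simp add: c_rep_def tAut_plus_simps ncs.scale_right_diff_distrib ncs.scale_right_distrib
        sum.distrib sum_subtractf)
  also have "\<dots> \<in> commA g n"
    by (intro commA_sum commA_smul expL_mult_log(2)) (simp_all add: F2 G2 Aut_plus_expL[OF F1])
  finally show ?thesis .
qed

subsection \<open>Operators on \<open>A \<oplus> K\<close>\<close>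

definition pscale :: "'k::field_char_0 \<Rightarrow> 'k ser \<times> 'k \<Rightarrow> 'k ser \<times> 'k" where
  "pscale c p = (c \<odot> fst p, c * snd p)"

lemma pscale_simps [simp]: "fst (pscale c p) = c \<odot> fst p" "snd (pscale c p) = c * snd p"
  by (simp_all add: pscale_def)

text \<open>A type of its own, because the Baker--Campbell--Hausdorff theorem is about a ring type.
  The type cannot depend on \<open>g\<close> and \<open>n\<close>, so operators act on all series in
  the letters \<open>gen\<close> and not just on \<open>A\<close>.\<close>

typedef (overloaded) 'k lin_op =
  "{f :: 'k::field_char_0 ser \<times> 'k \<Rightarrow> 'k ser \<times> 'k.
     (\<forall>p q. f (p + q) = f p + f q) \<and> (\<forall>c p. f (pscale c p) = pscale c (f p))}"
  morphisms ap Op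
  by (rule exI[of _ id]) simp

lemma ap_add: "ap T (p + q) = ap T p + ap T q"
  and ap_pscale: "ap T (pscale c p) = pscale c (ap T p)"
  using ap[of T] unfolding mem_Collect_eq by blast+

lemma ap_zero: "ap T 0 = 0"
  using ap_add[of T 0 0] by simp

lemma ap_Op:
  assumes "\<And>p q. f (p + q) = f p + f q" "\<And>c p. f (pscale c p) = pscale c (f p)"
  shows "ap (Op f) = f"
  using assms by (intro Op_inverse CollectI conjI allI)

lemma lin_op_eqI: "(\<And>p. ap T p = ap U p) \<Longrightarrow> T = U"
  by (metis ap_inject ext)

instantiation lin_op :: (field_char_0) ring_1
begin

definition "0 = Op (\<lambda>p. 0)"
definition "1 = Op (\<lambda>p. p)"
definition "T + U = Op (\<lambda>p. ap T p + ap U p)"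
definition "- T = Op (\<lambda>p. - ap T p)"
definition "T - U = Op (\<lambda>p. ap T p - ap U p)"
definition "T * U = Op (\<lambda>p. ap T (ap U p))"

lemma pscale_add: "pscale c (p + q) = pscale c p + pscale c q"
  and pscale_uminus: "pscale c (- p) = - pscale c p"
  and pscale_diff: "pscale c (p - q) = pscale c p - pscale c q"
  and pscale_zero: "pscale c 0 = 0"
  by (auto intro!: prod_eqI simp: ncs.scale_right_distrib ncs.scale_right_diff_distrib algebra_simps)

lemma ap_simps [simp]:
  "ap 0 p = 0" "ap 1 p = p" "ap (T + U) p = ap T p + ap U p" "ap (- T) p = - ap T p"
  "ap (T - U) p = ap T p - ap U p" "ap (T * U) p = ap T (ap U p)"
  unfolding zero_lin_op_def one_lin_op_def plus_lin_op_def uminus_lin_op_def minus_lin_op_def times_lin_op_def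
  by (subst ap_Op; simp add: ap_add ap_pscale pscale_add pscale_uminus pscale_diff pscale_zero algebra_simps)+

instance
proof
  show "(0 :: 'a lin_op) \<noteq> 1"
  proof
    assume "(0 :: 'a lin_op) = 1"
    then have "ap (0 :: 'a lin_op) (0, 1) = ap 1 (0, 1)" by simp
    then show False by (simp add: zero_prod_def)
  qed
qed (auto intro!: lin_op_eqI simp: ap_add algebra_simps)

end

definition scal_op :: "'k::field_char_0 \<Rightarrow> 'k lin_op" where
  "scal_op c = Op (pscale c)"

lemma ap_scal_op [simp]: "ap (scal_op c) p = pscale c p"
  unfolding scal_op_def
  by (subst ap_Op) (auto intro!: prod_eqI simp: ncs.scale_right_distrib algebra_simps)

lemma ap_sum: "ap (sum T A) p = (\<Sum>i\<in>A. ap (T i) p)"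
  by (induction A rule: infinite_finite_induct) simp_all

text \<open>The summand \<open>K\<close> is placed in degree 0, so the scalar component vanishes in
  positive degree. An operator \<open>(a, s) \<mapsto> (u a + s d, 0)\<close> then raises the degree
  by one as soon as \<open>u\<close> does and \<open>d\<close> has positive weight.\<close>

definition pF :: "nat \<Rightarrow> ('k::field_char_0 ser \<times> 'k) set" where
  "pF i = {p. fst p \<in> ncs_ge wtw i \<and> (i > 0 \<longrightarrow> snd p = 0)}"

definition oFl :: "nat \<Rightarrow> 'k::field_char_0 lin_op set" where
  "oFl m = {T. \<forall>i. \<forall>p\<in>pF i. ap T p \<in> pF (i + m)}"

lemma pF_0: "p \<in> pF 0"
  by (simp add: pF_def ncs_ge_def)

lemma pF_add: "p \<in> pF i \<Longrightarrow> q \<in> pF i \<Longrightarrow> p + q \<in> pF i"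
  by (auto simp: pF_def ncs_ge_def) (metis add.right_neutral)

lemma pF_uminus: "p \<in> pF i \<Longrightarrow> - p \<in> pF i"
  by (simp add: pF_def ncs_ge_def)

lemma pF_zero: "0 \<in> pF i"
  by (simp add: pF_def ncs_ge_def)

lemma pF_pscale: "p \<in> pF i \<Longrightarrow> pscale c p \<in> pF i"
  by (auto simp: pF_def ncs_ge_def)

lemma pF_le: "p \<in> pF m \<Longrightarrow> k \<le> m \<Longrightarrow> p \<in> pF k"
  by (auto simp: pF_def ncs_ge_def intro: le_trans)

lemma pF_cf: "p \<in> pF i \<Longrightarrow> wtw w < i \<Longrightarrow> cf (fst p) w = 0"
  by (auto simp: pF_def intro: ncs_geD)

lemma oFlD: "T \<in> oFl m \<Longrightarrow> p \<in> pF i \<Longrightarrow> ap T p \<in> pF (i + m)"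
  by (simp add: oFl_def)

lemma oFlD0: "T \<in> oFl m \<Longrightarrow> ap T p \<in> pF m"
  using oFlD[OF _ pF_0] by fastforce

lemma oFl_complete:
  fixes x :: "nat \<Rightarrow> 'k::field_char_0 lin_op"
  assumes x: "\<And>m. x m \<in> oFl m"
  shows "\<exists>S. \<forall>n. S - (\<Sum>m<n. x m) \<in> oFl n"
proof (rule exI, rule allI)
  fix n
  \<comment> \<open>In the first component the terms with \<open>m > wtw w\<close> have no
    coefficient at \<open>w\<close>. In the second only \<open>x 0\<close> counts, as operators of
    positive degree have scalar output 0.\<close>
  define f where "f = (\<lambda>p. (Ncs (\<lambda>w. \<Sum>m\<le>wtw w. cf (fst (ap (x m) p)) w), snd (ap (x 0) p)))"
  have f: "ap (Op f) = f"
    by (rule ap_Op)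
      (auto simp: f_def ap_add ap_pscale sum.distrib sum_distrib_left algebra_simps intro!: prod_eqI ncs_eqI)
  have "f p - (\<Sum>m<n. ap (x m) p) \<in> pF (i + n)" if p: "p \<in> pF i" for p i
    unfolding pF_def
  proof (intro CollectI conjI impI ncs_geI)
    have xp: "ap (x m) p \<in> pF (i + m)" for m using oFlD[OF x p] .
    fix w assume w: "wtw w < i + n"
    have "cf (fst (\<Sum>m<n. ap (x m) p)) w = (\<Sum>m<n. cf (fst (ap (x m) p)) w)"
      by (simp add: fst_sum cf_sum)
    also have "\<dots> = (\<Sum>m\<in>{m. i + m \<le> wtw w}. cf (fst (ap (x m) p)) w)"
      using w by (intro sum.mono_neutral_right) (auto intro: pF_cf[OF xp])
    also have "\<dots> = (\<Sum>m\<le>wtw w. cf (fst (ap (x m) p)) w)"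
      by (intro sum.mono_neutral_left) (auto intro: pF_cf[OF xp])
    finally show "cf (fst (f p - (\<Sum>m<n. ap (x m) p))) w = 0" by (simp add: f_def)
  next
    assume pos: "0 < i + n"
    have s: "snd (ap (x m) p) = 0" if "0 < i + m" for m
      using oFlD[OF x p, of m] that by (auto simp: pF_def)
    show "snd (f p - (\<Sum>m<n. ap (x m) p)) = 0"
    proof (cases n)
      case 0
      then show ?thesis using pos s[of 0] by (simp add: f_def)
    next
      case (Suc n')
      then show ?thesis using s by (simp add: f_def snd_sum sum.lessThan_Suc_shift del: sum.lessThan_Suc)
    qed
  qed
  then show "Op f - (\<Sum>m<n. x m) \<in> oFl n" by (simp add: oFl_def f ap_sum)
qed

interpretation lop: complete_filtered_ring scal_op "oFl :: nat \<Rightarrow> 'k::field_char_0 lin_op set"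
proof
  fix T U :: "'k lin_op" and c d :: 'k and k m :: nat and x :: "nat \<Rightarrow> 'k lin_op"
  show "T * U \<in> oFl (k + m)" if T: "T \<in> oFl k" and U: "U \<in> oFl m"
    unfolding oFl_def
  proof (intro CollectI allI ballI)
    fix i and p :: "'k ser \<times> 'k" assume "p \<in> pF i"
    from oFlD[OF T oFlD[OF U this]] show "ap (T * U) p \<in> pF (i + (k + m))"
      by (simp add: ac_simps)
  qed
  show "(\<And>m. x m \<in> oFl m) \<Longrightarrow> \<exists>s. \<forall>n. s - (\<Sum>m<n. x m) \<in> oFl n"
    by (rule oFl_complete)
  show "(\<And>m. T \<in> oFl m) \<Longrightarrow> T = 0"
  proof (rule lin_op_eqI)
    fix p assume "\<And>m. T \<in> oFl m"
    then have "ap T p \<in> pF m" for m by (rule oFlD0)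
    then have "cf (fst (ap T p)) w = 0" "snd (ap T p) = 0" for w
      using pF_cf[of "ap T p" "Suc (wtw w)" w] by (auto simp: pF_def)
    then show "ap T p = ap 0 p" by (auto intro!: prod_eqI ncs_eqI)
  qed
  show "scal_op c * T = T * scal_op c"
    by (rule lin_op_eqI) (simp add: ap_pscale)
  show "scal_op 1 = (1 :: 'k lin_op)" by (rule lin_op_eqI) (auto intro!: prod_eqI)
  show "scal_op (c + d) = scal_op c + scal_op d"
    by (rule lin_op_eqI) (auto intro!: prod_eqI simp: ncs.scale_left_distrib algebra_simps)
  show "scal_op (c * d) = scal_op c * scal_op d"
    by (rule lin_op_eqI) (auto intro!: prod_eqI)
  show "(oFl m :: 'k lin_op set) \<subseteq> oFl k" if "k \<le> m"
  proof
    fix T :: "'k lin_op" assume T: "T \<in> oFl m"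
    have "ap T p \<in> pF (i + k)" if "p \<in> pF i" for i p
      by (rule pF_le[OF oFlD[OF T that]]) (use \<open>k \<le> m\<close> in simp)
    then show "T \<in> oFl k" by (simp add: oFl_def)
  qed
qed (simp_all add: oFl_def pF_pscale pF_zero pF_add pF_uminus)

text \<open>For \<open>T\<close> in \<open>oFl 1\<close> the lower row of its block matrix on
  \<open>A \<oplus> K\<close> vanishes; \<open>op_der T\<close> and \<open>op_vec T\<close> are the
  two blocks of the upper row.\<close>

definition op_der :: "'k::field_char_0 lin_op \<Rightarrow> 'k ser \<Rightarrow> 'k ser" where
  "op_der T a = fst (ap T (a, 0))"

definition op_vec :: "'k::field_char_0 lin_op \<Rightarrow> 'k ser" where
  "op_vec T = fst (ap T (0, 1))"

lemma op_der_simps: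
  "op_der T (a + b) = op_der T a + op_der T b" "op_der T (c \<odot> a) = c \<odot> op_der T a"
  "op_der (T + U) a = op_der T a + op_der U a" "op_der (T - U) a = op_der T a - op_der U a"
  "op_der (scal_op c * T) a = c \<odot> op_der T a" "op_der 0 a = 0" "op_der T 0 = 0"
  using ap_add[of T "(a, 0)" "(b, 0)"] ap_pscale[of T c "(a, 0)"] ap_zero[of T]
  by (simp_all add: op_der_def pscale_def zero_prod_def)

lemma op_vec_simps:
  "op_vec (T + U) = op_vec T + op_vec U" "op_vec (T - U) = op_vec T - op_vec U"
  "op_vec (scal_op c * T) = c \<odot> op_vec T" "op_vec 0 = 0"
  by (simp_all add: op_vec_def)

lemma ap_eq:
  assumes "T \<in> oFl 1"
  shows "ap T (a, s) = (op_der T a + s \<odot> op_vec T, 0)"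
proof -
  have "snd (ap T (a, s)) = 0" using oFlD0[OF assms] by (simp add: pF_def)
  moreover have "ap T (a, s) = ap T (a, 0) + pscale s (ap T (0, 1))"
    unfolding ap_pscale[symmetric] ap_add[symmetric] by (simp add: pscale_def)
  ultimately show ?thesis by (intro prod_eqI) (simp_all add: op_der_def op_vec_def)
qed

lemma op_der_ge:
  assumes "T \<in> oFl m" "a \<in> ncs_ge wtw k" shows "op_der T a \<in> ncs_ge wtw (k + m)"
  using oFlD[OF assms(1), of "(a, 0)" k] assms(2) by (simp add: op_der_def pF_def)

lemma op_vec_ge: "T \<in> oFl m \<Longrightarrow> op_vec T \<in> ncs_ge wtw m"
  using oFlD0[of T m "(0, 1)"] by (simp add: op_vec_def pF_def)

text \<open>Block multiplication with zero lower row. For \<open>T = (u, d)\<close> and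
  \<open>U = (v, e)\<close> the commutator thus has vector part \<open>u e - v d\<close>, the shape
  of the cocycle identity for the divergence.\<close>

lemma op_mult:
  assumes "T \<in> oFl 1" "U \<in> oFl 1"
  shows "op_der (T * U) a = op_der T (op_der U a)" "op_vec (T * U) = op_der T (op_vec U)"
  using assms by (simp_all add: op_der_def[of "T * U"] op_vec_def[of "T * U"] ap_eq)
    (simp_all add: op_der_simps)

text \<open>On \<open>(0, 1)\<close> the first application of \<open>T\<close> produces
  \<open>op_vec T\<close>, and only the remaining ones apply \<open>op_der T\<close>. This shift
  turns the \<open>1/k!\<close> of the exponential into the \<open>1/(k+1)!\<close> of
  \<open>j\<close>.\<close>

lemma op_power:
  assumes T: "T \<in> oFl 1"
  shows "ap (T ^ k) (a, 0) = ((op_der T ^^ k) a, 0)"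
    and "ap (T ^ Suc k) (0, 1) = ((op_der T ^^ k) (op_vec T), 0)"
proof -
  show 1: "ap (T ^ k) (a, 0) = ((op_der T ^^ k) a, 0)" for k a
    by (induction k) (simp_all add: ap_eq[OF T])
  have "ap (T ^ Suc k) (0, 1) = ap (T ^ k) (ap T (0, 1))"
    by (simp only: power_Suc2 ap_simps)
  also have "\<dots> = ((op_der T ^^ k) (op_vec T), 0)"
    by (simp add: ap_eq[OF T] op_der_simps 1)
  finally show "ap (T ^ Suc k) (0, 1) = ((op_der T ^^ k) (op_vec T), 0)" .
qed

lemma ap_app:
  assumes T: "T \<in> oFl 1"
  shows "cf (fst (ap (lop.app h T) p)) w = (\<Sum>k\<le>wtw w. fps_nth h k * cf (fst (ap (T ^ k) p)) w)"
    and "snd (ap (lop.app h T) p) = fps_nth h 0 * snd p"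
proof -
  have S: "ap (lop.app h T - (\<Sum>k<n. scal_op (fps_nth h k) * T ^ k)) p \<in> pF n" for n
    by (rule oFlD0) (use lop.app_sums[OF T, of h] in \<open>simp add: lop.sums_to_def\<close>)
  from pF_cf[OF S[of "Suc (wtw w)"], of w]
  show "cf (fst (ap (lop.app h T) p)) w = (\<Sum>k\<le>wtw w. fps_nth h k * cf (fst (ap (T ^ k) p)) w)"
    by (simp add: ap_sum fst_sum cf_sum lessThan_Suc_atMost)
  from S[of 1] show "snd (ap (lop.app h T) p) = fps_nth h 0 * snd p"
    by (simp add: pF_def)
qed

text \<open>Derivations are controlled only on \<open>A\<close>; discarding words with foreign
  letters extends them to operators on all series.\<close>

definition proj_Alg :: "nat \<Rightarrow> nat \<Rightarrow> 'k::field_char_0 ser \<Rightarrow> 'k ser" where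
  "proj_Alg g n a = Ncs (\<lambda>w. if set w \<subseteq> gens g n then cf a w else 0)"

lemma proj_Alg_Alg: "proj_Alg g n a \<in> Alg g n"
  by (simp add: proj_Alg_def Alg_def)

lemma proj_Alg_id: "a \<in> Alg g n \<Longrightarrow> proj_Alg g n a = a"
  by (rule ncs_eqI) (auto simp: proj_Alg_def Alg_def)

definition mkop :: "nat \<Rightarrow> nat \<Rightarrow> ('k::field_char_0 ser \<Rightarrow> 'k ser) \<Rightarrow> 'k ser \<Rightarrow> 'k lin_op" where
  "mkop g n u d = Op (\<lambda>p. (u (proj_Alg g n (fst p)) + snd p \<odot> d, 0))"

context
  fixes g n :: nat and u :: "'k::field_char_0 ser \<Rightarrow> 'k ser"
  assumes lin: "linear_on_Alg g n u" and raise: "\<And>m a. a \<in> Filt g n m \<Longrightarrow> u a \<in> Filt g n (m + 1)"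
begin

lemma ap_mkop: "ap (mkop g n u d) p = (u (proj_Alg g n (fst p)) + snd p \<odot> d, 0)"
proof -
  have 1: "proj_Alg g n (a + b) = proj_Alg g n a + proj_Alg g n b"
    "proj_Alg g n (c \<odot> a) = c \<odot> proj_Alg g n a" for a b :: "'k ser" and c
    by (rule ncs_eqI; simp add: proj_Alg_def)+
  show ?thesis
    unfolding mkop_def
    by (subst ap_Op) (auto simp: 1 linear_on_AlgD[OF lin] proj_Alg_Alg ncs.scale_left_distrib
        ncs.scale_right_distrib intro!: prod_eqI)
qed

lemma mkop_oFl:
  assumes d: "d \<in> Filt g n 1" shows "mkop g n u d \<in> oFl 1"
  unfolding oFl_def
proof (intro CollectI allI ballI)
  fix i and p :: "'k ser \<times> 'k" assume p: "p \<in> pF i"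
  have "proj_Alg g n (fst p) \<in> Filt g n i"
    by (rule FiltI[OF proj_Alg_Alg]) (simp add: proj_Alg_def pF_cf[OF p])
  then have "u (proj_Alg g n (fst p)) \<in> Filt g n (i + 1)" by (rule raise)
  moreover have "snd p \<odot> d \<in> Filt g n (i + 1)"
  proof (cases "i = 0")
    case True
    then show ?thesis using d by (simp add: Filt_smul)
  next
    case False
    then show ?thesis using p by (simp add: pF_def)
  qed
  ultimately show "ap (mkop g n u d) p \<in> pF (i + 1)"
    using Filt_add unfolding ap_mkop pF_def by (simp add: Filt_eq) blast
qed

lemma op_der_mkop: "a \<in> Alg g n \<Longrightarrow> op_der (mkop g n u d) a = u a"
  and op_vec_mkop: "op_vec (mkop g n u d) = d"
  using proj_Alg_id[of 0] linear_on_Alg_zero[OF lin]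
  by (simp_all add: op_der_def op_vec_def ap_mkop proj_Alg_id)

end

lemma funpow_cong_Alg:
  fixes u v :: "'k::field_char_0 ser \<Rightarrow> 'k ser"
  assumes "\<And>a. a \<in> Alg g n \<Longrightarrow> u a = v a" "\<And>a. a \<in> Alg g n \<Longrightarrow> v a \<in> Alg g n" "a \<in> Alg g n"
  shows "(u ^^ k) a = (v ^^ k) a \<and> (v ^^ k) a \<in> Alg g n"
proof (induction k)
  case (Suc k)
  then show ?case using assms(1,2)[of "(v ^^ k) a"] by simp
qed (simp add: assms(3))

text \<open>\<open>Der_plus\<close> does not ask for extensionality, so a derivation may matter only
  through its restriction to \<open>A\<close>.\<close>

lemma exp_der_cong:
  fixes u v :: "'k::field_char_0 ser \<Rightarrow> 'k ser"
  assumes "\<And>a. a \<in> Alg g n \<Longrightarrow> u a = v a" "\<And>a. a \<in> Alg g n \<Longrightarrow> v a \<in> Alg g n"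
  shows "exp_der g n u = exp_der g n v"
  unfolding exp_der_def
proof (rule restrict_ext)
  fix a :: "'k ser" assume "a \<in> Alg g n"
  then have "(u ^^ k) a = (v ^^ k) a" for k using funpow_cong_Alg[of g n u v a k] assms by blast
  then show "Ncs (\<lambda>w. \<Sum>k\<le>wtw w. cf ((u ^^ k) a) w / fact k) =
      Ncs (\<lambda>w. \<Sum>k\<le>wtw w. cf ((v ^^ k) a) w / fact k)" by simp
qed

lemma ap_ex:
  assumes T: "T \<in> oFl 1" and a: "a \<in> Alg g n"
  shows "ap (lop.ex T) (a, 0) = (exp_der g n (op_der T) a, 0)"
  using ap_app[OF T, of "fps_exp 1" "(a, 0)"] a
  by (intro prod_eqI ncs_eqI) (simp_all add: lop.ex_def exp_der_def op_power[OF T])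

text \<open>A derivation is the logarithm of its exponential, by \<open>lop.lg_ex\<close>. This
  uniqueness is what makes the description in \<open>jj\<close> single out one class.\<close>

lemma mkop_ex_inj:
  assumes u: "linear_on_Alg g n u" "\<And>m a. a \<in> Filt g n m \<Longrightarrow> u a \<in> Filt g n (m + 1)"
    and v: "linear_on_Alg g n v" "\<And>m a. a \<in> Filt g n m \<Longrightarrow> v a \<in> Filt g n (m + 1)"
    and eq: "exp_der g n u = exp_der g n v" and a: "a \<in> Alg g n"
  shows "u a = v a"
proof -
  \<comment> \<open>With vector part 0 the operator kills the scalar component and the words outside
    \<open>A\<close>. Its exponential is the identity there, hence determined by
    \<open>exp_der\<close> on \<open>A\<close>.\<close>
  have ex: "ap (lop.ex (mkop g n w 0)) p = (exp_der g n w (proj_Alg g n (fst p)), 0) + (p - (proj_Alg g n (fst p), 0))"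
    if w: "linear_on_Alg g n w" "\<And>m a. a \<in> Filt g n m \<Longrightarrow> w a \<in> Filt g n (m + 1)" for w and p :: "'a ser \<times> 'a"
  proof -
    let ?T = "mkop g n w 0"
    have T: "?T \<in> oFl 1" by (rule mkop_oFl[OF w]) simp_all
    define q where "q = (proj_Alg g n (fst p), 0 :: 'a)"
    have pA: "proj_Alg g n (fst p) \<in> Alg g n" by (rule proj_Alg_Alg)
    have "ap ?T (p - q) = 0"
    proof -
      have "proj_Alg g n (fst (p - q)) = 0"
        by (rule ncs_eqI) (simp add: q_def proj_Alg_def)
      then show ?thesis by (simp add: ap_mkop[OF w] linear_on_Alg_zero[OF w(1)] zero_prod_def)
    qed
    then have "ap (?T ^ k) (p - q) = (if k = 0 then p - q else 0)" for k
      by (cases k) (simp_all add: power_Suc2 ap_zero del: power_Suc)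
    then have "fps_nth (fps_exp 1) k * cf (fst (ap (?T ^ k) (p - q))) v = (if k = 0 then cf (fst (p - q)) v else 0)" for k v
      by simp
    then have "ap (lop.ex ?T) (p - q) = p - q"
      unfolding lop.ex_def by (intro prod_eqI ncs_eqI) (simp_all only: ap_app[OF T], simp_all)
    moreover have "ap (lop.ex ?T) q = (exp_der g n w (fst q), 0)"
      unfolding q_def ap_ex[OF T pA] using exp_der_cong[of g n "op_der ?T" w]
      by (simp add: op_der_mkop[OF w] linear_on_AlgD[OF w(1)])
    ultimately show ?thesis using ap_add[of "lop.ex ?T" q "p - q"] by (simp add: q_def)
  qed
  have "lop.ex (mkop g n u 0) = lop.ex (mkop g n v 0)"
    by (rule lin_op_eqI) (simp add: ex[OF u] ex[OF v] eq)
  then have "lop.lg (lop.ex (mkop g n u 0)) = lop.lg (lop.ex (mkop g n v 0))" by simp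
  then have "mkop g n u 0 = mkop g n v 0"
    by (simp only: lop.lg_ex mkop_oFl[OF u] mkop_oFl[OF v] Filt_zero)
  then show ?thesis using op_der_mkop[OF u a] op_der_mkop[OF v a] by metis
qed

subsection \<open>Derivations and the divergence\<close>

locale alg_der =
  fixes g n :: nat and u :: "'k::field_char_0 ser \<Rightarrow> 'k ser"
  assumes Der_plus: "u \<in> Der_plus g n"
begin

lemma linear: "linear_on_Alg g n u"
  and der_mult: "a \<in> Alg g n \<Longrightarrow> b \<in> Alg g n \<Longrightarrow> u (a * b) = u a * b + a * u b"
  and der_Lie: "a \<in> Lie g n \<Longrightarrow> u a \<in> Lie g n"
  and der_Filt: "a \<in> Filt g n m \<Longrightarrow> u a \<in> Filt g n (m + 1)"
  using Der_plus unfolding Der_plus_def by blast+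

lemmas der_Alg = linear_on_AlgD(1)[OF linear]
lemmas der_add = linear_on_AlgD(2)[OF linear]
lemmas der_smul = linear_on_AlgD(3)[OF linear]
lemmas der_diff = linear_on_Alg_diff[OF linear]
lemmas der_sum = linear_on_Alg_sum[OF linear]

lemma der_one: "u 1 = 0"
  using der_mult[of 1 1] by simp

lemma der_commA: "c \<in> commA g n \<Longrightarrow> u c \<in> commA g n"
proof (rule commA_image[OF linear])
  show "continuous_on_Alg g n u"
    unfolding continuous_on_Alg_def using der_Filt Filt_le by (metis image_subsetI le_add1)
  fix a b :: "'k ser" assume ab: "a \<in> Alg g n" "b \<in> Alg g n"
  have "u (commutator a b) = commutator (u a) b + commutator a (u b)"
    using ab by (simp add: commutator_def der_diff der_mult Alg_mult)
  then show "u (commutator a b) \<in> commA g n"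
    using ab by (simp add: commA_add commA_commutator der_Alg)
qed

lemma funpow_Filt: "a \<in> Filt g n m \<Longrightarrow> (u ^^ k) a \<in> Filt g n (m + k)"
  by (induction k) (use der_Filt in fastforce)+

lemma funpow_Alg: "a \<in> Alg g n \<Longrightarrow> (u ^^ k) a \<in> Alg g n"
  by (induction k) (simp_all add: der_Alg)

lemma funpow_commA: "c \<in> commA g n \<Longrightarrow> (u ^^ k) c \<in> commA g n"
  by (induction k) (simp_all add: der_commA)

end

section \<open>The maps d_x and the divergence\<close>

lemma dd_add: "dd x (a + b) = dd x a + dd x b"
  and dd_diff: "dd x (a - b) = dd x a - dd x b"
  and dd_smul: "dd x (c \<odot> a) = c \<odot> dd x a"
  by (rule ncs_eqI; simp add: dd_def)+

lemma dd_sum: "dd x (sum f I) = (\<Sum>i\<in>I. dd x (f i))"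
  by (rule ncs_eqI) (simp add: dd_def cf_sum)

lemma dd_Alg:
  assumes "a \<in> Alg g n" shows "dd x a \<in> Alg g n"
  unfolding Alg_def
proof (intro CollectI allI impI)
  fix w assume "cf (dd x a) w \<noteq> 0"
  then have "set (w @ [x]) \<subseteq> gens g n" using assms unfolding Alg_def dd_def cf_Ncs by blast
  then show "set w \<subseteq> gens g n" by simp
qed

lemma dd_Filt:
  assumes "a \<in> Filt g n (wt x + m)" shows "dd x a \<in> Filt g n m"
  by (rule FiltI[OF dd_Alg[OF Filt_Alg[OF assms]]]) (simp add: dd_def wtw_append FiltD[OF assms])

text \<open>If \<open>b\<close> has no constant term, the last letter of every word in
  \<open>a * b\<close> comes from \<open>b\<close>.\<close>

lemma dd_mult:
  assumes "cf b [] = 0"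
  shows "dd x (a * b) = a * dd x b"
proof (rule ncs_eqI)
  fix w
  have "cf (dd x (a * b)) w = (\<Sum>k\<le>Suc (length w). cf a (take k (w @ [x])) * cf b (drop k (w @ [x])))"
    by (simp add: dd_def cf_mult)
  also have "\<dots> = (\<Sum>k\<le>length w. cf a (take k w) * cf b (drop k w @ [x]))"
    using assms by simp
  also have "\<dots> = cf (a * dd x b) w" by (simp add: dd_def cf_mult)
  finally show "cf (dd x (a * b)) w = cf (a * dd x b) w" .
qed

lemma dd_letter: "dd x (letter y) = (if x = y then 1 else 0)"
  by (rule ncs_eqI) (auto simp: dd_def cf_letter cf_one)

text \<open>The chain rule for the left module derivations \<open>dd x\<close>, which makes \<open>div\<close> a cocycle.\<close>

lemma (in alg_der) dd_der:
  assumes a: "a \<in> Alg g n" and x: "x \<in> gens g n"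
  shows "dd x (u a) = u (dd x a) + (\<Sum>y\<in>gens g n. dd y a * dd x (u (letter y)))"
proof -
  have lA: "(letter y :: 'k ser) \<in> Alg g n" if "y \<in> gens g n" for y using that by (rule Alg_letter)
  have ul: "cf (u (letter y)) [] = 0" if "y \<in> gens g n" for y
    using FiltD[OF der_Filt[OF Filt_letter[OF that]], of "[]"] by simp
  have "u a = u (cf a [] \<odot> 1 + (\<Sum>y\<in>gens g n. dd y a * letter y))"
    using dd_decomposition[OF a] by simp
  also have "\<dots> = (\<Sum>y\<in>gens g n. u (dd y a) * letter y + dd y a * u (letter y))"
    by (simp add: der_add der_smul der_one der_sum der_mult Alg_smul Alg_sum Alg_mult dd_Alg a lA)
  finally have "dd x (u a) = (\<Sum>y\<in>gens g n. dd x (u (dd y a) * letter y) + dd x (dd y a * u (letter y)))"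
    by (simp add: dd_sum dd_add)
  also have "\<dots> = (\<Sum>y\<in>gens g n. (if x = y then u (dd y a) else 0) + dd y a * dd x (u (letter y)))"
    by (rule sum.cong) (simp_all add: dd_mult ul dd_letter cf_letter)
  also have "\<dots> = u (dd x a) + (\<Sum>y\<in>gens g n. dd y a * dd x (u (letter y)))"
    using x finite_gens[of g n] by (simp add: sum.distrib)
  finally show ?thesis .
qed

lemma div_lift_Filt:
  assumes "\<And>a k. a \<in> Filt g n k \<Longrightarrow> u a \<in> Filt g n (k + m)"
  shows "div_lift g n u \<in> Filt g n m"
  unfolding div_lift_def by (intro Filt_sum dd_Filt assms Filt_letter)

text \<open>The chain rule leaves a double sum over pairs of generators for either order of
  \<open>u\<close> and \<open>v\<close>; interchanging \<open>x\<close> and \<open>y\<close> in one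
  of them pairs the terms into commutators \<open>[d_x v(y), d_y u(x)]\<close>.\<close>

lemma div_lift_commutator:
  assumes u: "u \<in> Der_plus g n" and v: "v \<in> Der_plus g n"
  shows "div_lift g n (\<lambda>a. u (v a) - v (u a)) - (u (div_lift g n v) - v (div_lift g n u)) \<in> commA g n"
proof -
  interpret u: alg_der g n u by unfold_locales (rule u)
  interpret v: alg_der g n v by unfold_locales (rule v)
  let ?G = "gens g n"
  have lA: "letter y \<in> Alg g n" if "y \<in> ?G" for y using that by (rule Alg_letter)
  define M where "M = (\<lambda>x y. dd y (v (letter x)) * dd x (u (letter y)))"
  define N where "N = (\<lambda>x y. dd y (u (letter x)) * dd x (v (letter y)))"
  have "div_lift g n (\<lambda>a. u (v a) - v (u a)) =
    (\<Sum>x\<in>?G. dd x (u (v (letter x))) - dd x (v (u (letter x))))"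
    by (simp add: div_lift_def dd_diff)
  also have "\<dots> = (\<Sum>x\<in>?G. u (dd x (v (letter x))) + (\<Sum>y\<in>?G. M x y)
      - (v (dd x (u (letter x))) + (\<Sum>y\<in>?G. N x y)))"
    unfolding M_def N_def
    by (rule sum.cong) (simp_all add: u.dd_der v.dd_der u.der_Alg v.der_Alg lA)
  also have "\<dots> = u (div_lift g n v) - v (div_lift g n u) + ((\<Sum>x\<in>?G. \<Sum>y\<in>?G. M x y) - (\<Sum>x\<in>?G. \<Sum>y\<in>?G. N x y))"
    by (simp add: div_lift_def u.der_sum v.der_sum dd_Alg u.der_Alg v.der_Alg lA sum.distrib sum_subtractf)
  also have "(\<Sum>x\<in>?G. \<Sum>y\<in>?G. M x y) = (\<Sum>x\<in>?G. \<Sum>y\<in>?G. M y x)"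
    by (rule sum.swap)
  finally have "div_lift g n (\<lambda>a. u (v a) - v (u a)) - (u (div_lift g n v) - v (div_lift g n u)) =
     (\<Sum>x\<in>?G. \<Sum>y\<in>?G. commutator (dd x (v (letter y))) (dd y (u (letter x))))"
    by (simp add: M_def N_def commutator_def sum_subtractf)
  also have "\<dots> \<in> commA g n"
    by (intro commA_sum commA_commutator dd_Alg u.der_Alg v.der_Alg lA)
  finally show ?thesis .
qed

text \<open>
  \<open>T\<close> in \<open>div_ops\<close> is the operator \<open>(a, s) \<mapsto> (u a + s d, 0)\<close> for a derivation \<open>u\<close> and a lift \<open>d\<close> of
  \<open>div u\<close> from \<open>|A|\<close> to \<open>A\<close>.
\<close>

definition div_ops :: "nat \<Rightarrow> nat \<Rightarrow> 'k::field_char_0 lin_op set" where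
  "div_ops g n = {T \<in> oFl 1. op_der T \<in> Der_plus g n \<and> op_vec T \<in> Alg g n \<and>
     op_vec T - div_lift g n (op_der T) \<in> commA g n}"

lemma Der_plusI:
  assumes "\<And>a. a \<in> Alg g n \<Longrightarrow> u a \<in> Alg g n"
    "\<And>a b. a \<in> Alg g n \<Longrightarrow> b \<in> Alg g n \<Longrightarrow> u (a + b) = u a + u b"
    "\<And>a c. a \<in> Alg g n \<Longrightarrow> u (c \<odot> a) = c \<odot> u a"
    "\<And>a b. a \<in> Alg g n \<Longrightarrow> b \<in> Alg g n \<Longrightarrow> u (a * b) = u a * b + a * u b"
    "\<And>a. a \<in> Lie g n \<Longrightarrow> u a \<in> Lie g n"
    "\<And>a m. a \<in> Filt g n m \<Longrightarrow> u a \<in> Filt g n (m + 1)"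
  shows "u \<in> Der_plus g n"
  using assms unfolding Der_plus_def linear_on_Alg_def by blast

lemma op_der_Filt:
  assumes "T \<in> oFl m" "\<And>a. a \<in> Alg g n \<Longrightarrow> op_der T a \<in> Alg g n" "a \<in> Filt g n k"
  shows "op_der T a \<in> Filt g n (k + m)"
  using op_der_ge[OF assms(1)] assms(2,3) by (simp add: Filt_eq)

lemma op_der_Der_plusI:
  assumes T: "T \<in> oFl 1"
    and A: "\<And>a. a \<in> Alg g n \<Longrightarrow> op_der T a \<in> Alg g n"
    and "\<And>a b. a \<in> Alg g n \<Longrightarrow> b \<in> Alg g n \<Longrightarrow> op_der T (a * b) = op_der T a * b + a * op_der T b"
    and "\<And>a. a \<in> Lie g n \<Longrightarrow> op_der T a \<in> Lie g n"
  shows "op_der T \<in> Der_plus g n"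
  by (rule Der_plusI) (use assms op_der_Filt[OF T A] in \<open>auto simp: op_der_simps\<close>)

lemma div_lift_op:
  "div_lift g n (op_der (T + U)) = div_lift g n (op_der T) + div_lift g n (op_der U)"
  "div_lift g n (op_der (T - U)) = div_lift g n (op_der T) - div_lift g n (op_der U)"
  "div_lift g n (op_der (scal_op c * T)) = c \<odot> div_lift g n (op_der T)"
  by (simp_all add: div_lift_def op_der_simps dd_add dd_diff dd_smul sum.distrib sum_subtractf ncs.scale_sum_right)

lemma div_opsD:
  assumes "T \<in> div_ops g n"
  shows "T \<in> oFl 1" "op_der T \<in> Der_plus g n" "op_vec T \<in> Alg g n"
    "op_vec T - div_lift g n (op_der T) \<in> commA g n" "alg_der g n (op_der T)"
  using assms by (auto simp: div_ops_def alg_der_def)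

lemma div_ops_add:
  assumes T: "T \<in> div_ops g n" and U: "U \<in> div_ops g n" shows "T + U \<in> div_ops g n"
proof -
  interpret T: alg_der g n "op_der T" using T by (rule div_opsD)
  interpret U: alg_der g n "op_der U" using U by (rule div_opsD)
  have TU: "T + U \<in> oFl 1" using div_opsD(1)[OF T] div_opsD(1)[OF U] by (rule lop.Fl_add)
  have "op_der (T + U) \<in> Der_plus g n"
    by (rule op_der_Der_plusI[OF TU])
      (auto simp: op_der_simps Alg_add T.der_Alg U.der_Alg T.der_mult U.der_mult Lie_add T.der_Lie U.der_Lie algebra_simps)
  moreover have "op_vec (T + U) - div_lift g n (op_der (T + U)) \<in> commA g n"
    using commA_add[OF div_opsD(4)[OF T] div_opsD(4)[OF U]] by (simp add: div_lift_op op_vec_simps add_diff_add)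
  ultimately show ?thesis
    using TU div_opsD(3)[OF T] div_opsD(3)[OF U] by (simp add: div_ops_def op_vec_simps Alg_add)
qed

lemma div_ops_scal:
  assumes T: "T \<in> div_ops g n" shows "scal_op c * T \<in> div_ops g n"
proof -
  interpret T: alg_der g n "op_der T" using T by (rule div_opsD)
  have cT: "scal_op c * T \<in> oFl 1" using div_opsD(1)[OF T] by (rule lop.Fl_scal)
  have "op_der (scal_op c * T) \<in> Der_plus g n"
    by (rule op_der_Der_plusI[OF cT])
      (auto simp: op_der_simps Alg_smul T.der_Alg T.der_mult Lie_smul T.der_Lie
        ncs.scale_right_distrib smul_mult_left smul_mult_right)
  moreover have "op_vec (scal_op c * T) - div_lift g n (op_der (scal_op c * T)) \<in> commA g n"
    using commA_smul[OF div_opsD(4)[OF T], of c]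
    by (simp add: div_lift_op op_vec_simps ncs.scale_right_diff_distrib)
  ultimately show ?thesis
    using cT div_opsD(3)[OF T] by (simp add: div_ops_def op_vec_simps Alg_smul)
qed

text \<open>The vector part of the commutator need not be the divergence itself. It differs from it
  by the images of the old discrepancies under the two derivations, which stay in
  \<open>commA\<close>, and by the defect from \<open>div_lift_commutator\<close>.\<close>

lemma div_ops_commutator:
  assumes T: "T \<in> div_ops g n" and U: "U \<in> div_ops g n" shows "commutator T U \<in> div_ops g n"
proof -
  interpret T: alg_der g n "op_der T" using T by (rule div_opsD)
  interpret U: alg_der g n "op_der U" using U by (rule div_opsD)
  note T1 = div_opsD(1)[OF T] and U1 = div_opsD(1)[OF U]
  have TU: "commutator T U \<in> oFl 1"
    unfolding commutator_def by (intro lop.Fl_diff lop.Fl_mult_le[OF T1 U1] lop.Fl_mult_le[OF U1 T1]) simp_all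
  have der: "op_der (commutator T U) = (\<lambda>a. op_der T (op_der U a) - op_der U (op_der T a))"
    by (rule ext) (simp add: commutator_def op_der_simps op_mult(1)[OF T1 U1] op_mult(1)[OF U1 T1])
  have vec: "op_vec (commutator T U) = op_der T (op_vec U) - op_der U (op_vec T)"
    by (simp add: commutator_def op_vec_simps op_mult(2)[OF T1 U1] op_mult(2)[OF U1 T1])
  have "op_der (commutator T U) \<in> Der_plus g n"
    by (rule op_der_Der_plusI[OF TU])
      (auto simp: der Alg_diff T.der_Alg U.der_Alg T.der_mult U.der_mult T.der_add U.der_add Alg_mult
         Lie_diff T.der_Lie U.der_Lie algebra_simps)
  moreover have "op_vec (commutator T U) - div_lift g n (op_der (commutator T U)) \<in> commA g n"
  proof -
    let ?dT = "div_lift g n (op_der T)" and ?dU = "div_lift g n (op_der U)"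
    have dA: "?dT \<in> Alg g n" "?dU \<in> Alg g n"
      using Filt_Alg[OF div_lift_Filt] T.der_Filt U.der_Filt by blast+
    have "op_vec (commutator T U) - div_lift g n (op_der (commutator T U)) =
      op_der T (op_vec U - ?dU) - op_der U (op_vec T - ?dT) -
      (div_lift g n (op_der (commutator T U)) - (op_der T ?dU - op_der U ?dT))"
      using div_opsD(3)[OF T] div_opsD(3)[OF U] dA by (simp add: vec T.der_diff U.der_diff)
    moreover have "op_der T (op_vec U - ?dU) \<in> commA g n" "op_der U (op_vec T - ?dT) \<in> commA g n"
      using T.der_commA U.der_commA div_opsD(4)[OF T] div_opsD(4)[OF U] by blast+
    moreover have "div_lift g n (op_der (commutator T U)) - (op_der T ?dU - op_der U ?dT) \<in> commA g n"
      unfolding der by (rule div_lift_commutator[OF T.Der_plus U.Der_plus])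
    ultimately show ?thesis by (simp only: commA_diff)
  qed
  moreover have "op_vec (commutator T U) \<in> Alg g n"
    unfolding vec using div_opsD(3)[OF T] div_opsD(3)[OF U] by (intro Alg_diff T.der_Alg U.der_Alg)
  ultimately show ?thesis using TU by (simp add: div_ops_def)
qed

text \<open>The limit step for Baker--Campbell--Hausdorff in the operator ring. Every condition
  holds for the partial sums \<open>S N\<close>, and replacing \<open>T\<close> by
  \<open>S N\<close> costs an error in \<open>Filt g n N\<close>; the Leibniz rule then follows by
  separatedness, the other conditions by closedness of \<open>Lie\<close> and
  \<open>commA\<close>.\<close>

lemma div_ops_closed:
  assumes z: "lop.sums_to z T" "\<And>m. z m \<in> div_ops g n" "z 0 = 0"
  shows "T \<in> div_ops g n"
proof -
  define S where "S = (\<lambda>N. \<Sum>m<N. z m)"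
  have 0: "(0 :: 'a lin_op) \<in> div_ops g n" using z(2)[of 0] z(3) by simp
  have S: "S N \<in> div_ops g n" for N
    unfolding S_def by (induction N) (simp_all add: 0 div_ops_add z(2))
  have R: "T - S N \<in> oFl N" for N using z(1) by (simp add: lop.sums_to_def S_def)
  have T1: "T \<in> oFl 1"
    using lop.Fl_add[OF R[of 1] div_opsD(1)[OF S[of 1]]] by simp
  have ST: "op_der T a = op_der (S N) a + op_der (T - S N) a" "op_vec T = op_vec (S N) + op_vec (T - S N)" for N a
    by (simp_all add: op_der_simps op_vec_simps)
  have Rcf: "cf (op_der (T - S N) a) w = 0" "cf (op_vec (T - S N)) w = 0" if "wtw w < N" for N a w
    using ncs_geD[OF op_der_ge[OF R, of a 0 N]] ncs_geD[OF op_vec_ge[OF R], of w N] that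
    by (simp_all add: ncs_ge_def)
  \<comment> \<open>Lying in \<open>A\<close> is a condition on each coefficient separately, so each
    word may use its own partial sum: \<open>S (Suc (wtw w))\<close> agrees with \<open>T\<close> at
    \<open>w\<close>.\<close>
  have AlgI: "b \<in> Alg g n" if b: "\<And>w. \<exists>c\<in>Alg g n. cf b w = cf c w" for b :: "'a ser"
    unfolding Alg_def
  proof (intro CollectI allI impI)
    fix w assume "cf b w \<noteq> 0"
    moreover obtain c where "c \<in> Alg g n" "cf b w = cf c w" using b[of w] by blast
    ultimately show "set w \<subseteq> gens g n" by (simp add: Alg_def)
  qed
  have A: "op_der T a \<in> Alg g n" if "a \<in> Alg g n" for a
  proof (rule AlgI)
    fix w
    have "op_der (S (Suc (wtw w))) a \<in> Alg g n"
      by (rule linear_on_AlgD(1)[OF alg_der.linear[OF div_opsD(5)[OF S]] that])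
    then show "\<exists>c\<in>Alg g n. cf (op_der T a) w = cf c w"
      using ST(1)[of a "Suc (wtw w)"] Rcf(1)[of w "Suc (wtw w)"] by (intro bexI) simp_all
  qed
  have vA: "op_vec T \<in> Alg g n"
  proof (rule AlgI)
    fix w
    show "\<exists>c\<in>Alg g n. cf (op_vec T) w = cf c w"
      using ST(2)[of "Suc (wtw w)"] Rcf(2)[of w "Suc (wtw w)"]
      by (intro bexI[OF _ div_opsD(3)[OF S[of "Suc (wtw w)"]]]) simp
  qed
  have SA: "op_der (S N) a \<in> Alg g n" if "a \<in> Alg g n" for N a
    by (rule linear_on_AlgD(1)[OF alg_der.linear[OF div_opsD(5)[OF S]] that])
  have RA: "op_der (T - S N) a \<in> Alg g n" if "a \<in> Alg g n" for N a
    using A SA that by (simp add: op_der_simps Alg_diff)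
  have RF: "op_der (T - S N) a \<in> Filt g n (k + N)" if "a \<in> Filt g n k" for N a k
    by (rule op_der_Filt[OF R RA that])
  have "op_der T \<in> Der_plus g n"
  proof (rule op_der_Der_plusI[OF T1 A])
    fix a b :: "'a ser" assume ab: "a \<in> Alg g n" "b \<in> Alg g n"
    have "op_der T (a * b) - (op_der T a * b + a * op_der T b) \<in> Filt g n N" for N
    proof -
      have "op_der (S N) (a * b) = op_der (S N) a * b + a * op_der (S N) b"
        using alg_der.der_mult[OF div_opsD(5)[OF S]] ab by blast
      then have "op_der T (a * b) - (op_der T a * b + a * op_der T b) =
        op_der (T - S N) (a * b) - (op_der (T - S N) a * b + a * op_der (T - S N) b)"
        by (simp add: op_der_simps algebra_simps)
      moreover have "\<dots> \<in> Filt g n N"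
        using RF[of a 0 N] RF[of b 0 N] RF[of "a * b" 0 N] ab
        by (simp add: Filt_diff Filt_add Filt_mult_left Filt_mult_right Alg_mult del: op_der_simps)
      ultimately show ?thesis by simp
    qed
    then have "op_der T (a * b) - (op_der T a * b + a * op_der T b) = 0" by (rule Filt_separated)
    then show "op_der T (a * b) = op_der T a * b + a * op_der T b" by simp
  next
    fix a :: "'a ser" assume a: "a \<in> Lie g n"
    show "op_der T a \<in> Lie g n"
    proof (rule closed_in_AlgD[OF closed_Lie A[OF Lie_Alg[OF a]]])
      fix N
      have "op_der T a - op_der (S N) a \<in> Filt g n N"
        using RF[of a 0 N] Lie_Alg[OF a] by (simp add: op_der_simps)
      then show "\<exists>b\<in>Lie g n. op_der T a - b \<in> Filt g n N"
        using alg_der.der_Lie[OF div_opsD(5)[OF S] a] by blast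
    qed
  qed
  moreover have "op_vec T - div_lift g n (op_der T) \<in> commA g n"
  proof (rule closed_in_AlgD[OF closed_commA])
    have "div_lift g n (op_der T) \<in> Filt g n 1"
      by (rule div_lift_Filt) (rule op_der_Filt[OF T1 A])
    then show "op_vec T - div_lift g n (op_der T) \<in> Alg g n" using vA Filt_Alg Alg_diff by blast
    fix N
    have "op_vec T - div_lift g n (op_der T) - (op_vec (S N) - div_lift g n (op_der (S N))) =
      op_vec (T - S N) - div_lift g n (op_der (T - S N))"
      by (simp add: op_vec_simps div_lift_op)
    moreover have "op_vec (T - S N) \<in> Filt g n N"
      using op_vec_ge[OF R] vA div_opsD(3)[OF S[of N]] by (simp add: Filt_eq op_vec_simps Alg_diff)
    moreover have "div_lift g n (op_der (T - S N)) \<in> Filt g n N"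
      by (rule div_lift_Filt) (rule RF)
    ultimately have "op_vec T - div_lift g n (op_der T) - (op_vec (S N) - div_lift g n (op_der (S N))) \<in> Filt g n N"
      by (simp add: Filt_diff)
    then show "\<exists>b\<in>commA g n. op_vec T - div_lift g n (op_der T) - b \<in> Filt g n N"
      using div_opsD(4)[OF S[of N]] by blast
  qed
  ultimately show ?thesis using T1 vA by (simp add: div_ops_def)
qed

section \<open>The group cocycle j\<close>

definition j_series :: "('k::field_char_0 ser \<Rightarrow> 'k ser) \<Rightarrow> 'k ser \<Rightarrow> 'k ser" where
  "j_series u d = Ncs (\<lambda>w. \<Sum>k\<le>wtw w. cf ((u ^^ k) d) w / fact (k + 1))"

lemma j_exp_eq: "j_exp g n u = cyc g n (j_series u (div_lift g n u))"
  by (simp add: j_exp_def j_series_def)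

lemma j_series_Alg:
  assumes "alg_der g n u" "d \<in> Alg g n" shows "j_series u d \<in> Alg g n"
  using Alg_Ncs_sum[of "\<lambda>k. (u ^^ k) d" g n "\<lambda>k. 1 / fact (k + 1)" wtw] alg_der.funpow_Alg[OF assms]
  by (simp add: j_series_def)

text \<open>\<open>j_series u d\<close> is \<open>((e^u - 1) / u) d\<close>. A derivation preserves
  \<open>commA\<close>, so the class depends only on that of \<open>d\<close>; the lift is kept as
  an argument because the operators in \<open>div_ops\<close> carry arbitrary lifts of the
  divergence.\<close>

lemma j_series_commA:
  assumes u: "alg_der g n u" and d: "d \<in> Alg g n" "e \<in> Alg g n" "d - e \<in> commA g n"
  shows "j_series u d - j_series u e \<in> commA g n"
proof (rule closed_in_AlgD[OF closed_commA])
  interpret alg_der g n u by (rule u)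
  show "j_series u d - j_series u e \<in> Alg g n" using u d by (simp add: Alg_diff j_series_Alg)
  fix N
  have diff: "(u ^^ k) (d - e) = (u ^^ k) d - (u ^^ k) e" for k
    by (induction k) (simp_all add: der_diff funpow_Alg d)
  have F: "(u ^^ k) (d - e) \<in> Filt g n k" for k
    using funpow_Filt[of "d - e" 0 k] d by (simp add: Alg_diff)
  let ?s = "\<Sum>k<N. (1 / fact (k + 1)) \<odot> (u ^^ k) (d - e)"
  have "j_series u d - j_series u e - ?s = Ncs (\<lambda>w. \<Sum>k\<le>wtw w. cf ((1 / fact (k + 1)) \<odot> (u ^^ k) (d - e)) w) - ?s"
    by (rule ncs_eqI) (simp add: j_series_def diff diff_divide_distrib sum_subtractf)
  moreover have "\<dots> \<in> ncs_ge wtw N"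
    by (rule ncs_ge_complete) (use Filt_smul[OF F] in \<open>simp add: Filt_eq\<close>)
  ultimately have "j_series u d - j_series u e - ?s \<in> ncs_ge wtw N" by (simp only:)
  moreover have "j_series u d - j_series u e - ?s \<in> Alg g n"
    using u d by (intro Alg_diff j_series_Alg Alg_sum Alg_smul Filt_Alg[OF F])
  ultimately have "j_series u d - j_series u e - ?s \<in> Filt g n N"
    by (simp only: Filt_eq IntI)
  moreover have "?s \<in> commA g n" by (intro commA_sum commA_smul funpow_commA d)
  ultimately show "\<exists>b\<in>commA g n. j_series u d - j_series u e - b \<in> Filt g n N" by blast
qed

lemma j_series_cong:
  assumes "\<And>a. a \<in> Alg g n \<Longrightarrow> u a = v a" "\<And>a. a \<in> Alg g n \<Longrightarrow> v a \<in> Alg g n" "d \<in> Alg g n"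
  shows "j_series u d = j_series v d"
proof -
  have "(u ^^ k) d = (v ^^ k) d" for k using funpow_cong_Alg[of g n u v d k] assms by blast
  then show ?thesis by (simp add: j_series_def)
qed

lemma div_lift_cong:
  assumes "\<And>a. a \<in> Alg g n \<Longrightarrow> u a = v a"
  shows "div_lift g n u = div_lift g n v"
  unfolding div_lift_def by (rule sum.cong) (simp_all add: assms Alg_letter)

lemma ap_ex_vec:
  assumes T: "T \<in> div_ops g n"
  shows "ap (lop.ex T) (0, 1) = (j_series (op_der T) (op_vec T), 1)"
proof (rule prod_eqI)
  interpret T: alg_der g n "op_der T" using T by (rule div_opsD)
  note T1 = div_opsD(1)[OF T]
  have v1: "op_vec T \<in> Filt g n 1" using op_vec_ge[OF T1] div_opsD(3)[OF T] by (simp add: Filt_eq)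
  show "fst (ap (lop.ex T) (0, 1)) = fst (j_series (op_der T) (op_vec T), 1 :: 'a)"
  proof (rule ncs_eqI)
    fix w
    have 0: "cf (fst (ap (T ^ 0) (0, 1))) w = 0" by simp
    have "cf (fst (ap (lop.ex T) (0, 1))) w = (\<Sum>k\<le>wtw w. 1 / fact k * cf (fst (ap (T ^ k) (0, 1))) w)"
      unfolding lop.ex_def ap_app(1)[OF T1] by simp
    also have "\<dots> = (\<Sum>k<wtw w. 1 / fact (Suc k) * cf (fst (ap (T ^ Suc k) (0, 1))) w)"
      by (subst lessThan_Suc_atMost[symmetric], subst sum.lessThan_Suc_shift) (simp only: 0, simp)
    also have "\<dots> = (\<Sum>k<wtw w. cf ((op_der T ^^ k) (op_vec T)) w / fact (k + 1))"
      by (simp only: op_power(2)[OF T1]) simp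
    \<comment> \<open>The term \<open>k = wtw w\<close> may be added: \<open>op_vec T\<close> has
      positive weight, so \<open>k\<close> applications of \<open>op_der T\<close> lead to weight
      above \<open>wtw w\<close>.\<close>
    also have "\<dots> = (\<Sum>k\<le>wtw w. cf ((op_der T ^^ k) (op_vec T)) w / fact (k + 1))"
      using FiltD[OF T.funpow_Filt[OF v1, of "wtw w"], of w] by (simp add: lessThan_Suc_atMost[symmetric])
    finally show "cf (fst (ap (lop.ex T) (0, 1))) w = cf (fst (j_series (op_der T) (op_vec T), 1 :: 'a)) w"
      by (simp add: j_series_def)
  qed
  show "snd (ap (lop.ex T) (0, 1)) = snd (j_series (op_der T) (op_vec T), 1 :: 'a)"
    unfolding lop.ex_def ap_app(2)[OF T1] by simp
qed

lemma mkop_div_ops: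
  assumes u: "u \<in> Der_plus g n"
  shows "mkop g n u (div_lift g n u) \<in> div_ops g n"
proof -
  interpret u: alg_der g n u by unfold_locales (rule u)
  let ?T = "mkop g n u (div_lift g n u)"
  have d: "div_lift g n u \<in> Filt g n 1" by (rule div_lift_Filt) (rule u.der_Filt)
  have T: "?T \<in> oFl 1" by (rule mkop_oFl[OF u.linear u.der_Filt d])
  have der: "op_der ?T a = u a" if "a \<in> Alg g n" for a
    by (rule op_der_mkop[OF u.linear u.der_Filt that])
  have vec: "op_vec ?T = div_lift g n u" by (rule op_vec_mkop[OF u.linear u.der_Filt])
  have "op_der ?T \<in> Der_plus g n"
    by (rule op_der_Der_plusI[OF T]) (simp_all add: der Lie_Alg Alg_mult u.der_Alg u.der_Lie u.der_mult)
  moreover have "div_lift g n (op_der ?T) = div_lift g n u" by (rule div_lift_cong[OF der])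
  ultimately show ?thesis using T vec Filt_Alg[OF d] by (simp add: div_ops_def commA_zero)
qed

text \<open>Both columns of \<open>e^W = e^T e^U\<close> are read off: on \<open>(a, 0)\<close> it
  is the composition law for exponentials, on \<open>(0, 1)\<close> the cocycle identity for
  \<open>j\<close>. That \<open>W\<close> again consists of a derivation and a lift of its
  divergence is Baker--Campbell--Hausdorff inside \<open>div_ops\<close>.\<close>

theorem exp_der_compose:
  assumes u: "u \<in> Der_plus g n" and v: "v \<in> Der_plus g n"
  obtains w where "w \<in> Der_plus g n"
    "\<And>a. a \<in> Alg g n \<Longrightarrow> exp_der g n w a = exp_der g n u (exp_der g n v a)"
    "j_series w (div_lift g n w) - (j_series u (div_lift g n u) + exp_der g n u (j_series v (div_lift g n v))) \<in> commA g n"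
proof -
  interpret u: alg_der g n u by unfold_locales (rule u)
  interpret v: alg_der g n v by unfold_locales (rule v)
  define T where "T = mkop g n u (div_lift g n u)"
  define U where "U = mkop g n v (div_lift g n v)"
  have T: "T \<in> div_ops g n" and U: "U \<in> div_ops g n"
    unfolding T_def U_def using u v by (simp_all add: mkop_div_ops)
  have derT: "op_der T a = u a" if "a \<in> Alg g n" for a
    unfolding T_def by (rule op_der_mkop[OF u.linear u.der_Filt that])
  have derU: "op_der U a = v a" if "a \<in> Alg g n" for a
    unfolding U_def by (rule op_der_mkop[OF v.linear v.der_Filt that])
  have vec: "op_vec T = div_lift g n u" "op_vec U = div_lift g n v"
    by (simp_all only: T_def U_def op_vec_mkop[OF u.linear u.der_Filt] op_vec_mkop[OF v.linear v.der_Filt])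
  note T1 = div_opsD(1)[OF T] and U1 = div_opsD(1)[OF U]
  define W where "W = lop.lg (lop.ex T * lop.ex U)"
  \<comment> \<open>Here the terms only have to stay in \<open>div_ops\<close>, so the same set
    serves as \<open>L\<close> and as \<open>L'\<close>.\<close>
  obtain z where z: "lop.sums_to z W" "\<And>m. z m \<in> div_ops g n" "z 0 = 0"
    unfolding W_def
    by (rule lop.Baker_Campbell_Hausdorff[OF T1 U1 T U, of "div_ops g n"])
      (simp_all add: div_ops_add div_ops_scal div_ops_commutator)
  have W: "W \<in> div_ops g n" by (rule div_ops_closed[OF z])
  interpret W: alg_der g n "op_der W" using W by (rule div_opsD)
  have "lop.ex U \<in> oFl 0"
    using lop.Fl_add[OF lop.Fl_le[OF lop.ex_Fl[OF U1]] lop.Fl_one] by simp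
  then have "(lop.ex T - 1) * lop.ex U \<in> oFl 1"
    by (rule lop.Fl_mult_le[OF lop.ex_Fl[OF T1]]) simp
  from lop.Fl_add[OF this lop.ex_Fl[OF U1]] have "lop.ex T * lop.ex U - 1 \<in> oFl 1"
    by (simp add: algebra_simps)
  then have exW: "lop.ex W = lop.ex T * lop.ex U" unfolding W_def by (rule lop.ex_lg)
  have expT: "exp_der g n (op_der T) = exp_der g n u" and expU: "exp_der g n (op_der U) = exp_der g n v"
    by (rule exp_der_cong; simp add: derT derU u.der_Alg v.der_Alg)+
  have exT: "ap (lop.ex T) (a, 0) = (exp_der g n u a, 0)" and exU: "ap (lop.ex U) (a, 0) = (exp_der g n v a, 0)"
    if "a \<in> Alg g n" for a
    using that by (simp_all add: ap_ex[OF T1] ap_ex[OF U1] expT expU)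
  have expA: "exp_der g n v a \<in> Alg g n" if "a \<in> Alg g n" for a
    using that Alg_Ncs_sum[of "\<lambda>k. (v ^^ k) a" g n "\<lambda>k. 1 / fact k" wtw] by (simp add: exp_der_def v.funpow_Alg)
  have dA: "div_lift g n u \<in> Alg g n" "div_lift g n v \<in> Alg g n" "div_lift g n (op_der W) \<in> Alg g n"
    using Filt_Alg[OF div_lift_Filt] u.der_Filt v.der_Filt W.der_Filt by blast+
  have jA: "j_series v (div_lift g n v) \<in> Alg g n"
    by (rule j_series_Alg) (unfold_locales, rule v, rule dA)
  have "exp_der g n (op_der W) a = exp_der g n u (exp_der g n v a)" if "a \<in> Alg g n" for a
    using ap_ex[OF div_opsD(1)[OF W] that] by (simp add: exW exT exU expA that)
  moreover have "j_series (op_der W) (op_vec W) =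
      j_series u (div_lift g n u) + exp_der g n u (j_series v (div_lift g n v))"
  proof -
    have jT: "j_series (op_der T) (op_vec T) = j_series u (div_lift g n u)"
      unfolding vec by (rule j_series_cong[OF derT u.der_Alg dA(1)])
    have jU: "j_series (op_der U) (op_vec U) = j_series v (div_lift g n v)"
      unfolding vec by (rule j_series_cong[OF derU v.der_Alg dA(2)])
    have "ap (lop.ex W) (0, 1) = ap (lop.ex T) (ap (lop.ex U) (0, 1))" by (simp add: exW)
    also have "\<dots> = ap (lop.ex T) ((j_series v (div_lift g n v), 0) + (0, 1))"
      by (simp add: ap_ex_vec[OF U] jU)
    also have "\<dots> = (exp_der g n u (j_series v (div_lift g n v)) + j_series u (div_lift g n u), 1)"
      unfolding ap_add exT[OF jA] ap_ex_vec[OF T] jT by simp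
    finally show ?thesis by (simp add: ap_ex_vec[OF W])
  qed
  \<comment> \<open>The vector part of \<open>W\<close> is only a lift of the divergence, so
    \<open>div_lift\<close> may replace it modulo \<open>commA\<close>.\<close>
  moreover have "j_series (op_der W) (div_lift g n (op_der W)) - j_series (op_der W) (op_vec W) \<in> commA g n"
  proof (rule j_series_commA[OF div_opsD(5)[OF W] dA(3) div_opsD(3)[OF W]])
    show "div_lift g n (op_der W) - op_vec W \<in> commA g n"
      using commA_uminus[OF div_opsD(4)[OF W]] by simp
  qed
  ultimately show thesis using that[OF W.Der_plus] by simp
qed

subsection \<open>Logarithms of automorphisms\<close>

text \<open>\<open>X choose k\<close> as a polynomial. With \<open>N = F - 1\<close> the binomial
  theorem gives \<open>F^m = \<Sum>k. (m choose k) N^k\<close>, so each coefficient of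
  \<open>F^m(a)\<close> is polynomial in \<open>m\<close>.\<close>

definition binom_poly :: "nat \<Rightarrow> 'k::field_char_0 poly" where
  "binom_poly k = smult (1 / fact k) (\<Prod>i<k. [:- of_nat i, 1:])"

lemma poly_binom_poly: "poly (binom_poly k) (of_nat m) = (of_nat (m choose k) :: 'k::field_char_0)"
  by (simp add: binom_poly_def poly_prod binomial_gbinomial gbinomial_prod_rev atLeast0LessThan)

lemma binom_poly_Suc: "binom_poly (Suc k) = smult (1 / of_nat (Suc k)) (binom_poly k * [:- of_nat k, 1:])"
  unfolding binom_poly_def
  by (simp only: prod.lessThan_Suc mult_smult_left smult_smult fact_Suc of_nat_mult
      times_divide_times_eq mult_1 of_nat_fact)

lemma coeff_binom_poly_0: "coeff (binom_poly k :: 'k::field_char_0 poly) 0 = (if k = 0 then 1 else 0)"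
proof (cases k)
  case (Suc k')
  have "poly (binom_poly k :: 'k poly) (of_nat 0) = of_nat (0 choose k)" by (rule poly_binom_poly)
  then show ?thesis using Suc by (simp add: poly_0_coeff_0)
qed (simp add: binom_poly_def)

text \<open>The derivative of \<open>X choose k\<close> at 0 is \<open>(-1)^(k-1) / k\<close> for
  \<open>k > 0\<close>, the coefficient of \<open>log (1 + X)\<close>. So differentiating
  \<open>F^m\<close> at \<open>m = 0\<close> produces the series \<open>log (1 + N)\<close>.\<close>

lemma coeff_binom_poly_1: "coeff (binom_poly k :: 'k::field_char_0 poly) 1 = fps_nth (fps_ln 1) k"
proof (induction k)
  case 0
  then show ?case by (simp add: binom_poly_def)
next
  case (Suc k)
  have "coeff (binom_poly k * [:- of_nat k, 1:]) 1 = (coeff (binom_poly k) 0 - of_nat k * coeff (binom_poly k) 1 :: 'k)"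
    by (simp add: coeff_mult)
  then show ?case
    unfolding binom_poly_Suc coeff_smult Suc.IH coeff_binom_poly_0
    by (cases k) (simp_all add: fps_ln_nth del: of_nat_Suc)
qed

lemma poly_eq_of_nat:
  fixes p q :: "'k::field_char_0 poly"
  assumes "\<And>m. poly p (of_nat m) = poly q (of_nat m)"
  shows "p = q"
proof -
  have "range of_nat \<subseteq> {x. poly (p - q) x = 0}" using assms by auto
  moreover have "infinite (range (of_nat :: nat \<Rightarrow> 'k))" by (simp add: range_inj_infinite inj_of_nat)
  ultimately have "p - q = 0" using poly_roots_finite finite_subset by blast
  then show ?thesis by simp
qed

context
  fixes g n :: nat and F :: "'k::field_char_0 ser \<Rightarrow> 'k ser"
  assumes F: "F \<in> Aut_plus g n"
begin

interpretation alg_hom g n F using F by (rule Aut_plus_alg_hom)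

abbreviation (input) "N \<equiv> \<lambda>a. F a - a"

lemma N_linear: "linear_on_Alg g n N"
  unfolding linear_on_Alg_def
  by (auto simp: hom_Alg hom_add hom_smul Alg_diff ncs.scale_right_diff_distrib)

lemma N_Filt: "a \<in> Filt g n m \<Longrightarrow> N a \<in> Filt g n (m + 1)"
  by (rule Aut_plus_raises[OF F])

lemma N_funpow_Filt: "a \<in> Alg g n \<Longrightarrow> (N ^^ k) a \<in> Filt g n k"
proof (induction k)
  case (Suc k)
  then show ?case using N_Filt[of "(N ^^ k) a" k] by simp
qed simp

lemma F_funpow_Alg: "a \<in> Alg g n \<Longrightarrow> (F ^^ m) a \<in> Alg g n"
  by (induction m) (simp_all add: hom_Alg)

lemma F_funpow_mult: "a \<in> Alg g n \<Longrightarrow> b \<in> Alg g n \<Longrightarrow> (F ^^ m) (a * b) = (F ^^ m) a * (F ^^ m) b"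
  by (induction m) (simp_all add: hom_mult F_funpow_Alg)

lemma F_funpow_add: "a \<in> Alg g n \<Longrightarrow> b \<in> Alg g n \<Longrightarrow> (F ^^ m) (a + b) = (F ^^ m) a + (F ^^ m) b"
  by (induction m) (simp_all add: hom_add F_funpow_Alg)

lemma cf_F_funpow:
  assumes "a \<in> Alg g n"
  shows "cf ((F ^^ m) a) w = (\<Sum>k\<le>wtw w. of_nat (m choose k) * cf ((N ^^ k) a) w)"
  using assms
proof (induction m arbitrary: a)
  case 0
  have "(\<Sum>k\<le>wtw w. of_nat (0 choose k) * cf ((N ^^ k) a) w) = (\<Sum>k\<le>wtw w. if k = 0 then cf a w else 0)"
    by (rule sum.cong) (auto simp: binomial_eq_0)
  then show ?case by simp
next
  case (Suc m)
  let ?c = "\<lambda>k. cf ((N ^^ k) a) w"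
  have NA: "N a \<in> Alg g n" using Suc.prems by (rule linear_on_AlgD(1)[OF N_linear])
  have shift: "(N ^^ k) (N a) = (N ^^ Suc k) a" for k by (simp only: funpow_Suc_right o_apply)
  \<comment> \<open>\<open>N^k a\<close> has weight at least \<open>k\<close>; this vanishing term
    lets the upper limit move by one when Pascal's rule shifts the index.\<close>
  have last: "?c (Suc (wtw w)) = 0" using FiltD[OF N_funpow_Filt[OF Suc.prems]] by blast
  have "(F ^^ Suc m) a = (F ^^ m) (a + N a)" by (simp add: funpow_swap1)
  also have "cf \<dots> w = (\<Sum>k\<le>wtw w. of_nat (m choose k) * ?c k) + (\<Sum>k\<le>wtw w. of_nat (m choose k) * ?c (Suc k))"
    unfolding F_funpow_add[OF Suc.prems NA] cf_simps Suc.IH[OF Suc.prems] Suc.IH[OF NA] shift ..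
  also have "(\<Sum>k\<le>wtw w. of_nat (m choose k) * ?c k) = (\<Sum>k\<le>Suc (wtw w). of_nat (m choose k) * ?c k)"
    using last by simp
  also have "\<dots> = ?c 0 + (\<Sum>k\<le>wtw w. of_nat (m choose Suc k) * ?c (Suc k))"
    by (subst sum.atMost_Suc_shift) simp
  also have "\<dots> + (\<Sum>k\<le>wtw w. of_nat (m choose k) * ?c (Suc k)) =
      ?c 0 + (\<Sum>k\<le>wtw w. of_nat (Suc m choose Suc k) * ?c (Suc k))"
    by (simp only: binomial_Suc_Suc of_nat_add distrib_right sum.distrib add.assoc add.commute add.left_commute)
  also have "\<dots> = (\<Sum>k\<le>Suc (wtw w). of_nat (Suc m choose k) * ?c k)"
    by (subst sum.atMost_Suc_shift) simp
  also have "\<dots> = (\<Sum>k\<le>wtw w. of_nat (Suc m choose k) * ?c k)"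
    using last by simp
  finally show ?case .
qed

text \<open>The logarithm is formed in the operator ring, with vector part 0, so that
  \<open>exp (log F) = F\<close> is an instance of \<open>lop.ex_lg\<close>.\<close>

definition aut_log :: "'k ser \<Rightarrow> 'k ser" where
  "aut_log = op_der (lop.lg (1 + mkop g n N 0))"

lemma N_op: "mkop g n N 0 \<in> oFl 1"
  by (rule mkop_oFl[OF N_linear N_Filt Filt_zero])

lemma lg_oFl: "lop.lg (1 + mkop g n N 0) \<in> oFl 1"
  by (rule lop.lg_Fl) (use N_op in simp)

lemma cf_aut_log:
  assumes "a \<in> Alg g n"
  shows "cf (aut_log a) w = (\<Sum>k\<le>wtw w. fps_nth (fps_ln 1) k * cf ((N ^^ k) a) w)"
proof -
  have "(op_der (mkop g n N 0) ^^ k) a = (N ^^ k) a" for k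
    using funpow_cong_Alg[of g n "op_der (mkop g n N 0)" N a k] assms
      op_der_mkop[OF N_linear N_Filt] linear_on_AlgD(1)[OF N_linear] by blast
  then show ?thesis
    unfolding aut_log_def op_der_def[of _ a] lop.lg_def
    by (simp add: ap_app[OF N_op] op_power[OF N_op])
qed

lemma aut_log_Alg: "a \<in> Alg g n \<Longrightarrow> aut_log a \<in> Alg g n"
proof -
  assume a: "a \<in> Alg g n"
  have "aut_log a = Ncs (\<lambda>w. \<Sum>k\<le>wtw w. fps_nth (fps_ln 1) k * cf ((N ^^ k) a) w)"
    by (rule ncs_eqI) (simp add: cf_aut_log[OF a])
  then show ?thesis using Alg_Ncs_sum[of "\<lambda>k. (N ^^ k) a"] Filt_Alg[OF N_funpow_Filt[OF a]] by simp
qed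

text \<open>
  \<open>F\<^sup>m(a)\<close> depends polynomially on \<open>m\<close>, and \<open>log F\<close> is its derivative at \<open>m = 0\<close>. So the Leibniz
  rule for \<open>log F\<close> follows from the multiplicativity of all \<open>F\<^sup>m\<close>.
\<close>

lemma aut_log_mult:
  assumes a: "a \<in> Alg g n" and b: "b \<in> Alg g n"
  shows "aut_log (a * b) = aut_log a * b + a * aut_log b"
proof (rule ncs_eqI)
  fix w
  \<comment> \<open>As a polynomial in \<open>m\<close>, \<open>P a w\<close> has the values
    \<open>cf ((F ^^ m) a) w\<close>, the constant term \<open>cf a w\<close> and the linear
    coefficient \<open>cf (aut_log a) w\<close>. The linear coefficient of a product of polynomials
    has the form of the Leibniz rule.\<close>
  define P where "P = (\<lambda>a w. \<Sum>k\<le>wtw w. smult (cf ((N ^^ k) a) w) (binom_poly k))"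
  have poly: "poly (P a w) (of_nat m) = cf ((F ^^ m) a) w" if "a \<in> Alg g n" for a w m
    by (simp add: P_def poly_sum poly_binom_poly cf_F_funpow[OF that] mult.commute)
  have coeff0: "coeff (P a w) 0 = cf a w" for a w
    by (simp add: P_def coeff_sum coeff_binom_poly_0 if_distrib[of "(*) _"] cong: if_cong)
  have coeff1: "coeff (P a w) 1 = cf (aut_log a) w" if "a \<in> Alg g n" for a w
    by (simp only: P_def coeff_sum coeff_smult coeff_binom_poly_1 cf_aut_log[OF that] mult.commute)
  have "P (a * b) w = (\<Sum>i\<le>length w. P a (take i w) * P b (drop i w))"
    by (rule poly_eq_of_nat)
      (simp add: poly poly_sum a b Alg_mult F_funpow_mult cf_mult)
  then have "coeff (P (a * b) w) 1 =
      (\<Sum>i\<le>length w. coeff (P a (take i w)) 0 * coeff (P b (drop i w)) 1 + coeff (P a (take i w)) 1 * coeff (P b (drop i w)) 0)"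
    by (simp add: coeff_sum coeff_mult)
  then show "cf (aut_log (a * b)) w = cf (aut_log a * b + a * aut_log b) w"
    unfolding coeff0 coeff1[OF a] coeff1[OF b] coeff1[OF Alg_mult[OF a b]]
    by (simp add: cf_mult sum.distrib)
qed

lemma aut_log_Lie:
  assumes a: "a \<in> Lie g n" shows "aut_log a \<in> Lie g n"
proof (rule closed_in_AlgD[OF closed_Lie aut_log_Alg[OF Lie_Alg[OF a]]])
  fix m
  have NL: "(N ^^ k) a \<in> Lie g n" for k
    by (induction k) (simp_all add: a Lie_diff Aut_plus_Lie[OF F])
  let ?s = "\<Sum>k<m. fps_nth (fps_ln 1) k \<odot> (N ^^ k) a"
  have "aut_log a = Ncs (\<lambda>w. \<Sum>k\<le>wtw w. cf (fps_nth (fps_ln 1) k \<odot> (N ^^ k) a) w)"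
    by (rule ncs_eqI) (simp add: cf_aut_log[OF Lie_Alg[OF a]])
  moreover have "Ncs (\<lambda>w. \<Sum>k\<le>wtw w. cf (fps_nth (fps_ln 1) k \<odot> (N ^^ k) a) w) - ?s \<in> ncs_ge wtw m"
    by (rule ncs_ge_complete) (use Filt_smul[OF N_funpow_Filt[OF Lie_Alg[OF a]]] in \<open>simp add: Filt_eq\<close>)
  moreover have "?s \<in> Lie g n" by (intro Lie_sum Lie_smul NL)
  moreover from this have "aut_log a - ?s \<in> Alg g n"
    by (intro Alg_diff aut_log_Alg Lie_Alg a)
  ultimately show "\<exists>b\<in>Lie g n. aut_log a - b \<in> Filt g n m"
    by (intro bexI[of _ ?s]) (simp_all only: Filt_eq IntI)
qed

lemma aut_log_Der_plus: "aut_log \<in> Der_plus g n"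
  unfolding aut_log_def
  by (rule op_der_Der_plusI[OF lg_oFl])
    (simp_all only: aut_log_def[symmetric] aut_log_Alg aut_log_mult aut_log_Lie)

lemma exp_der_aut_log: "exp_der g n aut_log = F"
proof (rule extensionalityI[of _ "Alg g n"])
  show "exp_der g n aut_log \<in> extensional (Alg g n)" by (simp add: exp_der_def)
  show "F \<in> extensional (Alg g n)" using F by (simp add: Aut_plus_def)
  fix a :: "'k ser" assume a: "a \<in> Alg g n"
  have "lop.ex (lop.lg (1 + mkop g n N 0)) = 1 + mkop g n N 0"
    by (rule lop.ex_lg) (use N_op in simp)
  then have "(exp_der g n aut_log a, 0) = ap (1 + mkop g n N 0) (a, 0)"
    using ap_ex[OF lg_oFl a] by (simp add: aut_log_def)
  then show "exp_der g n aut_log a = F a"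
    by (simp add: ap_mkop[OF N_linear N_Filt] proj_Alg_id a)
qed

end

lemma div_lift_Alg: "u \<in> Der_plus g n \<Longrightarrow> div_lift g n u \<in> Alg g n"
  by (rule Filt_Alg[OF div_lift_Filt[of g n u 1]]) (rule alg_der.der_Filt[OF alg_der.intro])

text \<open>The definite description is well defined: two derivations with the same exponential
  agree on \<open>A\<close>, hence have the same divergence and the same series.\<close>

lemma jj_exp_der:
  assumes u: "u \<in> Der_plus g n"
  shows "jj g n (exp_der g n u) = cyc g n (j_series u (div_lift g n u))"
  unfolding jj_def
proof (rule the_equality)
  show "\<exists>v\<in>Der_plus g n. exp_der g n u = exp_der g n v \<and> cyc g n (j_series u (div_lift g n u)) = j_exp g n v"
    using u j_exp_eq by blast
  fix P assume "\<exists>v\<in>Der_plus g n. exp_der g n u = exp_der g n v \<and> P = j_exp g n v"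
  then obtain v where v: "v \<in> Der_plus g n" "exp_der g n u = exp_der g n v" "P = j_exp g n v" by blast
  interpret u: alg_der g n u by unfold_locales (rule u)
  interpret v: alg_der g n v by unfold_locales (rule v(1))
  have eq: "v a = u a" if "a \<in> Alg g n" for a
    by (rule mkop_ex_inj[OF v.linear v.der_Filt u.linear u.der_Filt v(2)[symmetric] that])
  have dA: "div_lift g n u \<in> Alg g n" using u by (rule div_lift_Alg)
  have "div_lift g n v = div_lift g n u" by (rule div_lift_cong[OF eq])
  then show "P = cyc g n (j_series u (div_lift g n u))"
    unfolding v(3) j_exp_eq using j_series_cong[OF eq u.der_Alg dA] by simp
qed

lemma cyc_eq_iff:
  assumes "a \<in> Alg g n" "b \<in> Alg g n"
  shows "cyc g n a = cyc g n b \<longleftrightarrow> a - b \<in> commA g n"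
proof
  assume "cyc g n a = cyc g n b"
  moreover have "a \<in> cyc g n a" using assms commA_zero by (simp add: cyc_def)
  ultimately show "a - b \<in> commA g n" by (simp add: cyc_def)
next
  assume ab: "a - b \<in> commA g n"
  have "c - a \<in> commA g n \<longleftrightarrow> c - b \<in> commA g n" for c
    using commA_add[OF _ ab, of "c - a"] commA_diff[OF _ ab, of "c - b"] by auto
  then show "cyc g n a = cyc g n b" by (simp add: cyc_def)
qed

definition j_rep :: "nat \<Rightarrow> nat \<Rightarrow> ('k::field_char_0 ser \<Rightarrow> 'k ser) \<Rightarrow> 'k ser" where
  "j_rep g n F = j_series (aut_log g n F) (div_lift g n (aut_log g n F))"

lemma j_rep_Alg: "F \<in> Aut_plus g n \<Longrightarrow> j_rep g n F \<in> Alg g n"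
  unfolding j_rep_def
  by (intro j_series_Alg div_lift_Alg) (simp_all add: alg_der_def aut_log_Der_plus)

lemma jj_eq: "F \<in> Aut_plus g n \<Longrightarrow> jj g n F = cyc g n (j_rep g n F)"
  using jj_exp_der[OF aut_log_Der_plus, of F g n] by (simp add: exp_der_aut_log j_rep_def)

theorem j_rep_cocycle:
  assumes F: "F \<in> Aut_plus g n" and G: "G \<in> Aut_plus g n"
  shows "j_rep g n (compose (Alg g n) F G) - (j_rep g n F + F (j_rep g n G)) \<in> commA g n"
proof -
  let ?u = "aut_log g n F" and ?v = "aut_log g n G"
  obtain w where w: "w \<in> Der_plus g n"
    "\<And>a. a \<in> Alg g n \<Longrightarrow> exp_der g n w a = exp_der g n ?u (exp_der g n ?v a)"
    "j_series w (div_lift g n w) - (j_series ?u (div_lift g n ?u) + exp_der g n ?u (j_series ?v (div_lift g n ?v))) \<in> commA g n"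
    using exp_der_compose[OF aut_log_Der_plus[OF F] aut_log_Der_plus[OF G]] by blast
  let ?H = "compose (Alg g n) F G"
  have H: "?H \<in> Aut_plus g n" using F G by (rule Aut_plus_compose)
  interpret w: alg_der g n w by unfold_locales (rule w(1))
  have "exp_der g n w = ?H"
    using w(2) by (intro extensionalityI[of _ "Alg g n"])
      (simp_all add: exp_der_aut_log[OF F] exp_der_aut_log[OF G] compose_def, simp add: exp_der_def)
  \<comment> \<open>\<open>w\<close> need not be the chosen logarithm of the composite; as the
    exponentials coincide, \<open>jj_exp_der\<close> identifies the classes.\<close>
  then have "cyc g n (j_rep g n ?H) = cyc g n (j_series w (div_lift g n w))"
    using jj_exp_der[OF w(1)] jj_eq[OF H] by simp
  moreover have "j_series w (div_lift g n w) \<in> Alg g n"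
    by (intro j_series_Alg w.alg_der_axioms div_lift_Alg w(1))
  ultimately have "j_rep g n ?H - j_series w (div_lift g n w) \<in> commA g n"
    using cyc_eq_iff j_rep_Alg[OF H] by blast
  from commA_add[OF this w(3)] show ?thesis
    unfolding j_rep_def[of g n F] j_rep_def[of g n G] exp_der_aut_log[OF F]
    by (simp only: add_diff_eq diff_add_cancel)
qed

subsection \<open>Torsors inside a group\<close>

text \<open>\<open>E\<close> is a torsor under \<open>K\<close> as soon as it is stable and all
  quotients \<open>y x^(-1)\<close> lie in \<open>K\<close>: the quotient moves \<open>x\<close> to
  \<open>y\<close>, and cancellation in \<open>G\<close> gives freeness. The maps are restricted to
  \<open>E\<close> because elements of \<open>BijGroup E\<close> are extensional.\<close>

lemma (in group) free_transitive_left: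
  assumes K: "subgroup K G" and E: "E \<subseteq> carrier G"
    and KE: "\<And>k x. k \<in> K \<Longrightarrow> x \<in> E \<Longrightarrow> k \<otimes> x \<in> E"
    and EE: "\<And>x y. x \<in> E \<Longrightarrow> y \<in> E \<Longrightarrow> y \<otimes> inv x \<in> K"
  shows "free_transitive_left_action (G\<lparr>carrier := K\<rparr>) E (\<lambda>k. \<lambda>x\<in>E. k \<otimes> x)"
proof -
  let ?\<phi> = "\<lambda>k. \<lambda>x\<in>E. k \<otimes> x"
  have KG: "k \<in> carrier G" if "k \<in> K" for k using subgroup.mem_carrier[OF K that] .
  have EG: "x \<in> carrier G" if "x \<in> E" for x using E that by blast
  have cancel: "inv k \<otimes> (k \<otimes> x) = x" "k \<otimes> (inv k \<otimes> x) = x" if "k \<in> K" "x \<in> E" for k x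
    using KG[OF that(1)] EG[OF that(2)] by (simp_all add: m_assoc[symmetric])
  have bij: "bij_betw (?\<phi> k) E E" if k: "k \<in> K" for k
    using k KE subgroup.m_inv_closed[OF K k] cancel[OF k]
    by (intro bij_betw_byWitness[where f' = "?\<phi> (inv k)"]) auto
  have "?\<phi> \<in> hom (G\<lparr>carrier := K\<rparr>) (BijGroup E)"
  proof (rule homI)
    show B: "?\<phi> k \<in> carrier (BijGroup E)" if "k \<in> carrier (G\<lparr>carrier := K\<rparr>)" for k
      using bij that by (simp add: BijGroup_def Bij_def)
    fix k l assume kl: "k \<in> carrier (G\<lparr>carrier := K\<rparr>)" "l \<in> carrier (G\<lparr>carrier := K\<rparr>)"
    have "?\<phi> (k \<otimes> l) = compose E (?\<phi> k) (?\<phi> l)"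
      by (rule ext) (use kl KE KG EG m_assoc in \<open>auto simp: compose_def\<close>)
    then show "?\<phi> (k \<otimes>\<^bsub>G\<lparr>carrier := K\<rparr>\<^esub> l) = ?\<phi> k \<otimes>\<^bsub>BijGroup E\<^esub> ?\<phi> l"
      using B[OF kl(1)] B[OF kl(2)] by (simp add: BijGroup_def)
  qed
  then have act: "group_action (G\<lparr>carrier := K\<rparr>) E ?\<phi>"
    unfolding group_action_def group_hom_def group_hom_axioms_def
    using subgroup_imp_group[OF K] group_BijGroup by blast
  have "transitive_action (G\<lparr>carrier := K\<rparr>) E ?\<phi>"
    unfolding transitive_action_def transitive_action_axioms_def
  proof (intro conjI allI impI act)
    fix x y assume xy: "x \<in> E" "y \<in> E"
    have "y \<otimes> inv x \<otimes> x = y" using EG[OF xy(1)] EG[OF xy(2)] by (simp add: m_assoc)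
    then show "\<exists>k\<in>carrier (G\<lparr>carrier := K\<rparr>). ?\<phi> k x = y" using xy EE[OF xy] by auto
  qed
  moreover have "stabilizer (G\<lparr>carrier := K\<rparr>) ?\<phi> x = {\<one>}" if x: "x \<in> E" for x
  proof -
    have "k = \<one>" if "k \<in> K" "k \<otimes> x = x" for k
      using r_cancel_one'[of x k] that KG EG[OF x] by auto
    then have "{k \<in> K. k \<otimes> x = x} = {\<one>}"
      using subgroup.one_closed[OF K] l_one[OF EG[OF x]] by blast
    then show ?thesis using x by (simp add: stabilizer_def)
  qed
  ultimately show ?thesis by (simp add: free_transitive_left_action_def)
qed

lemma (in group) group_opposite_group: "group (opposite_group G)"
proof (rule groupI)
  fix x assume "x \<in> carrier (opposite_group G)"
  then show "\<exists>y\<in>carrier (opposite_group G). y \<otimes>\<^bsub>opposite_group G\<^esub> x = \<one>\<^bsub>opposite_group G\<^esub>"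
    by (intro bexI[of _ "inv x"]) (simp_all add: opposite_group_def)
qed (simp_all add: opposite_group_def m_assoc)

text \<open>The left version in the opposite group, where the quotient \<open>y x^(-1)\<close>
  becomes \<open>x^(-1) y\<close>.\<close>

lemma (in group) free_transitive_right:
  assumes K: "subgroup K G" and E: "E \<subseteq> carrier G"
    and EK: "\<And>k x. k \<in> K \<Longrightarrow> x \<in> E \<Longrightarrow> x \<otimes> k \<in> E"
    and EE: "\<And>x y. x \<in> E \<Longrightarrow> y \<in> E \<Longrightarrow> inv x \<otimes> y \<in> K"
  shows "free_transitive_right_action (G\<lparr>carrier := K\<rparr>) E (\<lambda>k. \<lambda>x\<in>E. x \<otimes> k)"
proof -
  let ?O = "opposite_group G"
  interpret O: group ?O by (rule group_opposite_group)
  have inv: "inv\<^bsub>?O\<^esub> x = inv x" if "x \<in> carrier G" for x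
    using that by (intro O.inv_equality) (simp_all add: opposite_group_def)
  have subO: "subgroup K ?O"
    by (rule O.subgroupI)
      (use K inv in \<open>auto simp: opposite_group_def subgroup.subset subgroup.m_inv_closed
        subgroup.m_closed subgroup.mem_carrier dest: subgroup.one_closed\<close>)
  have "free_transitive_left_action (?O\<lparr>carrier := K\<rparr>) E (\<lambda>k. \<lambda>x\<in>E. k \<otimes>\<^bsub>?O\<^esub> x)"
  proof (rule O.free_transitive_left[OF subO])
    show "y \<otimes>\<^bsub>?O\<^esub> inv\<^bsub>?O\<^esub> x \<in> K" if "x \<in> E" "y \<in> E" for x y
      using EE[OF that] inv[of x] E that(1) by (auto simp: opposite_group_def)
  qed (use E EK in \<open>auto simp: opposite_group_def\<close>)
  moreover have "opposite_group (G\<lparr>carrier := K\<rparr>) = ?O\<lparr>carrier := K\<rparr>"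
    by (cases G) (simp add: opposite_group_def)
  moreover have "x \<otimes>\<^bsub>?O\<^esub> y = y \<otimes> x" for x y by (simp add: opposite_group_def)
  ultimately show ?thesis
    using subgroup_imp_group[OF K] by (simp add: free_transitive_right_action_def)
qed

lemma (in group) conjugation_iso:
  assumes H: "H \<subseteq> carrier G" and K: "K \<subseteq> carrier G" and f: "f \<in> carrier G"
    and KH: "\<And>k. k \<in> K \<Longrightarrow> inv f \<otimes> k \<otimes> f \<in> H" and HK: "\<And>h. h \<in> H \<Longrightarrow> f \<otimes> h \<otimes> inv f \<in> K"
  shows "(\<lambda>k. inv f \<otimes> k \<otimes> f) \<in> iso (G\<lparr>carrier := K\<rparr>) (G\<lparr>carrier := H\<rparr>)"
proof -
  have cancel: "f \<otimes> (inv f \<otimes> x) = x" "inv f \<otimes> (f \<otimes> x) = x" if "x \<in> carrier G" for x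
    using f that by (simp_all add: m_assoc[symmetric])
  have "(\<lambda>k. inv f \<otimes> k \<otimes> f) \<in> hom (G\<lparr>carrier := K\<rparr>) (G\<lparr>carrier := H\<rparr>)"
    by (rule homI) (use KH K f cancel in \<open>auto simp: m_assoc subset_iff\<close>)
  moreover have "bij_betw (\<lambda>k. inv f \<otimes> k \<otimes> f) K H"
    using KH HK K H f cancel
    by (intro bij_betw_byWitness[where f' = "\<lambda>h. f \<otimes> h \<otimes> inv f"]) (auto simp: m_assoc subset_iff)
  ultimately show ?thesis by (simp add: iso_def)
qed

subsection \<open>Cyclic words\<close>

text \<open>Equality in \<open>|A|\<close> as a relation on lifts, so that it can enter chains of
  transitive reasoning.\<close>

definition ceq :: "nat \<Rightarrow> nat \<Rightarrow> 'k::field_char_0 ser \<Rightarrow> 'k ser \<Rightarrow> bool" where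
  "ceq g n a b \<longleftrightarrow> a - b \<in> commA g n"

lemma ceq_refl: "ceq g n a a"
  by (simp add: ceq_def commA_zero)

lemma ceq_sym: "ceq g n a b \<Longrightarrow> ceq g n b a"
  unfolding ceq_def by (metis commA_uminus minus_diff_eq)

lemma ceq_trans [trans]: "ceq g n a b \<Longrightarrow> ceq g n b c \<Longrightarrow> ceq g n a c"
  unfolding ceq_def using commA_add[of "a - b" g n "b - c"] by simp

lemma ceq_add: "ceq g n a b \<Longrightarrow> ceq g n c d \<Longrightarrow> ceq g n (a + c) (b + d)"
  unfolding ceq_def using commA_add[of "a - b" g n "c - d"] by (simp add: add_diff_add)

lemma ceq_diff: "ceq g n a b \<Longrightarrow> ceq g n c d \<Longrightarrow> ceq g n (a - c) (b - d)"
  unfolding ceq_def using commA_diff[of "a - b" g n "c - d"] by (simp add: algebra_simps)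

lemma ceq_image:
  assumes "F \<in> Aut_plus g n" "a \<in> Alg g n" "b \<in> Alg g n" "ceq g n a b"
  shows "ceq g n (F a) (F b)"
proof -
  interpret alg_hom g n F using assms(1) by (rule Aut_plus_alg_hom)
  show ?thesis using assms hom_commA[of "a - b"] by (simp add: ceq_def hom_diff)
qed

lemma cyc_eq_ceq: "a \<in> Alg g n \<Longrightarrow> b \<in> Alg g n \<Longrightarrow> cyc g n a = cyc g n b \<longleftrightarrow> ceq g n a b"
  by (simp add: cyc_eq_iff ceq_def)

lemma cyc_plus_cyc:
  assumes "a \<in> Alg g n" "b \<in> Alg g n"
  shows "cyc g n a \<boxplus> cyc g n b = cyc g n (a + b)"
proof
  show "cyc g n a \<boxplus> cyc g n b \<subseteq> cyc g n (a + b)"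
  proof
    fix x assume "x \<in> cyc g n a \<boxplus> cyc g n b"
    then obtain c d where "x = c + d" "c \<in> cyc g n a" "d \<in> cyc g n b" by (auto simp: cyc_plus_def)
    then show "x \<in> cyc g n (a + b)"
      using commA_add[of "c - a" g n "d - b"] by (simp add: cyc_def Alg_add add_diff_add)
  qed
  show "cyc g n (a + b) \<subseteq> cyc g n a \<boxplus> cyc g n b"
  proof
    fix x assume "x \<in> cyc g n (a + b)"
    then have "x - b \<in> cyc g n a" "b \<in> cyc g n b"
      using assms by (simp_all add: cyc_def Alg_diff commA_zero algebra_simps)
    then show "x \<in> cyc g n a \<boxplus> cyc g n b"
      unfolding cyc_plus_def by (intro CollectI exI[of _ "x - b"] exI[of _ b]) simp
  qed
qed

lemma cyc_minus_cyc:
  assumes "a \<in> Alg g n" "b \<in> Alg g n"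
  shows "cyc g n a \<boxminus> cyc g n b = cyc g n (a - b)"
proof
  show "cyc g n a \<boxminus> cyc g n b \<subseteq> cyc g n (a - b)"
  proof
    fix x assume "x \<in> cyc g n a \<boxminus> cyc g n b"
    then obtain c d where x: "x = c - d" and cd: "c \<in> cyc g n a" "d \<in> cyc g n b" by (auto simp: cyc_minus_def)
    have eq: "c - d - (a - b) = (c - a) - (d - b)" by simp
    have "c - d - (a - b) \<in> commA g n"
      unfolding eq by (rule commA_diff) (use cd in \<open>simp_all add: cyc_def\<close>)
    then show "x \<in> cyc g n (a - b)"
      using cd unfolding x by (simp add: cyc_def Alg_diff)
  qed
  show "cyc g n (a - b) \<subseteq> cyc g n a \<boxminus> cyc g n b"
  proof
    fix x assume "x \<in> cyc g n (a - b)"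
    then have "x + b \<in> cyc g n a" "b \<in> cyc g n b"
      using assms by (simp_all add: cyc_def Alg_add commA_zero algebra_simps)
    then show "x \<in> cyc g n a \<boxminus> cyc g n b"
      unfolding cyc_minus_def by (intro CollectI exI[of _ "x + b"] exI[of _ b]) simp
  qed
qed

text \<open>The image of a coset is a whole coset and not just part of one, because the inverse
  automorphism preserves \<open>[A, A]\<close> as well.\<close>

lemma cyc_image:
  assumes F: "F \<in> Aut_plus g n" and a: "a \<in> Alg g n"
  shows "F ` cyc g n a = cyc g n (F a)"
proof -
  interpret F: alg_hom g n F using F by (rule Aut_plus_alg_hom)
  let ?I = "Aut_inv g n F"
  have I: "?I \<in> Aut_plus g n" using F by (rule Aut_inv_Aut_plus)
  show ?thesis
  proof
    show "F ` cyc g n a \<subseteq> cyc g n (F a)"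
    proof (rule image_subsetI)
      fix b assume "b \<in> cyc g n a"
      then show "F b \<in> cyc g n (F a)"
        using F.hom_commA[of "b - a"] a by (simp add: cyc_def F.hom_Alg F.hom_diff)
    qed
    show "cyc g n (F a) \<subseteq> F ` cyc g n a"
    proof
      fix c assume "c \<in> cyc g n (F a)"
      then have c: "c \<in> Alg g n" "ceq g n c (F a)" by (simp_all add: cyc_def ceq_def)
      then have "ceq g n (?I c) a"
        using ceq_image[OF I c(1) F.hom_Alg[OF a] c(2)] Aut_inv_left[OF F a] by simp
      then have "?I c \<in> cyc g n a" using Aut_inv_Alg[OF F c(1)] by (simp add: cyc_def ceq_def)
      then show "c \<in> F ` cyc g n a" using Aut_inv_right[OF F c(1)] by (metis imageI)
    qed
  qed
qed

section \<open>Lifts of the terms in the Kashiwara--Vergne equations\<close>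

definition q_rep :: "nat \<Rightarrow> nat \<Rightarrow> (gen \<Rightarrow> int) \<Rightarrow> 'k::field_char_0 ser" where
  "q_rep g n \<rho> = (\<Sum>i\<in>{1..g}. fps_app r_fps (letter (X i)) + fps_app r_fps (letter (Y i))) -
     (\<Sum>i\<in>{1..g}. of_int (\<rho> (X i)) \<odot> letter (Y i) - of_int (\<rho> (Y i)) \<odot> letter (X i))"

definition jgr_rep :: "nat \<Rightarrow> nat \<Rightarrow> (gen \<Rightarrow> int) \<Rightarrow> 'k::field_char_0 taut \<Rightarrow> 'k ser" where
  "jgr_rep g n \<rho> F = j_rep g n (fst F) - c_rep n \<rho> F"

definition duflo_rep :: "nat \<Rightarrow> (nat \<Rightarrow> 'k fps) \<Rightarrow> 'k fps \<Rightarrow> 'k::field_char_0 ser \<Rightarrow> 'k ser" where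
  "duflo_rep n hs h a = (\<Sum>j\<in>{1..n}. fps_app (hs j) (letter (Z j))) - fps_app h a"

lemma letter_XY_Alg: "i \<in> {1..g} \<Longrightarrow> letter (X i) \<in> Alg g n" "i \<in> {1..g} \<Longrightarrow> letter (Y i) \<in> Alg g n"
  by (rule Alg_letter, simp add: gens_def)+

lemma q_rep_Alg: "q_rep g n \<rho> \<in> Alg g n"
  unfolding q_rep_def
  by (intro Alg_diff Alg_sum Alg_add Alg_smul Alg_fps_app letter_XY_Alg)

lemma rp_cyc: "r_cyc g n \<boxminus> p_cyc g n \<rho> = cyc g n (q_rep g n \<rho>)"
  unfolding r_cyc_def p_cyc_def q_rep_def
  by (intro cyc_minus_cyc Alg_sum Alg_diff Alg_add Alg_smul Alg_fps_app letter_XY_Alg)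

lemma tAut_plusD:
  assumes "F \<in> carrier (tAut_plus g n)"
  shows "fst F \<in> Aut_plus g n" "alg_hom g n (fst F)"
    "\<And>j. j \<in> {1..n} \<Longrightarrow> snd F j \<in> expL g n"
    "\<And>j. j \<in> {1..n} \<Longrightarrow> fst F (letter (Z j)) = ncs_inv (snd F j) * letter (Z j) * snd F j"
  using assms Aut_plus_alg_hom[of "fst F" g n] by (auto simp: tAut_plus_simps)

lemma jgr_rep_Alg: "F \<in> carrier (tAut_plus g n) \<Longrightarrow> jgr_rep g n \<rho> F \<in> Alg g n"
  unfolding jgr_rep_def by (intro Alg_diff j_rep_Alg c_rep_Alg tAut_plusD)

lemma j_gr_eq: "F \<in> carrier (tAut_plus g n) \<Longrightarrow> j_gr g n \<rho> F = cyc g n (jgr_rep g n \<rho> F)"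
  unfolding j_gr_def jgr_rep_def c_cyc_def c_rep_def[symmetric]
  by (simp add: jj_eq tAut_plusD cyc_minus_cyc j_rep_Alg c_rep_Alg)

lemma R_f_eq:
  assumes F: "F \<in> carrier (tAut_plus g n)"
  shows "R_f g n \<rho> F = cyc g n (jgr_rep g n \<rho> F + fst F (q_rep g n \<rho>))"
proof -
  interpret alg_hom g n "fst F" using F by (rule tAut_plusD)
  show ?thesis
    unfolding R_f_def
    by (simp add: j_gr_eq[OF F] rp_cyc cyc_image tAut_plusD[OF F] q_rep_Alg cyc_plus_cyc jgr_rep_Alg[OF F] hom_Alg)
qed

lemma j_f_eq:
  assumes F: "F \<in> carrier (tAut_plus g n)"
  shows "j_f g n \<rho> F = cyc g n (jgr_rep g n \<rho> F + fst F (q_rep g n \<rho>) - q_rep g n \<rho>)"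
proof -
  interpret alg_hom g n "fst F" using F by (rule tAut_plusD)
  have "j_f g n \<rho> F = R_f g n \<rho> F \<boxminus> cyc g n (q_rep g n \<rho>)"
    unfolding j_f_def R_f_def j_gr_def rp_cyc ..
  then show ?thesis
    by (simp add: R_f_eq[OF F] cyc_minus_cyc jgr_rep_Alg[OF F] hom_Alg q_rep_Alg Alg_add)
qed

lemma duflo_rep_Alg: "a \<in> Alg g n \<Longrightarrow> duflo_rep n hs h a \<in> Alg g n"
  unfolding duflo_rep_def by (intro Alg_diff Alg_sum Alg_fps_app letter_Z_Alg)

lemma duflo_sum_eq: "a \<in> Alg g n \<Longrightarrow> duflo_sum g n hs h a = cyc g n (duflo_rep n hs h a)"
  unfolding duflo_sum_def duflo_rep_def by (intro cyc_minus_cyc Alg_sum Alg_fps_app letter_Z_Alg)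

lemma jgr_rep_cocycle:
  assumes F: "F \<in> carrier (tAut_plus g n)" and G: "G \<in> carrier (tAut_plus g n)"
  shows "ceq g n (jgr_rep g n \<rho> (F \<otimes>\<^bsub>tAut_plus g n\<^esub> G)) (jgr_rep g n \<rho> F + fst F (jgr_rep g n \<rho> G))"
proof -
  interpret alg_hom g n "fst F" using F by (rule tAut_plusD)
  have "ceq g n (j_rep g n (fst (F \<otimes>\<^bsub>tAut_plus g n\<^esub> G))) (j_rep g n (fst F) + fst F (j_rep g n (fst G)))"
    using j_rep_cocycle[OF tAut_plusD(1)[OF F] tAut_plusD(1)[OF G]] by (simp add: ceq_def tAut_plus_simps(2))
  moreover have "ceq g n (c_rep n \<rho> (F \<otimes>\<^bsub>tAut_plus g n\<^esub> G)) (c_rep n \<rho> F + fst F (c_rep n \<rho> G))"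
    using c_rep_cocycle[OF F G] by (simp add: ceq_def)
  ultimately have "ceq g n (jgr_rep g n \<rho> (F \<otimes>\<^bsub>tAut_plus g n\<^esub> G))
      (j_rep g n (fst F) + fst F (j_rep g n (fst G)) - (c_rep n \<rho> F + fst F (c_rep n \<rho> G)))"
    unfolding jgr_rep_def by (rule ceq_diff)
  then show ?thesis
    by (simp add: jgr_rep_def hom_diff j_rep_Alg tAut_plusD(1)[OF G] c_rep_Alg[OF G] algebra_simps)
qed

text \<open>Conjugation by \<open>f\<close> is a continuous algebra endomorphism, so it commutes
  with substitution into series.\<close>

lemma fps_app_conjugate:
  assumes f: "f \<in> expL g n" and a: "a \<in> Filt g n 1"
  shows "fps_app h (ncs_inv f * a * f) = ncs_inv f * fps_app h a * f"
proof -
  have fA: "f \<in> Alg g n" "ncs_inv f \<in> Alg g n" using f expL_inverse(1) expL_Alg by blast+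
  have inv: "f * (ncs_inv f * b) = b" for b
    using expL_inverse(3)[OF f] by (simp add: mult.assoc[symmetric])
  interpret conj: alg_hom g n "\<lambda>a. ncs_inv f * a * f"
  proof
    show "linear_on_Alg g n (\<lambda>a. ncs_inv f * a * f)"
      unfolding linear_on_Alg_def
      by (auto simp: Alg_mult fA smul_mult_left smul_mult_right distrib_left distrib_right)
    show "continuous_on_Alg g n (\<lambda>a. ncs_inv f * a * f)"
      unfolding continuous_on_Alg_def
      by (auto intro!: Filt_mult_right[OF Filt_mult_left] fA)
  qed (simp_all add: expL_inverse[OF f] mult.assoc inv)
  show ?thesis
    by (rule conj.hom_fps_app[symmetric, OF a]) (intro Filt_mult_right Filt_mult_left fA a)
qed

lemma letter_Z_Filt: "j \<in> {1..n} \<Longrightarrow> letter (Z j) \<in> Filt g n 1"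
  using Filt_le[OF Filt_letter[of "Z j" g n], of 1] by (simp add: gens_def)

text \<open>This is where the tangential form of \<open>F\<close> enters: \<open>h_j(z_j)\<close> is
  mapped to a conjugate of itself, which has the same class in \<open>|A|\<close>, while
  \<open>h(a)\<close> becomes \<open>h(F a)\<close>. Hence Duflo sums are transported with unchanged
  functions.\<close>

lemma duflo_rep_image:
  assumes F: "F \<in> carrier (tAut_plus g n)" and a: "a \<in> Filt g n 1"
  shows "ceq g n (fst F (duflo_rep n hs h a)) (duflo_rep n hs h (fst F a))"
proof -
  note F1 = tAut_plusD(1)[OF F]
  interpret alg_hom g n "fst F" using F by (rule tAut_plusD)
  have app: "fst F (fps_app k b) = fps_app k (fst F b)" if "b \<in> Filt g n 1" for k b
    by (rule hom_fps_app[OF that Aut_plus_Filt[OF F1 that]])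
  have sumA: "(\<Sum>j\<in>{1..n}. fps_app (hs j) (letter (Z j))) \<in> Alg g n"
    by (intro Alg_sum Alg_fps_app letter_Z_Alg)
  have sum: "fst F (\<Sum>j\<in>{1..n}. fps_app (hs j) (letter (Z j))) =
      (\<Sum>j\<in>{1..n}. fst F (fps_app (hs j) (letter (Z j))))"
    by (rule hom_sum) (intro Alg_fps_app letter_Z_Alg)
  have "fst F (duflo_rep n hs h a) =
      (\<Sum>j\<in>{1..n}. fst F (fps_app (hs j) (letter (Z j)))) - fps_app h (fst F a)"
    unfolding duflo_rep_def sum[symmetric]
    by (simp only: hom_diff sumA Alg_fps_app Filt_Alg[OF a] app[OF a])
  then have "fst F (duflo_rep n hs h a) - duflo_rep n hs h (fst F a) =
      (\<Sum>j\<in>{1..n}. fst F (fps_app (hs j) (letter (Z j))) - fps_app (hs j) (letter (Z j)))"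
    by (simp add: duflo_rep_def sum_subtractf)
  also have "\<dots> \<in> commA g n"
  proof (rule commA_sum)
    fix j assume j: "j \<in> {1..n}"
    let ?f = "snd F j" and ?b = "fps_app (hs j) (letter (Z j)) :: 'a ser"
    have f: "?f \<in> expL g n" using F j by (rule tAut_plusD)
    have "fst F ?b = ncs_inv ?f * ?b * ?f"
      unfolding app[OF letter_Z_Filt[OF j]] tAut_plusD(4)[OF F j]
      by (rule fps_app_conjugate[OF f letter_Z_Filt[OF j]])
    then have "fst F ?b - ?b = commutator (ncs_inv ?f) (?b * ?f)"
      using expL_inverse(3)[OF f] by (simp add: commutator_def mult.assoc)
    moreover have "?b \<in> Alg g n" "?f \<in> Alg g n" "ncs_inv ?f \<in> Alg g n"
      using j f expL_inverse(1)[OF f] expL_Alg Alg_fps_app letter_Z_Alg by blast+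
    ultimately show "fst F ?b - ?b \<in> commA g n" by (simp add: commA_commutator Alg_mult)
  qed
  finally show ?thesis by (simp add: ceq_def)
qed

lemma fps_app_linear:
  "fps_app (h + k) a = fps_app h a + fps_app k a" "fps_app (- h) a = - fps_app h a" "fps_app 0 a = 0"
  by (rule ncs_eqI; simp add: fps_app_def distrib_right sum.distrib sum_negf)+

lemma duflo_rep_linear:
  "duflo_rep n (\<lambda>j. hs j + ks j) (h + k) a = duflo_rep n hs h a + duflo_rep n ks k a"
  "duflo_rep n (\<lambda>j. - hs j) (- h) a = - duflo_rep n hs h a"
  "duflo_rep n (\<lambda>j. 0) 0 a = 0"
  by (simp_all add: duflo_rep_def fps_app_linear sum.distrib sum_negf)

subsection \<open>The Kashiwara--Vergne groupoid\<close>

text \<open>The Duflo functions are arguments and not existentially bound, since they have to be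
  followed through composition and inversion.\<close>

definition kv_morphism where
  "kv_morphism g n \<rho> a e a' e' hs h F \<longleftrightarrow> F \<in> carrier (tAut_plus g n) \<and> duflo_admissible n hs h \<and>
     fst F a = a' \<and> ceq g n (jgr_rep g n \<rho> F + fst F e) (e' + duflo_rep n hs h a')"

lemma fst_mult_tAut: "a \<in> Alg g n \<Longrightarrow> fst (F \<otimes>\<^bsub>tAut_plus g n\<^esub> G) a = fst F (fst G a)"
  by (simp add: tAut_plus_simps(2) compose_def)

lemma fst_one_tAut: "a \<in> Alg g n \<Longrightarrow> fst \<one>\<^bsub>tAut_plus g n\<^esub> a = a"
  by (simp add: tAut_plus_simps(3))

text \<open>Write \<open>J = j - c\<close>. In \<open>|A|\<close> the cocycle property gives
  \<open>J(GF) + GF(e) = J(G) + G(J(F) + F(e))\<close>. The equation for \<open>F\<close> is pushed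
  forward by \<open>G\<close>, its Duflo sum moving from \<open>a'\<close> to \<open>a''\<close>,
  and the equation for \<open>G\<close> finishes.\<close>

lemma kv_morphism_mult:
  assumes F: "kv_morphism g n \<rho> a e a' e' hs h F" and G: "kv_morphism g n \<rho> a' e' a'' e'' ks k G"
    and A: "a \<in> Filt g n 1" "e \<in> Alg g n" "e' \<in> Alg g n"
  shows "kv_morphism g n \<rho> a e a'' e'' (\<lambda>j. hs j + ks j) (h + k) (G \<otimes>\<^bsub>tAut_plus g n\<^esub> F)"
proof -
  let ?T = "tAut_plus g n :: 'a taut monoid" and ?j = "jgr_rep g n \<rho>"
  interpret T: group ?T by (rule group_tAut_plus)
  have FT: "F \<in> carrier ?T" "fst F a = a'" "ceq g n (?j F + fst F e) (e' + duflo_rep n hs h a')"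
    and GT: "G \<in> carrier ?T" "fst G a' = a''" "ceq g n (?j G + fst G e') (e'' + duflo_rep n ks k a'')"
    and adm: "duflo_admissible n hs h" "duflo_admissible n ks k"
    using F G by (simp_all add: kv_morphism_def)
  interpret F: alg_hom g n "fst F" using FT(1) by (rule tAut_plusD)
  interpret G: alg_hom g n "fst G" using GT(1) by (rule tAut_plusD)
  have a': "a' \<in> Filt g n 1" using Aut_plus_Filt[OF tAut_plusD(1)[OF FT(1)] A(1)] FT(2) by simp
  have D: "duflo_rep n hs h a' \<in> Alg g n" using a' by (intro duflo_rep_Alg Filt_Alg)
  have "ceq g n (?j (G \<otimes>\<^bsub>?T\<^esub> F) + fst G (fst F e)) (?j G + fst G (?j F) + fst G (fst F e))"
    by (rule ceq_add[OF jgr_rep_cocycle[OF GT(1) FT(1)] ceq_refl])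
  also have "?j G + fst G (?j F) + fst G (fst F e) = ?j G + fst G (?j F + fst F e)"
    by (simp add: G.hom_add jgr_rep_Alg[OF FT(1)] F.hom_Alg A)
  also have "ceq g n \<dots> (?j G + fst G (e' + duflo_rep n hs h a'))"
    by (rule ceq_add[OF ceq_refl ceq_image[OF tAut_plusD(1)[OF GT(1)] _ _ FT(3)]])
      (simp_all add: Alg_add jgr_rep_Alg[OF FT(1)] F.hom_Alg A D)
  also have "?j G + fst G (e' + duflo_rep n hs h a') = (?j G + fst G e') + fst G (duflo_rep n hs h a')"
    by (simp add: G.hom_add A D add.assoc)
  also have "ceq g n \<dots> (e'' + duflo_rep n ks k a'' + duflo_rep n hs h a'')"
    by (rule ceq_add[OF GT(3)]) (use duflo_rep_image[OF GT(1) a', of hs h] GT(2) in simp)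
  finally have "ceq g n (?j (G \<otimes>\<^bsub>?T\<^esub> F) + fst (G \<otimes>\<^bsub>?T\<^esub> F) e)
      (e'' + duflo_rep n (\<lambda>j. hs j + ks j) (h + k) a'')"
    by (simp add: fst_mult_tAut A(2) duflo_rep_linear(1) add.assoc add.commute[of "duflo_rep n ks k a''"])
  then show ?thesis
    using FT GT adm fst_mult_tAut[OF Filt_Alg[OF A(1)], of G F] by (simp add: kv_morphism_def duflo_admissible_def)
qed

text \<open>The cocycle property for the identity composed with itself says that this class equals
  twice itself.\<close>

lemma jgr_rep_one: "ceq g n (jgr_rep g n \<rho> \<one>\<^bsub>tAut_plus g n\<^esub>) 0"
proof -
  let ?T = "tAut_plus g n :: 'a taut monoid"
  interpret T: group ?T by (rule group_tAut_plus)
  have "ceq g n (jgr_rep g n \<rho> \<one>\<^bsub>?T\<^esub>) (jgr_rep g n \<rho> \<one>\<^bsub>?T\<^esub> + jgr_rep g n \<rho> \<one>\<^bsub>?T\<^esub>)"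
    using jgr_rep_cocycle[OF T.one_closed T.one_closed, of \<rho>]
    unfolding T.l_one[OF T.one_closed] fst_one_tAut[OF jgr_rep_Alg[OF T.one_closed]] .
  from ceq_diff[OF ceq_sym[OF this] ceq_refl[of g n "jgr_rep g n \<rho> \<one>\<^bsub>?T\<^esub>"]]
  show ?thesis by simp
qed

lemma kv_morphism_one:
  assumes "a \<in> Filt g n 1" "e \<in> Alg g n"
  shows "kv_morphism g n \<rho> a e a e (\<lambda>j. 0) 0 \<one>\<^bsub>tAut_plus g n\<^esub>"
proof -
  interpret T: group "tAut_plus g n :: 'a taut monoid" by (rule group_tAut_plus)
  have "ceq g n (jgr_rep g n \<rho> \<one>\<^bsub>tAut_plus g n\<^esub> + e) (0 + e)"
    by (rule ceq_add[OF jgr_rep_one ceq_refl])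
  then show ?thesis
    using T.one_closed fst_one_tAut[OF assms(2)] fst_one_tAut[OF Filt_Alg[OF assms(1)]]
    by (simp add: kv_morphism_def duflo_admissible_def duflo_rep_linear(3))
qed

text \<open>With \<open>J = j - c\<close>, the cocycle property for \<open>F^(-1) F = 1\<close>
  gives \<open>J(F^(-1)) = - F^(-1)(J(F))\<close> in \<open>|A|\<close>. The equation for
  \<open>F\<close>, pushed forward by \<open>F^(-1)\<close>, then supplies the Duflo sum at
  \<open>a\<close> with opposite sign.\<close>

lemma kv_morphism_inv:
  assumes F: "kv_morphism g n \<rho> a e a' e' hs h F"
    and A: "a \<in> Filt g n 1" "e \<in> Alg g n" "e' \<in> Alg g n"
  shows "kv_morphism g n \<rho> a' e' a e (\<lambda>j. - hs j) (- h) (inv\<^bsub>tAut_plus g n\<^esub> F)"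
proof -
  let ?T = "tAut_plus g n :: 'a taut monoid" and ?j = "jgr_rep g n \<rho>"
  interpret T: group ?T by (rule group_tAut_plus)
  let ?I = "inv\<^bsub>?T\<^esub> F"
  have FT: "F \<in> carrier ?T" "fst F a = a'" "ceq g n (?j F + fst F e) (e' + duflo_rep n hs h a')"
    and adm: "duflo_admissible n hs h"
    using F by (simp_all add: kv_morphism_def)
  have IT: "?I \<in> carrier ?T" using FT(1) by (rule T.inv_closed)
  interpret F: alg_hom g n "fst F" using FT(1) by (rule tAut_plusD)
  interpret I: alg_hom g n "fst ?I" using IT by (rule tAut_plusD)
  have IF: "fst ?I (fst F b) = b" if "b \<in> Alg g n" for b
    using fst_mult_tAut[OF that, of ?I F] fst_one_tAut[OF that] unfolding T.l_inv[OF FT(1)] by simp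
  have aA: "a \<in> Alg g n" using A(1) by (rule Filt_Alg)
  have a': "a' \<in> Filt g n 1" using Aut_plus_Filt[OF tAut_plusD(1)[OF FT(1)] A(1)] FT(2) by simp
  have D: "duflo_rep n hs h a' \<in> Alg g n" using a' by (intro duflo_rep_Alg Filt_Alg)
  have Ia': "fst ?I a' = a" using IF[OF aA] FT(2) by simp
  have "ceq g n (?j ?I + fst ?I (?j F)) 0"
    using ceq_trans[OF ceq_sym[OF jgr_rep_cocycle[OF IT FT(1), of \<rho>, unfolded T.l_inv[OF FT(1)]]] jgr_rep_one] .
  moreover have "ceq g n (fst ?I (?j F) + e) (fst ?I e' + duflo_rep n hs h a)"
  proof -
    have "fst ?I (?j F) + e = fst ?I (?j F + fst F e)"
      by (simp add: I.hom_add jgr_rep_Alg[OF FT(1)] F.hom_Alg A IF)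
    also have "ceq g n \<dots> (fst ?I (e' + duflo_rep n hs h a'))"
      by (rule ceq_image[OF tAut_plusD(1)[OF IT] _ _ FT(3)]) (simp_all add: Alg_add jgr_rep_Alg[OF FT(1)] F.hom_Alg A D)
    also have "fst ?I (e' + duflo_rep n hs h a') = fst ?I e' + fst ?I (duflo_rep n hs h a')"
      by (simp add: I.hom_add A D)
    also have "ceq g n \<dots> (fst ?I e' + duflo_rep n hs h a)"
      by (rule ceq_add[OF ceq_refl]) (use duflo_rep_image[OF IT a', of hs h] Ia' in simp)
    finally show ?thesis .
  qed
  ultimately have "ceq g n (?j ?I + fst ?I (?j F) - (fst ?I (?j F) + e)) (0 - (fst ?I e' + duflo_rep n hs h a))"
    by (rule ceq_diff)
  from ceq_add[OF this ceq_refl[of g n "e + fst ?I e'"]]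
  have "ceq g n (?j ?I + fst ?I e') (e + duflo_rep n (\<lambda>j. - hs j) (- h) a)"
    by (simp add: duflo_rep_linear algebra_simps)
  then show ?thesis using IT Ia' adm by (simp add: kv_morphism_def duflo_admissible_def)
qed

lemma omega_Filt: "omega g n \<in> Filt g n 1"
  unfolding omega_def
proof (intro Filt_add Filt_sum letter_Z_Filt)
  fix i assume i: "i \<in> {1..g}"
  have "commutator (letter (X i)) (letter (Y i)) \<in> Lie g n"
    by (intro Lie_commutator Lie_letter) (use i in \<open>simp_all add: gens_def\<close>)
  then show "commutator (letter (X i)) (letter (Y i)) \<in> Filt g n 1" by (rule Lie_Filt_1)
qed

lemma xi_Filt: "xi g n \<in> Filt g n 1"
  unfolding xi_def Filt_1_iff
proof (intro conjI cf_ncs_log_Nil Alg_log Alg_mult Alg_prod_list)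
  fix a :: "'a ser"
  show "a \<in> Alg g n" if "a \<in> set (map (\<lambda>i. ncs_exp (letter (X i)) * ncs_exp (letter (Y i)) *
      ncs_exp (- letter (X i)) * ncs_exp (- letter (Y i))) [1..<Suc g])"
    using that letter_XY_Alg[of _ g n] by (auto simp: less_Suc_eq_le intro!: Alg_mult Alg_exp Alg_uminus)
  show "a \<in> Alg g n" if "a \<in> set (map (\<lambda>j. ncs_exp (letter (Z j))) [1..<Suc n])"
    using that letter_Z_Alg[of _ n g] by (auto simp: less_Suc_eq_le intro!: Alg_exp)
qed

lemma omega_Alg: "omega g n \<in> Alg g n" and xi_Alg: "xi g n \<in> Alg g n"
  using omega_Filt xi_Filt by (blast intro: Filt_Alg)+

lemma KV_duflo_iff:
  assumes "F \<in> carrier (tAut_plus g n)" "fst F (xi g n) = xi g n"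
  shows "KV_duflo g n \<rho> F hs h \<longleftrightarrow> kv_morphism g n \<rho> (xi g n) (q_rep g n \<rho>) (xi g n) (q_rep g n \<rho>) hs h F"
proof -
  interpret alg_hom g n "fst F" using assms(1) by (rule tAut_plusD)
  have "ceq g n (a - q) d \<longleftrightarrow> ceq g n a (q + d)" for a q d :: "'a ser"
    by (simp add: ceq_def algebra_simps)
  then show ?thesis
    using assms
    by (simp add: xi_Alg KV_duflo_def kv_morphism_def j_f_eq duflo_sum_eq cyc_eq_ceq Alg_diff Alg_add jgr_rep_Alg
        hom_Alg q_rep_Alg duflo_rep_Alg)
qed

lemma KRV_duflo_iff:
  assumes "F \<in> carrier (tAut_plus g n)" "fst F (omega g n) = omega g n"
  shows "KRV_duflo g n \<rho> F hs h \<longleftrightarrow> kv_morphism g n \<rho> (omega g n) 0 (omega g n) 0 hs h F"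
proof -
  interpret alg_hom g n "fst F" using assms(1) by (rule tAut_plusD)
  show ?thesis
    using assms
    by (simp add: omega_Alg KRV_duflo_def kv_morphism_def j_gr_eq duflo_sum_eq cyc_eq_ceq jgr_rep_Alg hom_zero duflo_rep_Alg)
qed

lemma SolKV_iff:
  "F \<in> SolKV g n \<rho> \<longleftrightarrow> (\<exists>hs h. kv_morphism g n \<rho> (xi g n) (q_rep g n \<rho>) (omega g n) 0 hs h F)"
proof (cases "F \<in> carrier (tAut_plus g n)")
  case True
  interpret alg_hom g n "fst F" using True by (rule tAut_plusD)
  show ?thesis
    using True
    by (simp add: omega_Alg SolKV_def kv_morphism_def R_f_eq duflo_sum_eq cyc_eq_ceq Alg_add jgr_rep_Alg
        hom_Alg q_rep_Alg duflo_rep_Alg) blast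
qed (simp add: SolKV_def kv_morphism_def)

lemma carrier_KV:
  "F \<in> carrier (KV g n \<rho>) \<longleftrightarrow>
     (\<exists>hs h. kv_morphism g n \<rho> (xi g n) (q_rep g n \<rho>) (xi g n) (q_rep g n \<rho>) hs h F)"
  using KV_duflo_iff[of F g n \<rho>] by (auto simp: KV_def) (auto simp: kv_morphism_def)

lemma carrier_KRV:
  "F \<in> carrier (KRV g n \<rho>) \<longleftrightarrow> (\<exists>hs h. kv_morphism g n \<rho> (omega g n) 0 (omega g n) 0 hs h F)"
  using KRV_duflo_iff[of F g n \<rho>] by (auto simp: KRV_def) (auto simp: kv_morphism_def)

lemma subgroup_kv_morphism:
  assumes a: "a \<in> Filt g n 1" and e: "e \<in> Alg g n"
  shows "subgroup {F. \<exists>hs h. kv_morphism g n \<rho> a e a e hs h F} (tAut_plus g n)" (is "subgroup ?S ?T")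
proof -
  interpret T: group ?T by (rule group_tAut_plus)
  show ?thesis
  proof (rule T.subgroupI)
    show "?S \<noteq> {}" using kv_morphism_one[OF a e] by blast
    show "inv\<^bsub>?T\<^esub> F \<in> ?S" if "F \<in> ?S" for F
      using that kv_morphism_inv[OF _ a e e] by blast
    show "F \<otimes>\<^bsub>?T\<^esub> G \<in> ?S" if "F \<in> ?S" "G \<in> ?S" for F G
      using that kv_morphism_mult[OF _ _ a e e] by blast
  qed (auto simp: kv_morphism_def)
qed

theorem theorem8p4:
  fixes S :: "'p::t2_space set" and \<Phi> :: "'p chart set" and B :: "nat \<Rightarrow> 'p set"
    and g n :: nat and pt :: 'p and \<alpha> \<beta> \<gamma> :: "nat \<Rightarrow> real \<Rightarrow> 'p"
    and f :: "'p frame set" and \<rho> :: "gen \<Rightarrow> int"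
    and Sol :: "'k::field_char_0 taut set" and KVgrp KRVgrp T :: "'k taut monoid"
  defines "\<rho> \<equiv> rot S \<Phi> f \<circ> case_gen \<alpha> \<beta> \<gamma>"
    and "Sol \<equiv> SolKV g n \<rho>"
    and "KVgrp \<equiv> KV g n \<rho>"
    and "KRVgrp \<equiv> KRV g n \<rho>"
    and "T \<equiv> tAut_plus g n"
  assumes "compact_connected_oriented_surface S \<Phi>"
    and "has_genus S \<Phi> g"
    and "boundary_labelling S \<Phi> n B"
    and "(g, n) \<noteq> (0, 0)"
    and "pt \<in> B 0"
    and "standard_generating_system S \<Phi> B g n pt \<alpha> \<beta> \<gamma>"
    and "f \<in> framings \<Phi>"
    and "Sol \<noteq> {}"
  shows "free_transitive_right_action KVgrp Sol (\<lambda>H. \<lambda>F\<in>Sol. F \<otimes>\<^bsub>T\<^esub> H)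
    \<and> free_transitive_left_action KRVgrp Sol (\<lambda>G. \<lambda>F\<in>Sol. G \<otimes>\<^bsub>T\<^esub> F)
    \<and> (\<forall>F\<in>Sol.
         (\<lambda>G. inv\<^bsub>T\<^esub> F \<otimes>\<^bsub>T\<^esub> G \<otimes>\<^bsub>T\<^esub> F) \<in> iso KRVgrp KVgrp
         \<and> (\<forall>G\<in>carrier KRVgrp. \<forall>hs h. KRV_duflo g n \<rho> G hs h \<longrightarrow>
              KV_duflo g n \<rho> (inv\<^bsub>T\<^esub> F \<otimes>\<^bsub>T\<^esub> G \<otimes>\<^bsub>T\<^esub> F) hs h))"
proof -
  let ?M = "kv_morphism g n \<rho> :: 'k ser \<Rightarrow> _" and ?\<xi> = "xi g n" and ?\<omega> = "omega g n"
  let ?q = "q_rep g n \<rho>"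
  let ?H = "{F. \<exists>hs h. ?M ?\<xi> ?q ?\<xi> ?q hs h F}" and ?K = "{F. \<exists>hs h. ?M ?\<omega> 0 ?\<omega> 0 hs h F}"
  interpret T: group T unfolding assms(5) by (rule group_tAut_plus)
  have H: "KVgrp = T\<lparr>carrier := ?H\<rparr>" and K: "KRVgrp = T\<lparr>carrier := ?K\<rparr>"
  proof -
    have "carrier KVgrp = ?H" "carrier KRVgrp = ?K"
      unfolding assms(3,4) using carrier_KV[of _ g n \<rho>] carrier_KRV[of _ g n \<rho>] by blast+
    then show "KVgrp = T\<lparr>carrier := ?H\<rparr>" "KRVgrp = T\<lparr>carrier := ?K\<rparr>"
      unfolding assms(3-5) by (simp_all add: KV_def KRV_def)
  qed
  have subH: "subgroup ?H T" and subK: "subgroup ?K T"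
    unfolding assms(5) by (rule subgroup_kv_morphism[OF xi_Filt q_rep_Alg],
        rule subgroup_kv_morphism[OF omega_Filt Alg_zero])
  have Sol: "F \<in> Sol \<longleftrightarrow> (\<exists>hs h. ?M ?\<xi> ?q ?\<omega> 0 hs h F)" for F
    unfolding assms(2) by (rule SolKV_iff)
  \<comment> \<open>Composition with the source fixed at \<open>(\<xi>, r - p)\<close>, and next at
    \<open>(\<omega>, 0)\<close>; this discharges the side conditions on the source once for all
    uses.\<close>
  have mult_\<xi>: "?M ?\<xi> ?q b d (\<lambda>j. hs j + ks j) (h + k) (G \<otimes>\<^bsub>T\<^esub> F)"
    if "?M ?\<xi> ?q a e hs h F" "?M a e b d ks k G" "e \<in> Alg g n" for a e b d hs h ks k F G
    unfolding assms(5) by (rule kv_morphism_mult[OF that(1,2) xi_Filt q_rep_Alg that(3)])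
  have mult_\<omega>: "?M ?\<omega> 0 b d (\<lambda>j. hs j + ks j) (h + k) (G \<otimes>\<^bsub>T\<^esub> F)"
    if "?M ?\<omega> 0 a e hs h F" "?M a e b d ks k G" "e \<in> Alg g n" for a e b d hs h ks k F G
    unfolding assms(5) by (rule kv_morphism_mult[OF that(1,2) omega_Filt Alg_zero that(3)])
  have inv: "?M ?\<omega> 0 ?\<xi> ?q (\<lambda>j. - hs j) (- h) (inv\<^bsub>T\<^esub> F)" if "?M ?\<xi> ?q ?\<omega> 0 hs h F" for hs h F
    unfolding assms(5) by (rule kv_morphism_inv[OF that xi_Filt q_rep_Alg Alg_zero])
  have MT: "F \<in> carrier T" if "?M a e b d hs h F" for a e b d hs h F
    using that unfolding assms(5) kv_morphism_def by blast
  have SolT: "Sol \<subseteq> carrier T" using Sol MT by blast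
  have right: "free_transitive_right_action KVgrp Sol (\<lambda>H. \<lambda>F\<in>Sol. F \<otimes>\<^bsub>T\<^esub> H)"
    unfolding H
  proof (rule T.free_transitive_right[OF subH SolT])
    show "F \<otimes>\<^bsub>T\<^esub> G \<in> Sol" if "G \<in> ?H" "F \<in> Sol" for F G
      using that mult_\<xi>[OF _ _ q_rep_Alg] unfolding Sol by blast
    \<comment> \<open>A loop at \<open>\<xi>\<close>: \<open>G\<close> leads from
      \<open>\<xi>\<close> to \<open>\<omega>\<close>, the inverse of \<open>F\<close> leads
      back.\<close>
    show "inv\<^bsub>T\<^esub> F \<otimes>\<^bsub>T\<^esub> G \<in> ?H" if "F \<in> Sol" "G \<in> Sol" for F G
      using that mult_\<xi>[OF _ inv Alg_zero] unfolding Sol by blast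
  qed
  have left: "free_transitive_left_action KRVgrp Sol (\<lambda>G. \<lambda>F\<in>Sol. G \<otimes>\<^bsub>T\<^esub> F)"
    unfolding K
  proof (rule T.free_transitive_left[OF subK SolT])
    show "G \<otimes>\<^bsub>T\<^esub> F \<in> Sol" if "G \<in> ?K" "F \<in> Sol" for F G
      using that mult_\<xi>[OF _ _ Alg_zero] unfolding Sol by blast
    show "G \<otimes>\<^bsub>T\<^esub> inv\<^bsub>T\<^esub> F \<in> ?K" if "F \<in> Sol" "G \<in> Sol" for F G
      using that mult_\<omega>[OF inv _ q_rep_Alg] unfolding Sol by blast
  qed
  have conj: "?M ?\<xi> ?q ?\<xi> ?q hs h (inv\<^bsub>T\<^esub> F \<otimes>\<^bsub>T\<^esub> G \<otimes>\<^bsub>T\<^esub> F)"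
    if F: "F \<in> Sol" and G: "?M ?\<omega> 0 ?\<omega> 0 hs h G" for F G hs h
  proof -
    obtain ks k where F: "?M ?\<xi> ?q ?\<omega> 0 ks k F" using F unfolding Sol by blast
    \<comment> \<open>Going out along \<open>F\<close> adds \<open>ks\<close> and \<open>k\<close>,
      coming back subtracts them, so exactly the Duflo functions of \<open>G\<close> remain.\<close>
    have "?M ?\<xi> ?q ?\<xi> ?q (\<lambda>j. ks j + hs j + - ks j) (k + h + - k) (inv\<^bsub>T\<^esub> F \<otimes>\<^bsub>T\<^esub> (G \<otimes>\<^bsub>T\<^esub> F))"
      by (rule mult_\<xi>[OF mult_\<xi>[OF F G Alg_zero] inv[OF F] Alg_zero])
    then show ?thesis by (simp add: T.m_assoc MT[OF F] MT[OF G])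
  qed
  \<comment> \<open>The reverse conjugation, which provides the inverse map of the
    isomorphism.\<close>
  have conj': "F \<otimes>\<^bsub>T\<^esub> G \<otimes>\<^bsub>T\<^esub> inv\<^bsub>T\<^esub> F \<in> ?K" if F: "F \<in> Sol" and G: "G \<in> ?H" for F G
  proof -
    obtain ks k hs h where "?M ?\<xi> ?q ?\<omega> 0 ks k F" "?M ?\<xi> ?q ?\<xi> ?q hs h G"
      using F G unfolding Sol by blast
    then show ?thesis using mult_\<omega>[OF inv mult_\<xi>[OF _ _ q_rep_Alg] q_rep_Alg] by blast
  qed
  have "(\<lambda>G. inv\<^bsub>T\<^esub> F \<otimes>\<^bsub>T\<^esub> G \<otimes>\<^bsub>T\<^esub> F) \<in> iso KRVgrp KVgrp" if F: "F \<in> Sol" for F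
    unfolding H K
    by (rule T.conjugation_iso) (use F SolT MT conj[OF F] conj'[OF F] in blast)+
  moreover have "KV_duflo g n \<rho> (inv\<^bsub>T\<^esub> F \<otimes>\<^bsub>T\<^esub> G \<otimes>\<^bsub>T\<^esub> F) hs h"
    if F: "F \<in> Sol" and G: "G \<in> carrier KRVgrp" "KRV_duflo g n \<rho> G hs h" for F G hs h
  proof -
    have "G \<in> carrier (tAut_plus g n)" "fst G ?\<omega> = ?\<omega>" using G(1) unfolding assms(4) KRV_def by auto
    then have "?M ?\<omega> 0 ?\<omega> 0 hs h G" using G(2) KRV_duflo_iff by blast
    then have "?M ?\<xi> ?q ?\<xi> ?q hs h (inv\<^bsub>T\<^esub> F \<otimes>\<^bsub>T\<^esub> G \<otimes>\<^bsub>T\<^esub> F)" by (rule conj[OF F])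
    then show ?thesis by (subst KV_duflo_iff) (simp_all add: kv_morphism_def)
  qed
  ultimately show ?thesis using left right by blast
qed

end
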